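(* Let $N,n,L\ge1$ be integers, let $\Sigma:\mathbb T\to\mathcal H_+^N$ be a continuous function, and let $z\in\mathbb C$. Given a function $M(\eta)\in\mathfrak S^{2N}$, the function $$\mathcal F_{\Sigma,z}(M(\eta),\eta)=\Bigl(\frac1{2\pi}\int_0^{2\pi}\bigl(\mathscr T((I_2\otimes\Sigma(e^{\imath\theta}))M(\eta))+U_L(e^{\imath\theta})\bigr)^{-1}\otimes\Sigma(e^{\imath\theta})\,d\theta-\begin{bmatrix}\eta&z\\ \bar z&\eta\end{bmatrix}\otimes I_N\Bigr)^{-1}$$ is well-defined for $\eta\in\mathbb C_+$ and belongs to $\mathfrak S^{2N}$ as a function of $\eta$. Moreover, the functional equation in the parameter $\eta\in\mathbb C_+$ $$P(z,\eta)=\mathcal F_{\Sigma,z}(P(z,\eta),\eta)$$ admits a unique solution $P(z,\cdot)$ in the class $\mathfrak S^{2N}$. Furthermore, write $P(z,\cdot)=\begin{bmatrix}P_{00}(z,\cdot)&P_{01}(z,\cdot)\\ P_{10}(z,\cdot)&P_{11}(z,\cdot)\end{bmatrix}$ with $N\times N$ blocks, and let $\Lambda(dt)=\begin{bmatrix}\Lambda_{00}(dt)&\Lambda_{01}(dt)\\ \Lambda_{10}(dt)&\Lambda_{11}(dt)\end{bmatrix}$ be the matrix measure whose matrix Stieltjes transform is $P(z,\cdot)$, so that $P_{ii}(z,\cdot)$ is the Stieltjes transform of $\Lambda_{ii}$. Then the positive matrix measures $\Lambda_{00}$ and $\Lambda_{11}$ are symmetric, i.e. $\Lambda_{ii}(B)=\Lambda_{ii}(-B)$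 for every Borel set $B\subset\mathbb R$ and $i\in\{0,1\}$.
   Context: $\mathbb T$ is the unit circle of $\mathbb C$; $\mathbb C_+=\{w\in\mathbb C:\Im w>0\}$; $\mathcal H_+^m$ is the set of $m\times m$ Hermitian nonnegative matrices; $\otimes$ is the Kronecker product. $\mathfrak S^m$ is the set of $m\times m$ matrix Stieltjes transforms, i.e. functions $F:\mathbb C_+\to\mathbb C^{m\times m}$ of the form $F(\eta)=\int_{\mathbb R}\frac{1}{\lambda-\eta}\,\mu(d\lambda)$ where $\mu$ is an $\mathcal H_+^m$-valued measure on $\mathbb R$ with $\mu(\mathbb R)=I_m$. Equivalently, $F$ is analytic on $\mathbb C_+$, $\Im F(\eta):=(F(\eta)-F(\eta)^* )/(2\imath)$ is positive definite for all $\eta\in\mathbb C_+$, and $-\imath tF(\imath t)\to I_m$ as $t\to\infty$. For $M=\begin{bmatrix}M_{00}&M_{01}\\ M_{10}&M_{11}\end{bmatrix}\in\mathbb C^{2N\times2N}$ with blocks in $\mathbb C^{N\times N}$, $$\mathscr T(M)=\begin{bmatrix}\operatorname{tr}M_{00}/n&\operatorname{tr}M_{01}/n\\ \operatorname{tr}M_{10}/n&\operatorname{tr}M_{11}/n\end{bmatrix}\in\mathbb C^{2\times2},\qquad U_L(e^{\imath\theta})=\begin{bmatrix}0&e^{-\imath L\theta}\\ e^{\imath L\theta}&0\end{bmatrix}.$$ *)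

theory Defs
  imports "HOL-Analysis.Analysis"
begin

text \<open>
  A \<open>2N \<times> 2N\<close> matrix with \<open>N \<times> N\<close> blocks is indexed by pairs in \<open>2 \<times> 'N\<close>, where
  \<open>CARD('N) = N\<close>; the first component, \<open>0\<close> or \<open>1\<close> in the type \<open>2\<close>, selects the block.
\<close>

definition upper_half_plane :: "complex set" where
  "upper_half_plane = {w. 0 < Im w}"

definition hermitian_nonneg :: "complex^'m^'m \<Rightarrow> bool" where
  "hermitian_nonneg A \<longleftrightarrow>
     (\<forall>i j. A $ i $ j = cnj (A $ j $ i)) \<and>
     (\<forall>x :: complex^'m. 0 \<le> Re (\<Sum>i\<in>UNIV. cnj (x $ i) * (A *v x) $ i))"

definition kronecker :: "complex^'a^'a \<Rightarrow> complex^'b^'b \<Rightarrow> complex^('a::finite \<times> 'b::finite)^('a::finite \<times> 'b::finite)" where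
  "kronecker A B = (\<chi> p q. A $ fst p $ fst q * B $ snd p $ snd q)"

definition block :: "2 \<Rightarrow> 2 \<Rightarrow> complex^(2 \<times> 'a::finite)^(2 \<times> 'a::finite) \<Rightarrow> complex^'a^'a" where
  "block i j M = (\<chi> k l. M $ (i, k) $ (j, l))"

text \<open>
  The library's \<open>vector [a, b]\<close> is not used here: it numbers entries by \<open>1\<close> and \<open>2\<close>,
  and \<open>2 = 0\<close> in the type \<open>2\<close>.
\<close>

definition matrix2 :: "complex \<Rightarrow> complex \<Rightarrow> complex \<Rightarrow> complex \<Rightarrow> complex^2^2" where
  "matrix2 a b c d =
     (\<chi> i j. if i = 0 then (if j = 0 then a else b) else (if j = 0 then c else d))"

definition matrix_measure :: "(real set \<Rightarrow> complex^'m^'m) \<Rightarrow> bool" where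
  "matrix_measure \<mu> \<longleftrightarrow>
     (\<forall>B\<in>sets borel. hermitian_nonneg (\<mu> B)) \<and>
     \<mu> {} = 0 \<and>
     (\<forall>A :: nat \<Rightarrow> real set. range A \<subseteq> sets borel \<longrightarrow> disjoint_family A \<longrightarrow>
        (\<lambda>k. \<mu> (A k)) sums \<mu> (\<Union>k. A k))"

text \<open>
  Integral against a complex measure \<open>\<nu>\<close>: write
  \<open>\<nu> = \<mu>\<^sub>0 + \<i> \<mu>\<^sub>1 - \<mu>\<^sub>2 - \<i> \<mu>\<^sub>3\<close> with finite positive measures (for instance by the Jordan
  decomposition) and integrate against each of them.  By additivity of the integral in the
  measure, the value does not depend on the decomposition.
\<close>

definition has_complex_measure_integral ::
    "(real set \<Rightarrow> complex) \<Rightarrow> (real \<Rightarrow> complex) \<Rightarrow> complex \<Rightarrow> bool" where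
  "has_complex_measure_integral \<nu> f I \<longleftrightarrow>
     (\<exists>\<mu> :: nat \<Rightarrow> real measure.
        (\<forall>k<4. sets (\<mu> k) = sets borel \<and> finite_measure (\<mu> k) \<and> integrable (\<mu> k) f) \<and>
        (\<forall>B\<in>sets borel. \<nu> B = (\<Sum>k<4. \<i> ^ k * complex_of_real (measure (\<mu> k) B))) \<and>
        I = (\<Sum>k<4. \<i> ^ k * integral\<^sup>L (\<mu> k) f))"

definition is_stieltjes_transform_of ::
    "(complex \<Rightarrow> complex^'m^'m) \<Rightarrow> (real set \<Rightarrow> complex^'m^'m) \<Rightarrow> bool" where
  "is_stieltjes_transform_of F \<mu> \<longleftrightarrow>
     (\<forall>\<eta>\<in>upper_half_plane. \<forall>i j.
        has_complex_measure_integral (\<lambda>B. \<mu> B $ i $ j)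
          (\<lambda>t. 1 / (complex_of_real t - \<eta>)) (F \<eta> $ i $ j))"

text \<open>
  The class of matrix Stieltjes transforms.  Its members are total functions, but membership
  depends only on their values on the upper half plane.
\<close>

definition stieltjes_class :: "(complex \<Rightarrow> complex^'m^'m) set" where
  "stieltjes_class =
     {F. \<exists>\<mu>. matrix_measure \<mu> \<and> \<mu> UNIV = mat 1 \<and> is_stieltjes_transform_of F \<mu>}"

definition block_trace :: "nat \<Rightarrow> complex^(2 \<times> 'a::finite)^(2 \<times> 'a::finite) \<Rightarrow> complex^2^2" where
  "block_trace n M = (\<chi> i j. trace (block i j M) / of_nat n)"

definition U_mat :: "nat \<Rightarrow> real \<Rightarrow> complex^2^2" where
  "U_mat L \<theta> = matrix2 0 (cis (- (real L * \<theta>))) (cis (real L * \<theta>)) 0"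

definition inner_mat ::
    "(complex \<Rightarrow> complex^'a^'a) \<Rightarrow> nat \<Rightarrow> nat \<Rightarrow> complex^(2 \<times> 'a::finite)^(2 \<times> 'a::finite) \<Rightarrow> real \<Rightarrow> complex^2^2" where
  "inner_mat \<Sigma> n L M \<theta> =
     block_trace n (kronecker (mat 1) (\<Sigma> (cis \<theta>)) ** M) + U_mat L \<theta>"

definition F_integrand ::
    "(complex \<Rightarrow> complex^'a^'a) \<Rightarrow> nat \<Rightarrow> nat \<Rightarrow> complex^(2 \<times> 'a::finite)^(2 \<times> 'a::finite) \<Rightarrow> real
      \<Rightarrow> complex^(2 \<times> 'a::finite)^(2 \<times> 'a::finite)" where
  "F_integrand \<Sigma> n L M \<theta> = kronecker (matrix_inv (inner_mat \<Sigma> n L M \<theta>)) (\<Sigma> (cis \<theta>))"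

definition outer_mat ::
    "(complex \<Rightarrow> complex^'a^'a) \<Rightarrow> nat \<Rightarrow> nat \<Rightarrow> complex \<Rightarrow> complex^(2 \<times> 'a::finite)^(2 \<times> 'a::finite) \<Rightarrow> complex
      \<Rightarrow> complex^(2 \<times> 'a::finite)^(2 \<times> 'a::finite)" where
  "outer_mat \<Sigma> n L z M \<eta> =
     (1 / (2 * pi)) *\<^sub>R integral {0..2 * pi} (F_integrand \<Sigma> n L M)
       - kronecker (matrix2 \<eta> z (cnj z) \<eta>) (mat 1)"

definition F_map ::
    "(complex \<Rightarrow> complex^'a^'a) \<Rightarrow> nat \<Rightarrow> nat \<Rightarrow> complex \<Rightarrow> complex^(2 \<times> 'a::finite)^(2 \<times> 'a::finite) \<Rightarrow> complex
      \<Rightarrow> complex^(2 \<times> 'a::finite)^(2 \<times> 'a::finite)" where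
  "F_map \<Sigma> n L z M \<eta> = matrix_inv (outer_mat \<Sigma> n L z M \<eta>)"

text \<open>Since \<open>matrix_inv\<close> and \<open>integral\<close> are total, well-definedness is a separate condition.\<close>

definition F_well_defined ::
    "(complex \<Rightarrow> complex^'a^'a) \<Rightarrow> nat \<Rightarrow> nat \<Rightarrow> complex \<Rightarrow> complex^(2 \<times> 'a::finite)^(2 \<times> 'a::finite) \<Rightarrow> complex
      \<Rightarrow> bool" where
  "F_well_defined \<Sigma> n L z M \<eta> \<longleftrightarrow>
     (\<forall>\<theta>\<in>{0..2 * pi}. invertible (inner_mat \<Sigma> n L M \<theta>)) \<and>
     F_integrand \<Sigma> n L M absolutely_integrable_on {0..2 * pi} \<and>
     invertible (outer_mat \<Sigma> n L z M \<eta>)"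

definition solves_equation ::
    "(complex \<Rightarrow> complex^'a^'a) \<Rightarrow> nat \<Rightarrow> nat \<Rightarrow> complex
      \<Rightarrow> (complex \<Rightarrow> complex^(2 \<times> 'a::finite)^(2 \<times> 'a::finite)) \<Rightarrow> bool" where
  "solves_equation \<Sigma> n L z P \<longleftrightarrow> (\<forall>\<eta>\<in>upper_half_plane. P \<eta> = F_map \<Sigma> n L z (P \<eta>) \<eta>)"

end

theory Submission
  imports Defs "HOL-Complex_Analysis.Complex_Analysis" "HOL-Probability.Probability"
begin

text \<open>
  Write \<open>qf x A = x\<^sup>* A x\<close>. If \<open>Im M(\<eta>) > 0\<close>, then \<open>Im (\<T>(\<Sigma>M) + U\<^sub>L) \<ge> 0\<close>, strictly where
  \<open>\<Sigma> \<noteq> 0\<close>, while \<open>U\<^sub>L\<close> is unitary and covers the zeros of \<open>\<Sigma>\<close>; so the integrand exists and has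
  nonpositive imaginary part. Hence the matrix to be inverted has imaginary part at most \<open>- Im \<eta>\<close>, its
  inverse has quadratic forms bounded by \<open>|x|\<^sup>2 / Im \<eta>\<close> with positive imaginary part, and a matrix
  version of the Herglotz representation puts it into the Stieltjes class.

  For large \<open>Im \<eta>\<close> the map is a contraction. Two solutions agree there, hence everywhere by analytic
  continuation. For existence, the Picard iterates form a normal family; a limit is again a
  Stieltjes transform by the Herglotz representation, solves the equation for large \<open>Im \<eta>\<close>, and hence
  everywhere.

  Finally, with \<open>J = diag(I, -I)\<close>, the function \<open>\<eta> \<mapsto> - J P(- cnj \<eta>)\<^sup>* J\<close> solves the same equation,
  so it is \<open>P\<close>. On the diagonal blocks this says that the measures are symmetric.
\<close>

text \<open>Two obstacles shape the proof. The entries of a matrix measure are complex measures, so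
  everything is reduced to the scalar functions \<open>qf x (F \<eta>)\<close>, and polarization
  recovers the entries. The Herglotz measures obtained for different \<open>x\<close> come without
  any relation to each other; Stieltjes inversion for complex combinations of measures shows that
  they fit together into one matrix measure. Second, the contraction holds only high up in the half
  plane, while limits of iterates must be controlled everywhere. Bounds near the real axis come from
  \<open>resolvent_like\<close>, and the normalization at infinity survives the limit because all
  values of the map on such arguments obey the same bound \<open>decay_const / Im \<eta>\<close>.
  Writing \<Sigma> as a sum of rank one matrices turns both the block trace and the Kronecker
  product into sums of quadratic forms; this is how positivity passes through the map. The sign
  matrix J is forced: the negative adjoint reverses the sign of U_L and of the entries z, and J,
  which flips the off-diagonal blocks, reverses them back.\<close>

no_notation fps_nth (infixl \<open>$\<close> 75)

section \<open>Stieltjes transforms of finite measures\<close>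

definition stieltjes :: "real measure \<Rightarrow> complex \<Rightarrow> complex" where
  "stieltjes M \<eta> = (\<integral>t. 1 / (complex_of_real t - \<eta>) \<partial>M)"

definition poisson :: "complex \<Rightarrow> real \<Rightarrow> real" where
  "poisson \<eta> t = Im \<eta> / ((t - Re \<eta>)\<^sup>2 + (Im \<eta>)\<^sup>2)"

lemma Im_cauchy_kernel: "Im (1 / (complex_of_real t - \<eta>)) = poisson \<eta> t"
  by (simp add: poisson_def Im_divide power2_eq_square algebra_simps)

lemma norm_cauchy_kernel_le:
  assumes "0 < Im \<eta>" shows "norm (1 / (complex_of_real t - \<eta>)) \<le> 1 / Im \<eta>"
proof -
  have "Im \<eta> \<le> norm (complex_of_real t - \<eta>)"
    using abs_Im_le_cmod[of "complex_of_real t - \<eta>"] assms by simp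
  then show ?thesis
    using assms by (simp add: norm_divide frac_le)
qed

lemma cauchy_kernel_measurable [measurable]:
  "(\<lambda>t. 1 / (complex_of_real t - \<eta>)) \<in> borel_measurable borel"
  by measurable

lemma poisson_measurable [measurable]: "poisson \<eta> \<in> borel_measurable borel"
  unfolding poisson_def by measurable

lemma poisson_nonneg: "0 < Im \<eta> \<Longrightarrow> 0 \<le> poisson \<eta> t"
  by (simp add: poisson_def)

lemma poisson_pos: "0 < Im \<eta> \<Longrightarrow> 0 < poisson \<eta> t"
  by (simp add: poisson_def add_nonneg_pos)

lemma poisson_le: "0 < Im \<eta> \<Longrightarrow> poisson \<eta> t \<le> 1 / Im \<eta>"
  using norm_cauchy_kernel_le[of \<eta> t] abs_Im_le_cmod[of "1 / (complex_of_real t - \<eta>)"]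
  unfolding Im_cauchy_kernel by linarith

context finite_borel_measure
begin

lemma borel_integrable_bounded:
  fixes f :: "real \<Rightarrow> 'a::{banach, second_countable_topology}"
  assumes "f \<in> borel_measurable borel" "\<And>t. norm (f t) \<le> K"
  shows "integrable M f"
proof (rule integrable_const_bound[where B=K])
  show "f \<in> borel_measurable M"
    using assms(1) measurable_cong_sets[OF M_is_borel refl] by blast
qed (use assms in auto)

lemma integrable_cauchy_kernel:
  "0 < Im \<eta> \<Longrightarrow> integrable M (\<lambda>t. 1 / (complex_of_real t - \<eta>))"
  by (rule borel_integrable_bounded[OF cauchy_kernel_measurable norm_cauchy_kernel_le])

lemma integrable_poisson: "0 < Im \<eta> \<Longrightarrow> integrable M (poisson \<eta>)"
  by (rule borel_integrable_bounded[where K = "1 / Im \<eta>"])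
    (simp_all add: poisson_le poisson_nonneg)

lemma Im_stieltjes:
  assumes "0 < Im \<eta>" shows "Im (stieltjes M \<eta>) = (\<integral>t. poisson \<eta> t \<partial>M)"
  unfolding stieltjes_def integral_Im[OF integrable_cauchy_kernel[OF assms], symmetric]
    Im_cauchy_kernel ..

lemma norm_stieltjes_le:
  assumes "0 < Im \<eta>" shows "norm (stieltjes M \<eta>) \<le> measure M UNIV / Im \<eta>"
proof -
  have "norm (stieltjes M \<eta>) \<le> (\<integral>t. norm (1 / (complex_of_real t - \<eta>)) \<partial>M)"
    unfolding stieltjes_def by (rule integral_norm_bound)
  also have "\<dots> \<le> (\<integral>t. 1 / Im \<eta> \<partial>M)"
    using assms norm_cauchy_kernel_le integrable_cauchy_kernel by (intro integral_mono) auto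
  also have "\<dots> = measure M UNIV / Im \<eta>"
    by (simp add: borel_UNIV)
  finally show ?thesis .
qed

text \<open>The Poisson kernel is positive everywhere, so a vanishing integral would make the whole
  line a null set.\<close>

lemma Im_stieltjes_pos:
  assumes "0 < Im \<eta>" "0 < measure M UNIV" shows "0 < Im (stieltjes M \<eta>)"
proof -
  have "0 \<le> (\<integral>t. poisson \<eta> t \<partial>M)"
    using poisson_nonneg[OF assms(1)] by simp
  moreover have "(\<integral>t. poisson \<eta> t \<partial>M) \<noteq> 0"
  proof
    assume "(\<integral>t. poisson \<eta> t \<partial>M) = 0"
    then have "AE t in M. poisson \<eta> t = 0"
      using integral_nonneg_eq_0_iff_AE[OF integrable_poisson[OF assms(1)]]
        poisson_nonneg[OF assms(1)] by auto
    then have "AE t in M. False"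
      using poisson_pos[OF assms(1)] by (elim AE_mp) (intro AE_I2, metis less_irrefl)
    then have "emeasure M (space M) = 0"
      by (simp add: AE_iff_null null_sets_def)
    then show False
      using assms(2) by (simp add: measure_def borel_UNIV)
  qed
  ultimately show ?thesis
    unfolding Im_stieltjes[OF assms(1)] by simp
qed

text \<open>The difference quotient is the integral of a product of two Cauchy kernels. Dominated
  convergence is a statement about sequences, hence the passage to sequences tending to
  \<eta>.\<close>

lemma holomorphic_on_stieltjes: "stieltjes M holomorphic_on upper_half_plane"
proof -
  have "(stieltjes M has_field_derivative (\<integral>t. 1 / (complex_of_real t - \<eta>)\<^sup>2 \<partial>M)) (at \<eta>)"
    if \<eta>: "0 < Im \<eta>" for \<eta>
    unfolding has_field_derivative_iff
  proof (subst tendsto_at_iff_sequentially, intro allI impI)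
    fix X :: "nat \<Rightarrow> complex" assume X: "\<forall>i. X i \<in> UNIV - {\<eta>}" "X \<longlonglongrightarrow> \<eta>"
    have "open {w. Im \<eta> / 2 < Im w}"
      using open_halfspace_Im_gt[of "Im \<eta> / 2"] by simp
    then have "eventually (\<lambda>i. X i \<in> {w. Im \<eta> / 2 < Im w}) sequentially"
      using X(2) \<eta> by (intro topological_tendstoD) auto
    then obtain n0 where n0: "\<And>i. i \<ge> n0 \<Longrightarrow> Im \<eta> / 2 < Im (X i)"
      by (auto simp: eventually_sequentially)
    \<comment> \<open>Without the first \<open>n0\<close> terms the imaginary parts stay above
      \<open>Im \<eta> / 2\<close>, so the kernels have the constant bound
      \<open>2 / Im \<eta>\<close>.\<close>
    define Y where "Y i = X (i + n0)" for i
    have Y: "Im \<eta> / 2 < Im (Y i)" "Y i \<noteq> \<eta>" for i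
      using n0 X(1) by (auto simp: Y_def)
    have Yl: "Y \<longlonglongrightarrow> \<eta>"
      unfolding Y_def using X(2) by (rule LIMSEQ_ignore_initial_segment)
    have nz: "complex_of_real t - w \<noteq> 0" if "0 < Im w" for t w
      using that by (auto simp: complex_eq_iff)
    have Ypos: "0 < Im (Y i)" for i
      using Y(1)[of i] \<eta> by linarith
    let ?k = "\<lambda>i t. 1 / (complex_of_real t - Y i) * (1 / (complex_of_real t - \<eta>))"
    have quot: "(stieltjes M (Y i) - stieltjes M \<eta>) / (Y i - \<eta>)
        = (\<integral>t. ?k i t \<partial>M)" for i
    proof -
      have "stieltjes M (Y i) - stieltjes M \<eta>
          = (\<integral>t. 1 / (complex_of_real t - Y i) - 1 / (complex_of_real t - \<eta>) \<partial>M)"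
        unfolding stieltjes_def
        using integrable_cauchy_kernel[OF Ypos] integrable_cauchy_kernel[OF \<eta>] by simp
      also have "\<dots> = (\<integral>t. (Y i - \<eta>) * (?k i t) \<partial>M)"
        using nz[OF Ypos] nz[OF \<eta>] by (intro Bochner_Integration.integral_cong) (auto simp: field_simps)
      also have "\<dots> = (Y i - \<eta>) * (\<integral>t. ?k i t \<partial>M)"
        by (rule integral_mult_right_zero)
      finally show ?thesis
        using Y(2)[of i] by (metis nonzero_mult_div_cancel_left right_minus_eq)
    qed
    have "(\<lambda>i. \<integral>t. ?k i t \<partial>M)
        \<longlonglongrightarrow> (\<integral>t. 1 / (complex_of_real t - \<eta>) * (1 / (complex_of_real t - \<eta>)) \<partial>M)"
    proof (rule integral_dominated_convergence[where w = "\<lambda>_. 2 / Im \<eta> * (1 / Im \<eta>)"])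
      show "AE t in M. (\<lambda>i. ?k i t)
          \<longlonglongrightarrow> 1 / (complex_of_real t - \<eta>) * (1 / (complex_of_real t - \<eta>))"
        using nz[OF \<eta>] by (intro AE_I2 tendsto_intros Yl) auto
      show "AE t in M. norm (?k i t)
          \<le> 2 / Im \<eta> * (1 / Im \<eta>)" for i
      proof (intro AE_I2)
        fix t
        have "norm (1 / (complex_of_real t - Y i)) \<le> 1 / Im (Y i)"
          by (rule norm_cauchy_kernel_le[OF Ypos])
        also have "\<dots> \<le> 2 / Im \<eta>"
          using Y(1)[of i] \<eta> Ypos[of i] by (simp add: field_simps)
        finally show "norm (?k i t)
            \<le> 2 / Im \<eta> * (1 / Im \<eta>)"
          unfolding norm_mult using norm_cauchy_kernel_le[OF \<eta>, of t] \<eta>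
          by (intro mult_mono) auto
      qed
    qed (auto simp: measurable_cong_sets[OF M_is_borel refl])
    then have "(\<lambda>i. (stieltjes M (Y i) - stieltjes M \<eta>) / (Y i - \<eta>))
        \<longlonglongrightarrow> (\<integral>t. 1 / (complex_of_real t - \<eta>)\<^sup>2 \<partial>M)"
      unfolding quot by (simp add: power2_eq_square)
    then show "((\<lambda>y. (stieltjes M y - stieltjes M \<eta>) / (y - \<eta>)) \<circ> X)
        \<longlonglongrightarrow> (\<integral>t. 1 / (complex_of_real t - \<eta>)\<^sup>2 \<partial>M)"
      unfolding Y_def comp_def by (rule LIMSEQ_offset)
  qed
  then show ?thesis
    unfolding holomorphic_on_def upper_half_plane_def
    using field_differentiable_def has_field_derivative_at_within by blast
qed

lemma integral_simple_function:
  fixes f :: "real \<Rightarrow> complex"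
  assumes "simple_function borel f"
  shows "integral\<^sup>L M f = (\<Sum>y\<in>range f. measure M (f -` {y}) *\<^sub>R y)"
proof -
  have sf: "simple_function M f"
    using assms by (simp add: simple_function_def borel_UNIV M_is_borel)
  have "Bochner_Integration.simple_bochner_integrable M f"
    by (rule simple_bochner_integrable.intros[OF sf]) (simp add: emeasure_finite)
  then have "integral\<^sup>L M f = Bochner_Integration.simple_bochner_integral M f"
    by (rule simple_bochner_integrable_eq_integral[symmetric])
  then show ?thesis
    by (simp add: simple_bochner_integral_def borel_UNIV vimage_def)
qed

end

text \<open>
  Complex measures are handled as finite complex combinations of positive ones. The two families allow for
  the comparison of different decompositions of the same complex measure.
\<close>

lemma measure_combination_integral_eq:
  fixes \<mu> :: "'l \<Rightarrow> real measure" and \<nu> :: "'k \<Rightarrow> real measure" and c d :: "_ \<Rightarrow> complex"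
    and f :: "real \<Rightarrow> complex"
  assumes \<mu>: "\<And>l. l \<in> A \<Longrightarrow> finite_borel_measure (\<mu> l)"
    and \<nu>: "\<And>l. l \<in> A' \<Longrightarrow> finite_borel_measure (\<nu> l)"
    and eq: "\<And>B. B \<in> sets borel \<Longrightarrow>
      (\<Sum>l\<in>A. c l * of_real (measure (\<mu> l) B)) = (\<Sum>l\<in>A'. d l * of_real (measure (\<nu> l) B))"
    and f: "f \<in> borel_measurable borel" "\<And>t. norm (f t) \<le> K"
  shows "(\<Sum>l\<in>A. c l * integral\<^sup>L (\<mu> l) f) = (\<Sum>l\<in>A'. d l * integral\<^sup>L (\<nu> l) f)"
proof -
  obtain s where s: "\<And>i. simple_function borel (s i)" "\<And>t. (\<lambda>i. s i t) \<longlonglongrightarrow> f t"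
      "\<And>i t. norm (s i t) \<le> 2 * norm (f t)"
    using borel_measurable_implies_sequence_metric[OF f(1), of 0] by auto
  have lim: "(\<lambda>i. integral\<^sup>L m (s i)) \<longlonglongrightarrow> integral\<^sup>L m f" if "finite_borel_measure m" for m
  proof -
    interpret finite_borel_measure m by fact
    note [simp] = measurable_cong_sets[OF M_is_borel refl]
    show ?thesis
    proof (rule integral_dominated_convergence[where w = "\<lambda>_. 2 * K"])
      show "AE t in m. norm (s i t) \<le> 2 * K" for i
        using s(3)[of i] f(2) by (intro AE_I2) (meson mult_left_mono order_trans zero_le_numeral)
      show "s i \<in> borel_measurable m" for i
        using borel_measurable_simple_function[OF s(1)] by simp
    qed (use f s in auto)
  qed
  \<comment> \<open>For a simple function each level set contributes the hypothesis
    \<open>eq\<close>, multiplied by the value taken there.\<close>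
  have simple: "(\<Sum>l\<in>A. c l * integral\<^sup>L (\<mu> l) (s i)) = (\<Sum>l\<in>A'. d l * integral\<^sup>L (\<nu> l) (s i))" for i
  proof -
    have sets: "s i -` {y} \<in> sets borel" for y
      using measurable_sets[OF borel_measurable_simple_function[OF s(1)], of "{y}" i] by simp
    have "(\<Sum>l\<in>A. c l * integral\<^sup>L (\<mu> l) (s i))
        = (\<Sum>l\<in>A. \<Sum>y\<in>range (s i). c l * of_real (measure (\<mu> l) (s i -` {y})) * y)"
      using \<mu> by (intro sum.cong)
        (simp_all add: finite_borel_measure.integral_simple_function[OF _ s(1)] sum_distrib_left scaleR_conv_of_real mult.assoc)
    also have "\<dots> = (\<Sum>y\<in>range (s i). (\<Sum>l\<in>A. c l * of_real (measure (\<mu> l) (s i -` {y}))) * y)"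
      unfolding sum_distrib_right by (rule sum.swap)
    also have "\<dots> = (\<Sum>y\<in>range (s i). (\<Sum>l\<in>A'. d l * of_real (measure (\<nu> l) (s i -` {y}))) * y)"
      by (simp add: eq[OF sets])
    also have "\<dots> = (\<Sum>l\<in>A'. \<Sum>y\<in>range (s i). d l * of_real (measure (\<nu> l) (s i -` {y})) * y)"
      unfolding sum_distrib_right by (rule sum.swap)
    also have "\<dots> = (\<Sum>l\<in>A'. d l * integral\<^sup>L (\<nu> l) (s i))"
      using \<nu> by (intro sum.cong)
        (simp_all add: finite_borel_measure.integral_simple_function[OF _ s(1)] sum_distrib_left scaleR_conv_of_real mult.assoc)
    finally show ?thesis .
  qed
  have "(\<lambda>i. \<Sum>l\<in>A. c l * integral\<^sup>L (\<mu> l) (s i)) \<longlonglongrightarrow> (\<Sum>l\<in>A. c l * integral\<^sup>L (\<mu> l) f)"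
    by (intro tendsto_intros lim \<mu>)
  moreover have "(\<lambda>i. \<Sum>l\<in>A'. d l * integral\<^sup>L (\<nu> l) (s i)) \<longlonglongrightarrow> (\<Sum>l\<in>A'. d l * integral\<^sup>L (\<nu> l) f)"
    by (intro tendsto_intros lim \<nu>)
  ultimately show ?thesis
    unfolding simple by (rule LIMSEQ_unique)
qed

section \<open>Stieltjes inversion\<close>

lemma poisson_integral_Icc:
  assumes "a \<le> b" "0 < y"
  shows "(\<integral>x. poisson (Complex x y) t * indicator {a..b} x \<partial>lborel)
    = arctan ((b - t) / y) - arctan ((a - t) / y)"
proof -
  have "((\<lambda>x. arctan ((x - t) / y)) has_real_derivative poisson (Complex x y) t) (at x)" for x
    using assms(2)
    by (auto intro!: derivative_eq_intros simp: poisson_def field_simps power2_eq_square add_pos_nonneg)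
  moreover have "(\<lambda>x. poisson (Complex x y) t) \<in> borel_measurable borel"
    unfolding poisson_def by simp
  ultimately show ?thesis
    using assms by (intro integral_FTC_Icc_nonneg) (auto simp: poisson_nonneg)
qed

text \<open>Fubini applies because the kernel is at most \<open>1 / y\<close> on the strip over
  \<open>{a..b}\<close>, whose product measure is finite.\<close>

lemma (in finite_borel_measure) integral_poisson_integral:
  assumes "a \<le> b" "0 < y"
  shows "(\<integral>x. (\<integral>t. poisson (Complex x y) t \<partial>M) * indicator {a..b} x \<partial>lborel)
      = (\<integral>t. arctan ((b - t) / y) - arctan ((a - t) / y) \<partial>M)" (is ?eq)
    and "integrable lborel (\<lambda>x. (\<integral>t. poisson (Complex x y) t \<partial>M) * indicator {a..b} x)" (is ?int)
proof -
  note sigma_finite_M = sigma_finite_measure_axioms and emeasure_M = emeasure_finite[of UNIV]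
  interpret pair_sigma_finite lborel M
    by standard
  have int: "integrable (lborel \<Otimes>\<^sub>M M) (\<lambda>(x, t). poisson (Complex x y) t * indicator {a..b} x)"
  proof (rule integrableI_bounded_set[where A = "{a..b} \<times> UNIV" and B = "1 / y"])
    show "{a..b} \<times> UNIV \<in> sets (lborel \<Otimes>\<^sub>M M)"
      using sets.top[of M] by (intro pair_measureI) (auto simp: borel_UNIV)
    have "emeasure (lborel \<Otimes>\<^sub>M M) ({a..b} \<times> UNIV) = ennreal (b - a) * emeasure M UNIV"
      using sets.top[of M] assms by (subst sigma_finite_measure.emeasure_pair_measure_Times[OF sigma_finite_M]) (auto simp: borel_UNIV)
    also have "\<dots> < \<infinity>"
      using emeasure_M by (simp add: ennreal_mult_eq_top_iff less_top[symmetric])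
    finally show "emeasure (lborel \<Otimes>\<^sub>M M) ({a..b} \<times> UNIV) < \<infinity>" .
    show "(\<lambda>(x, t). poisson (Complex x y) t * indicator {a..b} x) \<in> borel_measurable (lborel \<Otimes>\<^sub>M M)"
      unfolding poisson_def using M_is_borel
      by (simp add: measurable_cong_sets[OF sets_pair_measure_cong[OF sets_lborel M_is_borel] refl])
    show "AE p\<in>{a..b} \<times> UNIV in lborel \<Otimes>\<^sub>M M.
        norm (case p of (x, t) \<Rightarrow> poisson (Complex x y) t * indicator {a..b} x) \<le> 1 / y"
      using assms(2) poisson_le[of "Complex _ y"]
      by (intro AE_I2) (auto simp: poisson_nonneg abs_mult indicator_def)
  qed (auto simp: indicator_def)
  have e: "(\<integral>t. poisson (Complex x y) t \<partial>M) * indicator {a..b} x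
      = (\<integral>t. poisson (Complex x y) t * indicator {a..b} x \<partial>M)" for x
    by simp
  show ?eq
    unfolding e Fubini_integral[OF int]  poisson_integral_Icc[OF assms, symmetric]
    using Fubini_integral[OF int] by simp
  show ?int
    unfolding e using integrable_fst'[OF int] by simp
qed

text \<open>
  One diagonal limit does the work of three: the height \<open>1 / (k + 1)\<^sup>2\<close> tends to \<open>0\<close> faster than the
  slack \<open>1 / (k + 1)\<close> at the right end, so that an atom at \<open>b\<close> is counted in full and not by half.
\<close>

lemma (in finite_borel_measure) poisson_inversion:
  "(\<lambda>k. \<integral>t. arctan ((b + 1 / real (Suc k) - t) * (real (Suc k))\<^sup>2)
      - arctan ((- real (Suc k) - t) * (real (Suc k))\<^sup>2) \<partial>M) \<longlonglongrightarrow> pi * measure M {..b}"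
proof -
  let ?u = "\<lambda>k t. arctan ((b + 1 / real (Suc k) - t) * (real (Suc k))\<^sup>2)" and ?v = "\<lambda>k t. arctan ((- real (Suc k) - t) * (real (Suc k))\<^sup>2)"
  note [simp] = measurable_cong_sets[OF M_is_borel refl]
  have at_top: "LIM k sequentially. real (Suc k) :> at_top"
    using filterlim_compose[OF filterlim_real_sequentially filterlim_Suc] .
  have lim1: "(\<lambda>k. ?u k t)
      \<longlonglongrightarrow> pi * indicator {..b} t - pi / 2" for t
  proof (cases "t \<le> b")
    case True
    have "LIM k sequentially. (b + 1 / real (Suc k) - t) * (real (Suc k))\<^sup>2 :> at_top"
    proof (rule filterlim_at_top_mono[OF at_top], intro always_eventually allI)
      fix k
      have "real (Suc k) = (1 / real (Suc k)) * (real (Suc k))\<^sup>2"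
        by (simp add: power2_eq_square)
      also have "\<dots> \<le> (b + 1 / real (Suc k) - t) * (real (Suc k))\<^sup>2"
        using True by (intro mult_right_mono) auto
      finally show "real (Suc k) \<le> (b + 1 / real (Suc k) - t) * (real (Suc k))\<^sup>2" .
    qed
    from filterlim_compose[OF tendsto_arctan_at_top this] True show ?thesis
      by simp
  next
    case False
    have "(\<lambda>k. b + 1 / real (Suc k) - t) \<longlonglongrightarrow> b + 0 - t"
      by (intro tendsto_intros tendsto_divide_0[OF tendsto_const] filterlim_at_top_imp_at_infinity at_top)
    moreover have "LIM k sequentially. (real (Suc k))\<^sup>2 :> at_top"
      by (intro filterlim_pow_at_top at_top) simp
    ultimately have "LIM k sequentially. (b + 1 / real (Suc k) - t) * (real (Suc k))\<^sup>2 :> at_bot"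
      using False by (intro filterlim_tendsto_neg_mult_at_bot[where c = "b - t"]) auto
    from filterlim_compose[OF tendsto_arctan_at_bot this] False show ?thesis
      by simp
  qed
  have lim2: "(\<lambda>k. ?v k t) \<longlonglongrightarrow> - (pi / 2)" for t
  proof -
    have "LIM k sequentially. (t + real (Suc k)) * (real (Suc k))\<^sup>2 :> at_top"
      by (intro filterlim_at_top_mult_at_top filterlim_tendsto_add_at_top[OF tendsto_const]
          at_top filterlim_pow_at_top) simp
    then have "LIM k sequentially. - ((t + real (Suc k)) * (real (Suc k))\<^sup>2) :> at_bot"
      by (simp add: filterlim_uminus_at_bot)
    then have "LIM k sequentially. (- real (Suc k) - t) * (real (Suc k))\<^sup>2 :> at_bot"
      by (simp add: algebra_simps)
    from filterlim_compose[OF tendsto_arctan_at_bot this] show ?thesis .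
  qed
  have "(\<lambda>k. \<integral>t. ?u k t
      - ?v k t \<partial>M) \<longlonglongrightarrow> (\<integral>t. pi * indicator {..b} t \<partial>M)"
  proof (rule integral_dominated_convergence[where w = "\<lambda>_. pi"])
    show "AE t in M. (\<lambda>k. ?u k t
        - ?v k t) \<longlonglongrightarrow> pi * indicator {..b} t"
      using tendsto_diff[OF lim1 lim2] by (intro AE_I2) simp
    show "AE t in M. norm (?u k t
        - ?v k t) \<le> pi" for k
    proof (intro AE_I2)
      fix t
      show "norm (?u k t
        - ?v k t) \<le> pi"
        using arctan_bounded[of "(b + 1 / real (Suc k) - t) * (real (Suc k))\<^sup>2"]
          arctan_bounded[of "(- real (Suc k) - t) * (real (Suc k))\<^sup>2"]
        unfolding real_norm_def by linarith
    qed
  qed auto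
  also have "(\<integral>t. pi * indicator {..b} t \<partial>M) = pi * measure M {..b}"
    by (simp add: borel_UNIV)
  finally show ?thesis .
qed

text \<open>Integrating the hypothesis over a horizontal segment gives arctan differences, and
  \<open>poisson_inversion\<close> turns these into values on half-lines. The coefficients are
  complex, so the two sides are not positive measures to be compared by their distribution
  functions; the way from half-lines to Borel sets is an induction over the Dynkin system.\<close>

lemma measure_combination_eq_of_poisson_eq:
  fixes \<mu> :: "'l \<Rightarrow> real measure" and \<nu> :: "'k \<Rightarrow> real measure" and c d :: "_ \<Rightarrow> complex"
  assumes \<mu>: "\<And>l. l \<in> A \<Longrightarrow> finite_borel_measure (\<mu> l)"
    and \<nu>: "\<And>l. l \<in> A' \<Longrightarrow> finite_borel_measure (\<nu> l)"
    and eq: "\<And>\<eta>. 0 < Im \<eta> \<Longrightarrow>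
      (\<Sum>l\<in>A. c l * of_real (integral\<^sup>L (\<mu> l) (poisson \<eta>)))
      = (\<Sum>l\<in>A'. d l * of_real (integral\<^sup>L (\<nu> l) (poisson \<eta>)))"
    and B: "B \<in> sets borel"
  shows "(\<Sum>l\<in>A. c l * of_real (measure (\<mu> l) B)) = (\<Sum>l\<in>A'. d l * of_real (measure (\<nu> l) B))"
proof -
  \<comment> \<open>Stated for any family, as it is applied to both sides.\<close>
  have swap: "(\<integral>x. (\<Sum>l\<in>I. e l * complex_of_real (integral\<^sup>L (m l) (poisson (Complex x y)))) * complex_of_real (indicator {a..b} x) \<partial>lborel)
      = (\<Sum>l\<in>I. e l * complex_of_real (\<integral>t. arctan ((b - t) / y) - arctan ((a - t) / y) \<partial>m l))"
    if "a \<le> b" "0 < y" and m: "\<And>l. l \<in> I \<Longrightarrow> finite_borel_measure (m l)"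
    for a b y and I :: "'z set" and e and m :: "'z \<Rightarrow> real measure"
  proof -
    have "(\<Sum>l\<in>I. e l * complex_of_real (integral\<^sup>L (m l) (poisson (Complex x y)))) * complex_of_real (indicator {a..b} x)
      = (\<Sum>l\<in>I. e l * complex_of_real (integral\<^sup>L (m l) (poisson (Complex x y)) * indicator {a..b} x))" for x
      by (simp add: sum_distrib_right mult.assoc)
    moreover have "integrable lborel (\<lambda>x. e l * complex_of_real (integral\<^sup>L (m l) (poisson (Complex x y)) * indicator {a..b} x))"
      if "l \<in> I" for l
      using finite_borel_measure.integral_poisson_integral(2)[OF m[OF that] \<open>a \<le> b\<close> \<open>0 < y\<close>]
      by (intro integrable_mult_right integrable_of_real)
    ultimately have "(\<integral>x. (\<Sum>l\<in>I. e l * complex_of_real (integral\<^sup>L (m l) (poisson (Complex x y)))) * complex_of_real (indicator {a..b} x) \<partial>lborel)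
      = (\<Sum>l\<in>I. \<integral>x. e l * complex_of_real (integral\<^sup>L (m l) (poisson (Complex x y)) * indicator {a..b} x) \<partial>lborel)"
      by (simp add: Bochner_Integration.integral_sum del: of_real_mult)
    also have "\<dots> = (\<Sum>l\<in>I. e l * complex_of_real (\<integral>t. arctan ((b - t) / y) - arctan ((a - t) / y) \<partial>m l))"
    proof (intro sum.cong refl)
      fix l assume l: "l \<in> I"
      show "(\<integral>x. e l * complex_of_real (integral\<^sup>L (m l) (poisson (Complex x y)) * indicator {a..b} x) \<partial>lborel)
        = e l * complex_of_real (\<integral>t. arctan ((b - t) / y) - arctan ((a - t) / y) \<partial>m l)"
        using finite_borel_measure.integral_poisson_integral[OF m[OF l] that(1,2)]
        by (simp del: of_real_mult)
    qed
    finally show ?thesis .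
  qed
  have arctan_eq: "(\<Sum>l\<in>A. c l * of_real (\<integral>t. arctan ((b - t) / y) - arctan ((a - t) / y) \<partial>\<mu> l))
      = (\<Sum>l\<in>A'. d l * of_real (\<integral>t. arctan ((b - t) / y) - arctan ((a - t) / y) \<partial>\<nu> l))"
    if "a \<le> b" "0 < y" for a b y
  proof -
    have "(\<Sum>l\<in>A. c l * of_real (integral\<^sup>L (\<mu> l) (poisson (Complex x y))))
      = (\<Sum>l\<in>A'. d l * of_real (integral\<^sup>L (\<nu> l) (poisson (Complex x y))))" for x
      using that by (intro eq) simp
    then show ?thesis
      by (simp only: swap[OF that \<mu>, symmetric] swap[OF that \<nu>, symmetric])
  qed
  have atMost: "(\<Sum>l\<in>A. c l * of_real (measure (\<mu> l) {..b})) = (\<Sum>l\<in>A'. d l * of_real (measure (\<nu> l) {..b}))" for b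
  proof -
    define q where "q k m = (\<integral>t. arctan ((b + 1 / real (Suc k) - t) * (real (Suc k))\<^sup>2)
      - arctan ((- real (Suc k) - t) * (real (Suc k))\<^sup>2) \<partial>m)" for k m
    have lim: "(\<lambda>k. \<Sum>l\<in>I. e l * complex_of_real (q k (m l))) \<longlonglongrightarrow> (\<Sum>l\<in>I. e l * complex_of_real (pi * measure (m l) {..b}))"
      if "\<And>l. l \<in> I \<Longrightarrow> finite_borel_measure (m l)" for I :: "'z set" and e m
      unfolding q_def using that
      by (intro tendsto_sum tendsto_mult tendsto_const tendsto_of_real finite_borel_measure.poisson_inversion)
    \<comment> \<open>The segment from \<open>- real (Suc k)\<close> to
      \<open>b + 1 / real (Suc k)\<close> may be empty for small \<open>k\<close>.\<close>
    have "\<forall>\<^sub>F k in sequentially. - real (Suc k) \<le> b + 1 / real (Suc k)"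
      using eventually_ge_at_top[of "nat \<lceil>- b\<rceil>"]
    proof eventually_elim
      case (elim k)
      then have "- b \<le> real k"
        by linarith
      moreover have "0 \<le> 1 / real (Suc k)"
        by simp
      ultimately show ?case
        unfolding of_nat_Suc by linarith
    qed
    then have "\<forall>\<^sub>F k in sequentially.
        (\<Sum>l\<in>A. c l * of_real (q k (\<mu> l))) = (\<Sum>l\<in>A'. d l * of_real (q k (\<nu> l)))"
    proof eventually_elim
      case (elim k)
      from arctan_eq[OF elim, of "1 / (real (Suc k))\<^sup>2"] show ?case
        by (simp add: q_def)
    qed
    then have "(\<lambda>k. \<Sum>l\<in>A. c l * of_real (q k (\<mu> l)))
        \<longlonglongrightarrow> (\<Sum>l\<in>A'. d l * of_real (pi * measure (\<nu> l) {..b}))"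
      using lim[of A' \<nu> d] \<nu> by (subst tendsto_cong) auto
 
    from LIMSEQ_unique[OF lim[of A \<mu> c, OF \<mu>] this]
    have "(\<Sum>l\<in>A. c l * of_real (pi * measure (\<mu> l) {..b}))
        = (\<Sum>l\<in>A'. d l * of_real (pi * measure (\<nu> l) {..b}))"
      by this
    then have "complex_of_real pi * (\<Sum>l\<in>A. c l * of_real (measure (\<mu> l) {..b}))
        = complex_of_real pi * (\<Sum>l\<in>A'. d l * of_real (measure (\<nu> l) {..b}))"
      by (simp add: sum_distrib_left mult_ac)
    then show ?thesis
      by simp
  qed
  \<comment> \<open>The complement step of the Dynkin induction needs the total mass, and the whole
    line is not a half-line.\<close>
  have top: "(\<Sum>l\<in>A. c l * of_real (measure (\<mu> l) UNIV)) = (\<Sum>l\<in>A'. d l * of_real (measure (\<nu> l) UNIV))"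
  proof -
    have lim: "(\<lambda>k. \<Sum>l\<in>I. e l * complex_of_real (measure (m l) {..real k})) \<longlonglongrightarrow> (\<Sum>l\<in>I. e l * complex_of_real (measure (m l) UNIV))"
      if "\<And>l. l \<in> I \<Longrightarrow> finite_borel_measure (m l)" for I :: "'z set" and e m
      using that finite_borel_measure.cdf_lim_infty finite_borel_measure.borel_UNIV
      by (intro tendsto_sum tendsto_mult tendsto_const tendsto_of_real) (simp add: cdf_def2[symmetric])
    show ?thesis
      using LIMSEQ_unique[OF lim[of A \<mu> c, OF \<mu>, unfolded atMost] lim[of A' \<nu> d, OF \<nu>]] .
  qed
  have "sets borel = sigma_sets UNIV (range (\<lambda>a::real. {..a}))"
    by (subst borel_eq_atMost) simp
  then have B': "B \<in> sigma_sets UNIV (range (\<lambda>a::real. {..a}))"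
    using B by simp
  have "Int_stable (range (\<lambda>a::real. {..a}))" "range (\<lambda>a::real. {..a}) \<subseteq> Pow UNIV"
    by (auto simp: Int_stable_def)
  from this B' show ?thesis
  proof (induct rule: sigma_sets_induct_disjoint)
    case (compl S)
    have S: "S \<in> sets borel"
      using compl(1) by (subst borel_eq_atMost) simp
    have diff: "measure m (UNIV - S) = measure m UNIV - measure m S" if "finite_borel_measure m" for m
    proof -
      interpret finite_borel_measure m by fact
      show ?thesis
        using finite_measure_compl[of S] S by (simp add: borel_UNIV M_is_borel)
    qed
    have split: "(\<Sum>l\<in>I. e l * complex_of_real (measure (m l) (UNIV - S)))
        = (\<Sum>l\<in>I. e l * complex_of_real (measure (m l) UNIV)) - (\<Sum>l\<in>I. e l * complex_of_real (measure (m l) S))"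
      if "\<And>l. l \<in> I \<Longrightarrow> finite_borel_measure (m l)" for I :: "'z set" and e m
      using that by (simp add: diff algebra_simps flip: sum_subtractf)
    show ?case
      by (subst split[of A \<mu> c], erule \<mu>, subst split[of A' \<nu> d], erule \<nu>) (use top compl(2) in argo)
  next
    case (union S)
    have S: "range S \<subseteq> sets borel"
      using union(2) by (subst borel_eq_atMost) simp
    have lim: "(\<lambda>k. \<Sum>l\<in>I. e l * complex_of_real (measure (m l) (S k))) sums
        (\<Sum>l\<in>I. e l * complex_of_real (measure (m l) (\<Union>k. S k)))"
      if "\<And>l. l \<in> I \<Longrightarrow> finite_borel_measure (m l)" for I :: "'z set" and e m
    proof (intro sums_sum sums_mult sums_of_real)
      fix l assume "l \<in> I"
      then interpret finite_borel_measure "m l"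
        by (rule that)
      show "(\<lambda>k. measure (m l) (S k)) sums measure (m l) (\<Union>k. S k)"
        using S union(1) by (intro finite_measure_UNION) (auto simp: M_is_borel)
    qed
    show ?case
      using sums_unique2[OF lim[of A \<mu> c, OF \<mu>, unfolded union(3)] lim[of A' \<nu> d, OF \<nu>]] .
  qed (use atMost in auto)
qed

lemma measure_eq_of_poisson_eq:
  assumes "finite_borel_measure \<mu>" "finite_borel_measure \<nu>"
    and "\<And>\<eta>. 0 < Im \<eta> \<Longrightarrow> integral\<^sup>L \<mu> (poisson \<eta>) = integral\<^sup>L \<nu> (poisson \<eta>)"
    and "B \<in> sets borel"
  shows "measure \<mu> B = measure \<nu> B"
  using measure_combination_eq_of_poisson_eq[where A = "{()}" and A' = "{()}" and \<mu> = "\<lambda>_. \<mu>"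
      and \<nu> = "\<lambda>_. \<nu>" and c = "\<lambda>_. 1" and d = "\<lambda>_. 1" and B = B] assms
  by simp

section \<open>The Herglotz representation\<close>

text \<open>As a rational function of \<open>t\<close> the Poisson kernel has the poles \<eta> and
  \<open>cnj \<eta>\<close>. Only the first one lies in the upper half plane, so Cauchy's formula
  picks up the value at \<eta> alone.\<close>

lemma poisson_eq_cauchy:
  assumes "0 < Im \<eta>"
  shows "complex_of_real (poisson \<eta> t)
    = complex_of_real (Im \<eta>) / ((complex_of_real t - \<eta>) * (complex_of_real t - cnj \<eta>))"
proof -
  have "(complex_of_real t - \<eta>) * (complex_of_real t - cnj \<eta>) = complex_of_real ((t - Re \<eta>)\<^sup>2 + (Im \<eta>)\<^sup>2)"
    by (simp add: complex_eq_iff power2_eq_square algebra_simps)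
  then show ?thesis
    by (simp add: poisson_def)
qed

text \<open>
  Cauchy's formula for \<open>g(w) / (w - cnj \<eta>)\<close> on the rectangle with vertices \<open>-R, R, R + \<i>R, -R + \<i>R\<close>.
  The extra factor makes the integrand \<open>O(1 / R\<^sup>2)\<close> on the other three sides for any bounded \<open>g\<close>.
\<close>

lemma poisson_formula_truncated:
  assumes "0 < \<epsilon>" and g: "g holomorphic_on {w. - \<epsilon> < Im w}"
    and K: "\<And>w. 0 \<le> Im w \<Longrightarrow> norm (g w) \<le> K"
    and \<eta>: "0 < Im \<eta>" and R: "2 * norm \<eta> < R"
  shows "norm (complex_of_real pi * g \<eta> - integral {-R..R} (\<lambda>t. g (complex_of_real t) * complex_of_real (poisson \<eta> t)))
    \<le> 16 * K * Im \<eta> / R"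
proof -
  have R0: "0 < R"
    using R norm_ge_zero[of \<eta>] by linarith
  have K0: "0 \<le> K"
    using order_trans[OF norm_ge_zero K[of 0]] by simp
  have [simp]: "\<eta> \<noteq> cnj \<eta>"
    using \<eta> by (simp add: complex_eq_iff)
  \<comment> \<open>An open convex neighbourhood of the closed upper half plane that stays in the
    domain of \<open>g\<close> and excludes \<open>cnj \<eta>\<close>.\<close>
  define S where "S = {w. - min \<epsilon> (Im \<eta>) < Im w}"
  define h where "h w = g w / (w - cnj \<eta>)" for w
  define f where "f w = h w / (w - \<eta>)" for w
  define a1 a2 a3 a4 where "a1 = complex_of_real (- R)" and "a2 = complex_of_real R"
    and "a3 = Complex R R" and "a4 = Complex (- R) R"
  have convex: "convex S" and "open S"
    unfolding S_def by (rule convex_halfspace_Im_gt, rule open_halfspace_Im_gt)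
  have "w \<noteq> cnj \<eta>" if "w \<in> S" for w
    using that by (auto simp: S_def)
  moreover have "g holomorphic_on S"
    by (rule holomorphic_on_subset[OF g]) (auto simp: S_def)
  ultimately have "h holomorphic_on S"
    unfolding h_def
    by (intro holomorphic_on_divide holomorphic_on_diff holomorphic_on_ident holomorphic_on_const) auto
  moreover have in_box: "\<eta> \<in> box a1 a3"
    using R R0 \<eta> complex_Re_le_cmod[of \<eta>] abs_Re_le_cmod[of \<eta>] abs_Im_le_cmod[of \<eta>]
    by (auto simp: in_box_complex_iff a1_def a3_def)
  moreover have "path_image (rectpath a1 a3) \<subseteq> S - {\<eta>}"
  proof
    fix w assume w: "w \<in> path_image (rectpath a1 a3)"
    have "w \<in> cbox a1 a3"
      using path_image_rectpath_subset_cbox[of a1 a3] w R0 by (auto simp: a1_def a3_def)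
    then have "w \<in> S"
      using assms(1) \<eta> by (auto simp: in_cbox_complex_iff S_def a1_def a3_def)
    moreover have "w \<noteq> \<eta>"
      using path_image_rectpath_inter_box[of a1 a3] w in_box R0 by (auto simp: a1_def a3_def)
    ultimately show "w \<in> S - {\<eta>}"
      by simp
  qed
  ultimately have "(f has_contour_integral 2 * pi * \<i> * winding_number (rectpath a1 a3) \<eta> * h \<eta>) (rectpath a1 a3)"
    unfolding f_def using convex \<open>open S\<close> \<eta> assms(1)
    by (intro Cauchy_integral_formula_convex_simple[of S]) (auto simp: interior_open S_def)
  then have ci: "(f has_contour_integral 2 * pi * \<i> * h \<eta>) (rectpath a1 a3)"
    using winding_number_rectpath[OF in_box] by simp
  have rect: "rectpath a1 a3 = linepath a1 a2 +++ linepath a2 a3 +++ linepath a3 a4 +++ linepath a4 a1"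
    by (simp add: rectpath_def Let_def a1_def a2_def a3_def a4_def complex_of_real_def)
  have integrable: "f contour_integrable_on linepath a1 a2" "f contour_integrable_on linepath a2 a3"
    "f contour_integrable_on linepath a3 a4" "f contour_integrable_on linepath a4 a1"
    using has_contour_integral_integrable[OF ci] unfolding rect by simp_all
  have sum: "2 * pi * \<i> * h \<eta> = contour_integral (linepath a1 a2) f + (contour_integral (linepath a2 a3) f
      + (contour_integral (linepath a3 a4) f + contour_integral (linepath a4 a1) f))"
    using contour_integral_unique[OF ci] integrable unfolding rect by simp
  \<comment> \<open>Since \<open>R\<close> exceeds \<open>2 * norm \<eta>\<close>, both factors of
    the denominator are at least \<open>R / 2\<close>.\<close>
  have f_bound: "norm (f w) \<le> 4 * K / R\<^sup>2" if "0 \<le> Im w" "R \<le> norm w" for w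
  proof -
    have 1: "R / 2 \<le> norm (w - \<eta>)"
      using norm_triangle_ineq2[of w \<eta>] that R by linarith
    have 2: "R / 2 \<le> norm (w - cnj \<eta>)"
      using norm_triangle_ineq2[of w "cnj \<eta>"] that R by (simp only: complex_mod_cnj)
    have "R / 2 * (R / 2) \<le> norm (w - cnj \<eta>) * norm (w - \<eta>)"
      using 1 2 R0 by (intro mult_mono) auto
    then have "norm (g w) / (norm (w - cnj \<eta>) * norm (w - \<eta>)) \<le> K / (R / 2 * (R / 2))"
      using K[OF that(1)] K0 R0 by (intro frac_le) auto
    then show ?thesis
      by (simp add: f_def h_def norm_divide norm_mult power2_eq_square mult.commute)
  qed
  have B0: "0 \<le> 4 * K / R\<^sup>2"
    using K0 by simp
  have side: "norm (contour_integral (linepath p q) f) \<le> 4 * K / R\<^sup>2 * norm (q - p)"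
    if "f contour_integrable_on linepath p q" "\<And>w. w \<in> closed_segment p q \<Longrightarrow> 0 \<le> Im w \<and> R \<le> norm w" for p q
    using that f_bound by (intro contour_integral_bound_linepath B0) auto
  have right: "0 \<le> Im w \<and> R \<le> norm w" if "w \<in> closed_segment a2 a3" for w
  proof -
    have "Re w = R" "Im w \<in> {0..R}"
      using that R0 by (auto simp: a2_def a3_def closed_segment_same_Re complex_of_real_def closed_segment_eq_real_ivl)
    then show ?thesis
      using abs_Re_le_cmod[of w] R0 by auto
  qed
  have top: "0 \<le> Im w \<and> R \<le> norm w" if "w \<in> closed_segment a3 a4" for w
  proof -
    have "Im w = R"
      using that by (auto simp: a3_def a4_def closed_segment_same_Im)
    then show ?thesis
      using abs_Im_le_cmod[of w] R0 by auto
  qed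
  have left: "0 \<le> Im w \<and> R \<le> norm w" if "w \<in> closed_segment a4 a1" for w
  proof -
    have "Re w = - R" "Im w \<in> {0..R}"
      using that R0 by (auto simp: a4_def a1_def closed_segment_same_Re complex_of_real_def closed_segment_eq_real_ivl)
    then show ?thesis
      using abs_Re_le_cmod[of w] R0 by auto
  qed
  have lengths: "norm (a3 - a2) = R" "norm (a4 - a3) = 2 * R" "norm (a1 - a4) = R"
    using R0 by (simp_all add: a1_def a2_def a3_def a4_def cmod_def complex_of_real_def power2_eq_square real_sqrt_mult)
  have bottom: "contour_integral (linepath a1 a2) f = integral {-R..R} (\<lambda>t. f (complex_of_real t))"
    using contour_integral_linepath_Reals_eq[of a1 a2 f] R0 by (simp add: a1_def a2_def)
  \<comment> \<open>The right, top and left sides have lengths \<open>R\<close>,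
    \<open>2 * R\<close> and \<open>R\<close>, which makes 16 out of the constant 4.\<close>
  have "norm (2 * pi * \<i> * h \<eta> - integral {-R..R} (\<lambda>t. f (complex_of_real t)))
      \<le> 4 * K / R\<^sup>2 * R + (4 * K / R\<^sup>2 * (2 * R) + 4 * K / R\<^sup>2 * R)"
    unfolding sum bottom add_diff_cancel_left'
    using side[OF integrable(2) right] side[OF integrable(3) top] side[OF integrable(4) left] lengths
    by (intro norm_triangle_le add_mono) auto
  also have "\<dots> = 16 * K / R"
    using R0 by (simp add: field_simps power2_eq_square)
  finally have main: "norm (2 * pi * \<i> * h \<eta> - integral {-R..R} (\<lambda>t. f (complex_of_real t))) \<le> 16 * K / R" .
  have "g (complex_of_real t) * complex_of_real (poisson \<eta> t) = complex_of_real (Im \<eta>) * f (complex_of_real t)" for t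
    unfolding poisson_eq_cauchy[OF \<eta>] f_def h_def by (simp add: mult_ac)
  \<comment> \<open>\<open>h \<eta>\<close> contains the factor
    \<open>1 / (\<eta> - cnj \<eta>) = 1 / (2 * \<i> * Im \<eta>)\<close>, which reduces the
    constant \<open>2 * pi * \<i>\<close> of Cauchy's formula to \<open>pi\<close>.\<close>
  moreover have "complex_of_real pi * g \<eta> = complex_of_real (Im \<eta>) * (2 * pi * \<i> * h \<eta>)"
    using \<eta> by (simp add: h_def complex_diff_cnj field_simps complex_eq_iff)
  ultimately have "norm (complex_of_real pi * g \<eta> - integral {-R..R} (\<lambda>t. g (complex_of_real t) * complex_of_real (poisson \<eta> t)))
     = norm (complex_of_real (Im \<eta>) * (2 * pi * \<i> * h \<eta> - integral {-R..R} (\<lambda>t. f (complex_of_real t))))"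
    by (simp only: right_diff_distrib Henstock_Kurzweil_Integration.integral_mult_right)
  also have "\<dots> \<le> Im \<eta> * (16 * K / R)"
    using main \<eta> by (simp only: norm_mult norm_of_real) (intro mult_mono, auto)
  finally show ?thesis
    by (simp add: mult_ac)
qed

text \<open>The error in \<open>poisson_formula_truncated\<close> vanishes as the rectangle grows.
  Passing to imaginary parts makes the integrand nonnegative, so the truncated integrals increase
  and monotone convergence supplies integrability over the whole line.\<close>

lemma poisson_formula_Im:
  assumes "0 < \<epsilon>" and g: "g holomorphic_on {w. - \<epsilon> < Im w}"
    and K: "\<And>w. 0 \<le> Im w \<Longrightarrow> norm (g w) \<le> K"
    and pos: "\<And>w. 0 \<le> Im w \<Longrightarrow> 0 \<le> Im (g w)"
    and \<eta>: "0 < Im \<eta>"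
  shows "has_bochner_integral lborel (\<lambda>t. Im (g (complex_of_real t)) / pi * poisson \<eta> t) (Im (g \<eta>))"
proof -
  have contg: "continuous_on UNIV (\<lambda>t. g (complex_of_real t))"
    using assms(1) by (intro continuous_on_compose2[OF holomorphic_on_imp_continuous_on[OF g]] continuous_intros) auto
  have contp: "continuous_on UNIV (poisson \<eta>)"
    using \<eta> unfolding poisson_def by (intro continuous_intros) (auto simp: sum_power2_eq_zero_iff)
  have cont: "continuous_on UNIV (\<lambda>t. Im (g (complex_of_real t)) * poisson \<eta> t)"
    by (intro continuous_intros contg contp)
  define u where "u n t = indicator {- real n..real n} t *\<^sub>R (Im (g (complex_of_real t)) * poisson \<eta> t)" for n t
  have int_u: "integrable lborel (u n)" for n
    using borel_integrable_atLeastAtMost'[of "- real n" "real n", OF continuous_on_subset[OF cont]]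
    unfolding u_def set_integrable_def by simp
  have "integral\<^sup>L lborel (u n) = integral {- real n..real n} (\<lambda>t. Im (g (complex_of_real t)) * poisson \<eta> t)" for n
    using set_borel_integral_eq_integral(2)[of "{- real n..real n}" "\<lambda>t. Im (g (complex_of_real t)) * poisson \<eta> t"] int_u[of n]
    unfolding u_def set_integrable_def set_lebesgue_integral_def by simp
  also have "\<dots> n = Im (integral {- real n..real n} (\<lambda>t. g (complex_of_real t) * complex_of_real (poisson \<eta> t)))" for n
  proof -
    have "(\<lambda>t. g (complex_of_real t) * complex_of_real (poisson \<eta> t)) integrable_on {- real n..real n}"
      by (intro integrable_continuous_interval continuous_intros continuous_on_subset[OF contg] continuous_on_subset[OF contp]) auto
    from integral_linear[OF this bounded_linear_Im] show ?thesis
      by (simp add: comp_def)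
  qed
  finally have int_eq: "integral\<^sup>L lborel (u n) = Im (integral {- real n..real n} (\<lambda>t. g (complex_of_real t) * complex_of_real (poisson \<eta> t)))" for n .
  have "(\<lambda>n. integral {- real n..real n} (\<lambda>t. g (complex_of_real t) * complex_of_real (poisson \<eta> t)))
      \<longlonglongrightarrow> complex_of_real pi * g \<eta>"
  proof (subst LIM_zero_iff[symmetric], rule Lim_null_comparison)
    show "\<forall>\<^sub>F n in sequentially. norm (integral {- real n..real n} (\<lambda>t. g (complex_of_real t) * complex_of_real (poisson \<eta> t))
        - complex_of_real pi * g \<eta>) \<le> 16 * K * Im \<eta> / real n"
      using eventually_gt_at_top[of "nat \<lceil>2 * norm \<eta>\<rceil>"]
    proof eventually_elim
      case (elim n)
      then have "2 * norm \<eta> < real n"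
        by linarith
      from poisson_formula_truncated[OF assms(1) g K \<eta> this] show ?case
        by (simp add: norm_minus_commute)
    qed
    show "(\<lambda>n. 16 * K * Im \<eta> / real n) \<longlonglongrightarrow> 0"
      by (rule lim_const_over_n)
  qed
  from tendsto_Im[OF this] have lim: "(\<lambda>n. integral\<^sup>L lborel (u n)) \<longlonglongrightarrow> pi * Im (g \<eta>)"
    by (simp add: int_eq)
  have nonneg: "0 \<le> Im (g (complex_of_real t)) * poisson \<eta> t" for t
    using pos[of "complex_of_real t"] poisson_nonneg[OF \<eta>] by simp
  have "has_bochner_integral lborel (\<lambda>t. Im (g (complex_of_real t)) * poisson \<eta> t) (pi * Im (g \<eta>))"
  proof (rule has_bochner_integral_monotone_convergence[OF int_u _ _ lim])
    show "AE t in lborel. mono (\<lambda>n. u n t)"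
      using nonneg by (intro AE_I2 monoI) (auto simp: u_def indicator_def)
    show "AE t in lborel. (\<lambda>n. u n t) \<longlonglongrightarrow> Im (g (complex_of_real t)) * poisson \<eta> t"
    proof (intro AE_I2)
      fix t :: real
      have "\<forall>\<^sub>F n in sequentially. u n t = Im (g (complex_of_real t)) * poisson \<eta> t"
        using eventually_ge_at_top[of "nat \<lceil>\<bar>t\<bar>\<rceil>"]
      proof eventually_elim
        case (elim n)
        then have "t \<in> {- real n..real n}"
          by (auto; linarith)
        then show ?case
          by (simp add: u_def)
      qed
      then show "(\<lambda>n. u n t) \<longlonglongrightarrow> Im (g (complex_of_real t)) * poisson \<eta> t"
        by (rule tendsto_eventually)
    qed
    show "(\<lambda>t. Im (g (complex_of_real t)) * poisson \<eta> t) \<in> borel_measurable lborel"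
      using borel_measurable_continuous_onI[OF cont] by simp
  qed
  from has_bochner_integral_mult_right[OF this, of "1 / pi"] show ?thesis
    by simp
qed

lemma open_upper_half_plane: "open upper_half_plane"
  unfolding upper_half_plane_def by (rule open_halfspace_Im_gt)

lemma convex_upper_half_plane: "convex upper_half_plane"
  unfolding upper_half_plane_def by (rule convex_halfspace_Im_gt)

lemma connected_upper_half_plane: "connected upper_half_plane"
  by (rule convex_connected[OF convex_upper_half_plane])

text \<open>A nonconstant holomorphic function is open, but a subset of the real line contains no
  disc.\<close>

lemma holomorphic_real_valued_constant:
  assumes "f holomorphic_on S" "open S" "connected S" "\<And>w. w \<in> S \<Longrightarrow> Im (f w) = 0"
  shows "f constant_on S"
proof (rule ccontr)
  assume nc: "\<not> f constant_on S"
  then obtain w where w: "w \<in> S"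
    unfolding constant_on_def by blast
  have "open (f ` S)"
    by (rule open_mapping_thm[OF assms(1-3) assms(2) subset_refl nc])
  then obtain e where e: "0 < e" "ball (f w) e \<subseteq> f ` S"
    using w openE by blast
  have "f w + \<i> * complex_of_real (e / 2) \<in> ball (f w) e"
    using e(1) by (simp add: dist_norm norm_mult)
  then have "Im (f w + \<i> * complex_of_real (e / 2)) = 0"
    using e(2) assms(4) by fastforce
  then show False
    using assms(4)[OF w] e(1) by simp
qed

text \<open>
  The measure is a weak limit of the densities \<open>Im f(t + \<i>\<epsilon>) / \<pi>\<close> as \<open>\<epsilon> \<rightarrow> 0\<close>. They are probability densities
  and tight because \<open>y Im f(\<i>y)\<close> tends to \<open>1\<close>.
\<close>

lemma herglotz_real_distribution:
  assumes hol: "f holomorphic_on upper_half_plane"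
    and pos: "\<And>\<eta>. 0 < Im \<eta> \<Longrightarrow> 0 \<le> Im (f \<eta>)"
    and bound: "\<And>\<eta>. 0 < Im \<eta> \<Longrightarrow> norm (f \<eta>) \<le> 1 / Im \<eta>"
    and lim: "((\<lambda>y. y * Im (f (Complex 0 y))) \<longlongrightarrow> 1) at_top"
  shows "\<exists>M. real_distribution M \<and> (\<forall>\<eta>. 0 < Im \<eta> \<longrightarrow> f \<eta> = stieltjes M \<eta>)"
proof -
  define g where "g \<epsilon> w = f (w + \<i> * complex_of_real \<epsilon>)" for \<epsilon> w
  define p where "p \<epsilon> t = Im (g \<epsilon> (complex_of_real t)) / pi" for \<epsilon> t
  define \<mu> where "\<mu> \<epsilon> = density lborel (\<lambda>t. ennreal (p \<epsilon> t))" for \<epsilon>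
  have hol_g: "g \<epsilon> holomorphic_on {w. - \<epsilon> < Im w}" for \<epsilon>
    unfolding g_def
    by (intro holomorphic_on_compose_gen[OF _ hol, unfolded comp_def] holomorphic_intros)
      (auto simp: upper_half_plane_def)
  have g_pos: "0 \<le> Im (g \<epsilon> w)" if "0 < \<epsilon>" "0 \<le> Im w" for \<epsilon> w
    unfolding g_def using that by (intro pos) simp
  have g_bound: "norm (g \<epsilon> w) \<le> 1 / \<epsilon>" if "0 < \<epsilon>" "0 \<le> Im w" for \<epsilon> w
  proof -
    have "norm (g \<epsilon> w) \<le> 1 / (Im w + \<epsilon>)"
      unfolding g_def using bound[of "w + \<i> * complex_of_real \<epsilon>"] that by simp
    also have "\<dots> \<le> 1 / \<epsilon>"
      using that by (simp add: frac_le)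
    finally show ?thesis .
  qed
  have rep: "has_bochner_integral lborel (\<lambda>t. p \<epsilon> t * poisson \<eta> t) (Im (g \<epsilon> \<eta>))"
    if "0 < \<epsilon>" "0 < Im \<eta>" for \<epsilon> \<eta>
    unfolding p_def by (rule poisson_formula_Im[OF that(1) hol_g g_bound g_pos]) (use that in auto)
  have p_nonneg: "0 \<le> p \<epsilon> t" if "0 < \<epsilon>" for \<epsilon> t
    using g_pos[OF that, of "complex_of_real t"] by (simp add: p_def)
  have p_meas: "p \<epsilon> \<in> borel_measurable borel" if "0 < \<epsilon>" for \<epsilon>
  proof -
    have "continuous_on UNIV (\<lambda>t. g \<epsilon> (complex_of_real t))"
      using that by (intro continuous_on_compose2[OF holomorphic_on_imp_continuous_on[OF hol_g]] continuous_intros) auto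
    then show ?thesis
      unfolding p_def by (intro borel_measurable_continuous_onI continuous_intros) auto
  qed
  \<comment> \<open>This is \<open>lim\<close> at height \<open>m + \<epsilon>\<close> with
    \<open>m = real (Suc n)\<close>; the factor
    \<open>1 - \<epsilon> / (m + \<epsilon>) = m / (m + \<epsilon>)\<close> corrects the prefactor
    to \<open>m\<close>.\<close>
  have mass_lim: "(\<lambda>n. real (Suc n) * Im (g \<epsilon> (Complex 0 (real (Suc n))))) \<longlonglongrightarrow> 1" if "0 < \<epsilon>" for \<epsilon>
  proof -
    have Suc_top: "LIM n sequentially. real (Suc n) :> at_top"
      using filterlim_compose[OF filterlim_real_sequentially filterlim_Suc] .
    have add_top: "LIM n sequentially. real (Suc n) + \<epsilon> :> at_top"
      using filterlim_tendsto_add_at_top[OF tendsto_const Suc_top, of \<epsilon>] by (simp only: add.commute)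
    have "(\<lambda>n. 1 - \<epsilon> / (real (Suc n) + \<epsilon>)) \<longlonglongrightarrow> 1 - 0"
      by (intro tendsto_intros tendsto_divide_0[OF tendsto_const] filterlim_at_top_imp_at_infinity add_top)
    from tendsto_mult[OF this filterlim_compose[OF lim add_top]]
    have "(\<lambda>n. (1 - \<epsilon> / (real (Suc n) + \<epsilon>)) * ((real (Suc n) + \<epsilon>) * Im (f (Complex 0 (real (Suc n) + \<epsilon>))))) \<longlonglongrightarrow> 1"
      by simp
    moreover have "(1 - \<epsilon> / (real (Suc n) + \<epsilon>)) * ((real (Suc n) + \<epsilon>) * Im (f (Complex 0 (real (Suc n) + \<epsilon>))))
        = real (Suc n) * Im (g \<epsilon> (Complex 0 (real (Suc n))))" for n
    proof -
      have "Complex 0 (real (Suc n)) + \<i> * complex_of_real \<epsilon> = Complex 0 (real (Suc n) + \<epsilon>)"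
        by (simp add: complex_eq_iff)
      moreover have "(1 - \<epsilon> / (real (Suc n) + \<epsilon>)) * (real (Suc n) + \<epsilon>) = real (Suc n)"
        using that by (simp add: field_simps)
      ultimately show ?thesis
        unfolding g_def mult.assoc[symmetric] by (simp only:)
    qed
    ultimately show ?thesis
      by (simp only:)
  qed
  \<comment> \<open>\<open>m * poisson (Complex 0 m) t\<close> increases to 1 as \<open>m\<close>
    grows, so monotone convergence reads off the total mass from \<open>mass_lim\<close>.\<close>
  have mass: "has_bochner_integral lborel (p \<epsilon>) 1" if \<epsilon>: "0 < \<epsilon>" for \<epsilon>
  proof -
    define v where "v n t = real (Suc n) * (p \<epsilon> t * poisson (Complex 0 (real (Suc n))) t)" for n t
    have kernel: "m * poisson (Complex 0 m) t = 1 / ((t / m)\<^sup>2 + 1)" if "0 < m" for m t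
      using that by (simp add: poisson_def field_simps power2_eq_square)
    have v: "v n t = p \<epsilon> t * (1 / ((t / real (Suc n))\<^sup>2 + 1))" for n t
      unfolding v_def kernel[OF of_nat_0_less_iff[THEN iffD2, OF zero_less_Suc], symmetric] by (simp only: mult_ac)
    have int_v: "has_bochner_integral lborel (v n) (real (Suc n) * Im (g \<epsilon> (Complex 0 (real (Suc n)))))" for n
      unfolding v_def by (intro has_bochner_integral_mult_right rep \<epsilon>) simp
    show ?thesis
    proof (rule has_bochner_integral_monotone_convergence)
      show "integrable lborel (v n)" for n
        using int_v by (simp add: has_bochner_integral_iff)
      show "AE t in lborel. mono (\<lambda>n. v n t)"
      proof (intro AE_I2 monoI)
        fix t :: real and n m :: nat assume "n \<le> m"
        then have "(\<bar>t\<bar> / real (Suc m))\<^sup>2 \<le> (\<bar>t\<bar> / real (Suc n))\<^sup>2"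
          by (intro power_mono divide_left_mono) auto
        then show "v n t \<le> v m t"
          unfolding v using p_nonneg[OF \<epsilon>] by (intro mult_left_mono divide_left_mono) (auto simp: power_divide add_nonneg_pos)
      qed
      show "AE t in lborel. (\<lambda>n. v n t) \<longlonglongrightarrow> p \<epsilon> t"
      proof (intro AE_I2)
        fix t
        have "(\<lambda>n. t / real (Suc n)) \<longlonglongrightarrow> 0"
          using LIMSEQ_Suc[OF lim_const_over_n[of t]] .
        then have "(\<lambda>n. p \<epsilon> t * (1 / ((t / real (Suc n))\<^sup>2 + 1))) \<longlonglongrightarrow> p \<epsilon> t * (1 / (0\<^sup>2 + 1))"
          by (intro tendsto_intros) auto
        then show "(\<lambda>n. v n t) \<longlonglongrightarrow> p \<epsilon> t"
          unfolding v by simp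
      qed
      show "(\<lambda>n. integral\<^sup>L lborel (v n)) \<longlonglongrightarrow> 1"
        using mass_lim[OF \<epsilon>] int_v by (simp add: has_bochner_integral_iff)
      show "p \<epsilon> \<in> borel_measurable lborel"
        using p_meas[OF \<epsilon>] by simp
    qed
  qed
  have dist: "real_distribution (\<mu> \<epsilon>)" if \<epsilon>: "0 < \<epsilon>" for \<epsilon>
  proof -
    have "emeasure (\<mu> \<epsilon>) UNIV = (\<integral>\<^sup>+t. ennreal (p \<epsilon> t) \<partial>lborel)"
      unfolding \<mu>_def using p_meas[OF \<epsilon>] by (subst emeasure_density) auto
    also have "\<dots> = 1"
      using has_bochner_integral_iff[of lborel "p \<epsilon>" 1] mass[OF \<epsilon>] p_nonneg[OF \<epsilon>]
      by (subst nn_integral_eq_integral) auto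
    finally have "prob_space (\<mu> \<epsilon>)"
      by (intro prob_spaceI) (simp add: \<mu>_def)
    then show ?thesis
      by (intro real_distribution.intro) (simp_all add: real_distribution_axioms_def \<mu>_def)
  qed
  have poisson_\<mu>: "integral\<^sup>L (\<mu> \<epsilon>) (poisson \<eta>) = Im (g \<epsilon> \<eta>)" if "0 < \<epsilon>" "0 < Im \<eta>" for \<epsilon> \<eta>
    using rep[OF that] p_nonneg[OF that(1)] p_meas[OF that(1)] unfolding \<mu>_def
    by (subst integral_density) (auto simp: has_bochner_integral_iff)
  define e where "e k = 1 / real (Suc k)" for k
  have e_pos: "0 < e k" and e_le: "e k \<le> 1" for k
    by (simp_all add: e_def)
  \<comment> \<open>\<open>y * poisson (Complex 0 y) t\<close> is at most 1, and at most 1/2 outside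
    \<open>{-y<..y}\<close>. Hence a weighted Poisson integral above \<open>1 - \<delta> / 2\<close>
    leaves mass above \<open>1 - \<delta>\<close> in that interval. One \<open>y\<close> serves for
    all \<open>k\<close>: as \<open>e k \<le> 1\<close>, the factor \<open>y / (y + e k)\<close> is
    at least \<open>1 - 1 / (y + 1)\<close>.\<close>
  have "tight (\<lambda>k. \<mu> (e k))"
    unfolding tight_def
  proof (intro conjI allI impI)
    show "real_distribution (\<mu> (e k))" for k
      by (rule dist[OF e_pos])
    fix \<delta> :: real assume \<delta>: "0 < \<delta>"
    have "((\<lambda>y. (1 - 1 / (y + 1)) * (1 - \<delta> / 4)) \<longlongrightarrow> (1 - 0) * (1 - \<delta> / 4)) at_top"
      by (intro tendsto_intros tendsto_divide_0[OF tendsto_const] filterlim_at_top_imp_at_infinity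
          filterlim_tendsto_add_at_top[OF tendsto_const filterlim_ident, of 1, unfolded add.commute[of 1]])
    then have "\<forall>\<^sub>F y in at_top. 1 - \<delta> / 2 < (1 - 1 / (y + 1)) * (1 - \<delta> / 4)"
      using \<delta> by (intro order_tendstoD(1)) auto
    moreover have "\<forall>\<^sub>F y in at_top. 1 - \<delta> / 4 < y * Im (f (Complex 0 y))"
      using lim \<delta> by (intro order_tendstoD(1)) auto
    ultimately have "\<forall>\<^sub>F y in at_top. 1 - \<delta> / 2 < (1 - 1 / (y + 1)) * (1 - \<delta> / 4) \<and> 1 - \<delta> / 4 < y * Im (f (Complex 0 y))"
      by (rule eventually_conj)
    then obtain y1 where y1: "\<And>y. y \<ge> y1 \<Longrightarrow> 1 - \<delta> / 2 < (1 - 1 / (y + 1)) * (1 - \<delta> / 4)"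
      "\<And>y. y \<ge> y1 \<Longrightarrow> 1 - \<delta> / 4 < y * Im (f (Complex 0 y))"
      unfolding eventually_at_top_linorder by blast
    define y where "y = max y1 1"
    have y: "0 < y" "y1 \<le> y"
      by (auto simp: y_def)
    have large: "1 - \<delta> / 2 < y * Im (g (e k) (Complex 0 y))" for k
    proof -
      have "1 - 1 / (y + 1) = y / (y + 1)"
        using y by (simp add: field_simps)
      moreover have "y / (y + 1) \<le> y / (y + e k)"
        using y e_le[of k] e_pos[of k] by (intro divide_left_mono) auto
      ultimately have q: "0 \<le> 1 - 1 / (y + 1)" "1 - 1 / (y + 1) \<le> y / (y + e k)"
        using y by auto
      have a: "1 - \<delta> / 4 < (y + e k) * Im (f (Complex 0 (y + e k)))"
        using y1(2)[of "y + e k"] y(2) e_pos[of k] by simp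
      have "Complex 0 y + \<i> * complex_of_real (e k) = Complex 0 (y + e k)"
        by (simp add: complex_eq_iff)
      then have b: "y / (y + e k) * ((y + e k) * Im (f (Complex 0 (y + e k)))) = y * Im (g (e k) (Complex 0 y))"
        using y(1) e_pos[of k] by (simp add: g_def)
      have "0 \<le> (y + e k) * Im (f (Complex 0 (y + e k)))"
        using pos[of "Complex 0 (y + e k)"] y(1) e_pos[of k] by simp
      then have "(1 - 1 / (y + 1)) * ((y + e k) * Im (f (Complex 0 (y + e k)))) \<le> y * Im (g (e k) (Complex 0 y))"
        unfolding b[symmetric] by (intro mult_right_mono q)
      moreover have "(1 - 1 / (y + 1)) * (1 - \<delta> / 4) \<le> (1 - 1 / (y + 1)) * ((y + e k) * Im (f (Complex 0 (y + e k))))"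
        using a q(1) by (intro mult_left_mono) auto
      ultimately show ?thesis
        using y1(1)[OF y(2)] by linarith
    qed
    have "1 - \<delta> < measure (\<mu> (e k)) {-y<..y}" for k
    proof -
      interpret real_distribution "\<mu> (e k)"
        by (rule dist[OF e_pos])
      have "y * Im (g (e k) (Complex 0 y)) = (\<integral>t. y * poisson (Complex 0 y) t \<partial>\<mu> (e k))"
        using poisson_\<mu>[OF e_pos, of "Complex 0 y"] y(1) by simp
      also have "\<dots> \<le> (\<integral>t. 1 / 2 + 1 / 2 * indicator {-y<..y} t \<partial>\<mu> (e k))"
      proof (rule integral_mono)
        show "integrable (\<mu> (e k)) (\<lambda>t. y * poisson (Complex 0 y) t)"
          using integrable_poisson[of "Complex 0 y"] y(1) by simp
        show "integrable (\<mu> (e k)) (\<lambda>t. 1 / 2 + 1 / 2 * indicat_real {-y<..y} t)"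
          by (intro Bochner_Integration.integrable_add integrable_mult_right) (auto simp: emeasure_eq_measure)
        fix t
        have "y * poisson (Complex 0 y) t = y\<^sup>2 / (t\<^sup>2 + y\<^sup>2)"
          by (simp add: poisson_def power2_eq_square)
        moreover have "y\<^sup>2 / (t\<^sup>2 + y\<^sup>2) \<le> 1"
          using y(1) by (simp add: add_nonneg_pos)
        moreover have "y\<^sup>2 / (t\<^sup>2 + y\<^sup>2) \<le> 1 / 2" if "t \<notin> {-y<..y}"
        proof -
          have "y \<le> \<bar>t\<bar>"
            using that by auto
          then have "y\<^sup>2 \<le> t\<^sup>2"
            using y(1) by (metis abs_le_square_iff abs_of_pos)
          then show ?thesis
            using y(1) by (simp add: field_simps add_nonneg_pos)
        qed
        ultimately show "y * poisson (Complex 0 y) t \<le> 1 / 2 + 1 / 2 * indicator {-y<..y} t"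
          by (auto simp: indicator_def)
      qed
      also have "\<dots> = 1 / 2 + 1 / 2 * measure (\<mu> (e k)) {-y<..y}"
        using prob_space by (subst Bochner_Integration.integral_add) (auto simp: emeasure_eq_measure)
      finally show ?thesis
        using large[of k] by simp
    qed
    then show "\<exists>a b. a < b \<and> (\<forall>k. 1 - \<delta> < measure (\<mu> (e k)) {a<..b})"
      using y(1) by (intro exI[of _ "-y"] exI[of _ y]) auto
  qed
  then obtain r M where r: "strict_mono (r :: nat \<Rightarrow> nat)" and M: "real_distribution M"
    and conv: "weak_conv_m ((\<lambda>k. \<mu> (e k)) \<circ> id \<circ> r) M"
    using tight_imp_convergent_subsubsequence[of "\<lambda>k. \<mu> (e k)" id] by (auto simp: strict_mono_def)
  interpret M: real_distribution M
    by fact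
  have hol_M: "stieltjes M holomorphic_on upper_half_plane"
    by (rule M.holomorphic_on_stieltjes)
  have Im_eq: "Im (f \<eta>) = Im (stieltjes M \<eta>)" if \<eta>: "0 < Im \<eta>" for \<eta>
  proof -
    have "(\<lambda>k. integral\<^sup>L (((\<lambda>k. \<mu> (e k)) \<circ> id \<circ> r) k) (poisson \<eta>)) \<longlonglongrightarrow> integral\<^sup>L M (poisson \<eta>)"
    proof (rule weak_conv_imp_integral_bdd_continuous_conv[OF _ M conv])
      show "isCont (poisson \<eta>) t" for t
        using \<eta> unfolding poisson_def by (intro continuous_intros) (auto simp: sum_power2_eq_zero_iff)
      show "norm (poisson \<eta> t) \<le> 1 / Im \<eta>" for t
        using poisson_le[OF \<eta>] poisson_nonneg[OF \<eta>] by simp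
    qed (simp add: dist e_pos)
    then have 1: "(\<lambda>k. Im (f (\<eta> + \<i> * complex_of_real (e (r k))))) \<longlonglongrightarrow> Im (stieltjes M \<eta>)"
      using \<eta> by (simp add: poisson_\<mu> e_pos g_def M.Im_stieltjes)
    have "e \<longlonglongrightarrow> 0"
      unfolding e_def using LIMSEQ_Suc[OF lim_const_over_n[of 1]] .
    then have "(\<lambda>k. \<eta> + \<i> * complex_of_real (e (r k))) \<longlonglongrightarrow> \<eta> + \<i> * complex_of_real 0"
      using LIMSEQ_subseq_LIMSEQ[OF _ r, of e 0] by (intro tendsto_intros) (simp add: comp_def)
    moreover have "isCont f \<eta>"
      using holomorphic_on_imp_continuous_on[OF hol] open_upper_half_plane \<eta>
      by (auto simp: continuous_on_eq_continuous_at upper_half_plane_def)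
    ultimately have "(\<lambda>k. f (\<eta> + \<i> * complex_of_real (e (r k)))) \<longlonglongrightarrow> f \<eta>"
      using isCont_tendsto_compose by fastforce
    from LIMSEQ_unique[OF tendsto_Im[OF this] 1] show ?thesis .
  qed
  \<comment> \<open>Weak convergence has only identified the imaginary parts. The remaining constant
    vanishes because both functions decay along the imaginary axis.\<close>
  have "(\<lambda>\<eta>. f \<eta> - stieltjes M \<eta>) constant_on upper_half_plane"
    using Im_eq by (intro holomorphic_real_valued_constant holomorphic_on_diff hol hol_M
        open_upper_half_plane connected_upper_half_plane) (auto simp: upper_half_plane_def)
  then obtain d where d: "\<And>\<eta>. 0 < Im \<eta> \<Longrightarrow> f \<eta> - stieltjes M \<eta> = d"
    unfolding constant_on_def upper_half_plane_def by blast
  have "norm d \<le> 2 / y" if "0 < y" for y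
  proof -
    have "norm d \<le> norm (f (Complex 0 y)) + norm (stieltjes M (Complex 0 y))"
      using d[of "Complex 0 y"] that norm_triangle_ineq4[of "f (Complex 0 y)" "stieltjes M (Complex 0 y)"] by simp
    also have "\<dots> \<le> 1 / y + 1 / y"
      using bound[of "Complex 0 y"] M.norm_stieltjes_le[of "Complex 0 y"] that M.prob_space
      by (intro add_mono) auto
    finally show ?thesis
      by simp
  qed
  \<comment> \<open>At this height the bound reads \<open>norm d \<le> norm d / 2\<close>.\<close>
  from this[of "4 / norm d"] have "d = 0"
    by (cases "d = 0") auto
  with d M show ?thesis
    by auto
qed

lemma (in finite_borel_measure) scale_finite_borel_measure:
  assumes "0 \<le> c"
  shows "finite_borel_measure (density M (\<lambda>_. ennreal c))"
    and "measure (density M (\<lambda>_. ennreal c)) UNIV = c * measure M UNIV"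
    and "0 < Im \<eta> \<Longrightarrow> stieltjes (density M (\<lambda>_. ennreal c)) \<eta> = c *\<^sub>R stieltjes M \<eta>"
proof -
  have e: "emeasure (density M (\<lambda>_. ennreal c)) UNIV = ennreal c * emeasure M UNIV"
    using sets.top[of M] by (subst emeasure_density_const) (simp_all add: borel_UNIV)
  show "measure (density M (\<lambda>_. ennreal c)) UNIV = c * measure M UNIV"
    using assms by (simp add: measure_def e enn2real_mult)
  show "finite_borel_measure (density M (\<lambda>_. ennreal c))"
    by (intro finite_borel_measure.intro finite_measureI)
      (simp_all add: finite_borel_measure_axioms_def M_is_borel borel_UNIV e ennreal_mult_eq_top_iff)
  show "stieltjes (density M (\<lambda>_. ennreal c)) \<eta> = c *\<^sub>R stieltjes M \<eta>" if "0 < Im \<eta>"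
    using assms borel_measurable_integrable[OF integrable_cauchy_kernel[OF that]]
    unfolding stieltjes_def by (subst integral_density) auto
qed

theorem herglotz_representation:
  assumes hol: "f holomorphic_on upper_half_plane"
    and pos: "\<And>\<eta>. 0 < Im \<eta> \<Longrightarrow> 0 \<le> Im (f \<eta>)"
    and bound: "\<And>\<eta>. 0 < Im \<eta> \<Longrightarrow> norm (f \<eta>) \<le> c / Im \<eta>"
    and lim: "((\<lambda>y. y * Im (f (Complex 0 y))) \<longlongrightarrow> c) at_top"
  shows "\<exists>M. finite_borel_measure M \<and> measure M UNIV = c \<and> (\<forall>\<eta>. 0 < Im \<eta> \<longrightarrow> f \<eta> = stieltjes M \<eta>)"
proof -
  have c0: "0 \<le> c"
    using order_trans[OF norm_ge_zero bound[of \<i>]] by simp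
  show ?thesis
  \<comment> \<open>Mass 0 cannot be normalized, and it does occur: \<open>matrix_herglotz\<close>
    uses every vector \<open>x\<close>, and the polarization vector for \<open>i = j\<close>,
    \<open>k = 2\<close> is 0.\<close>
  proof (cases "c = 0")
    case True
    have "finite_borel_measure (null_measure lborel)"
      by (intro finite_borel_measure.intro finite_measureI) (auto simp: finite_borel_measure_axioms_def)
    moreover have "f \<eta> = stieltjes (null_measure lborel) \<eta>" if "0 < Im \<eta>" for \<eta>
      using bound[OF that] True by (simp add: stieltjes_def)
    ultimately show ?thesis
      using True by (intro exI[of _ "null_measure lborel"]) (simp add: measure_def)
  next
    case False
    with c0 have c: "0 < c"
      by simp
    have "\<exists>M. real_distribution M \<and> (\<forall>\<eta>. 0 < Im \<eta> \<longrightarrow> f \<eta> /\<^sub>R c = stieltjes M \<eta>)"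
    proof (rule herglotz_real_distribution)
      show "(\<lambda>\<eta>. f \<eta> /\<^sub>R c) holomorphic_on upper_half_plane"
        unfolding scaleR_conv_of_real by (intro holomorphic_intros hol)
      show "norm (f \<eta> /\<^sub>R c) \<le> 1 / Im \<eta>" if "0 < Im \<eta>" for \<eta>
        using bound[OF that] c that by (simp add: field_simps)
      from tendsto_mult_left[OF lim, of "1 / c"] show "((\<lambda>y. y * Im (f (Complex 0 y) /\<^sub>R c)) \<longlongrightarrow> 1) at_top"
        using c by (simp add: field_simps)
    qed (use pos c in auto)
    then obtain M where M: "real_distribution M" "\<And>\<eta>. 0 < Im \<eta> \<Longrightarrow> f \<eta> /\<^sub>R c = stieltjes M \<eta>"
      by blast
    interpret real_distribution M
      by fact
    show ?thesis
      using scale_finite_borel_measure[OF c0] M(2)[symmetric] c prob_space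
      by (intro exI[of _ "density M (\<lambda>_. ennreal c)"]) auto
  qed
qed

section \<open>Matrix Stieltjes transforms\<close>

definition sesq :: "complex^'m \<Rightarrow> complex^'m \<Rightarrow> complex^'m^'m \<Rightarrow> complex" where
  "sesq x y A = (\<Sum>i\<in>UNIV. \<Sum>j\<in>UNIV. cnj (x $ i) * y $ j * A $ i $ j)"

definition qf :: "complex^'m \<Rightarrow> complex^'m^'m \<Rightarrow> complex" where
  "qf x A = (\<Sum>i\<in>UNIV. cnj (x $ i) * (A *v x) $ i)"

lemma qf_eq_sesq: "qf x A = sesq x x A"
  by (simp add: qf_def sesq_def matrix_vector_mult_def sum_distrib_left mult_ac)

lemma sesq_add_left: "sesq (x + x') y A = sesq x y A + sesq x' y A"
  and sesq_add_right: "sesq x (y + y') A = sesq x y A + sesq x y' A"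
  by (simp_all add: sesq_def algebra_simps sum.distrib)

lemma sesq_scale_left: "sesq (c *s x) y A = cnj c * sesq x y A"
  and sesq_scale_right: "sesq x (c *s y) A = c * sesq x y A"
  by (simp_all add: sesq_def sum_distrib_left mult_ac)

lemma sesq_axis: "sesq (axis i 1) (axis j 1) A = A $ i $ j"
proof -
  have "cnj (axis i 1 $ p) * axis j 1 $ q * A $ p $ q = (if p = i then (if q = j then A $ p $ q else 0) else 0)" for p q
    by (simp add: axis_def)
  moreover have "(\<Sum>q\<in>UNIV. if p = i then if q = j then A $ p $ q else 0 else 0) = (if p = i then A $ p $ j else 0)" for p
    by (cases "p = i") simp_all
  ultimately show ?thesis
    by (simp add: sesq_def)
qed

lemma qf_add: "qf x (A + B) = qf x A + qf x B"
  and qf_diff: "qf x (A - B) = qf x A - qf x B"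
  and qf_scaleR: "qf x (r *\<^sub>R A) = r *\<^sub>R qf x A"
  by (simp_all add: qf_eq_sesq sesq_def algebra_simps sum.distrib sum_subtractf scaleR_sum_right)

lemma bounded_linear_qf: "bounded_linear (qf x)"
  by (rule linear_conv_bounded_linear[THEN iffD1], rule linearI) (simp_all add: qf_add qf_scaleR)

lemma qf_mat_1: "qf x (mat 1) = complex_of_real ((norm x)\<^sup>2)"
proof -
  have "(norm x)\<^sup>2 = (\<Sum>i\<in>UNIV. (norm (x $ i))\<^sup>2)"
    by (simp add: norm_vec_def L2_set_def sum_nonneg)
  then show ?thesis
    by (simp add: qf_def mult.commute[of "cnj _"] complex_norm_square[symmetric])
qed

definition polar_vec :: "'m \<Rightarrow> 'm \<Rightarrow> nat \<Rightarrow> complex^'m::finite" where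
  "polar_vec i j k = (1 / 2) *s (axis j 1 + \<i> ^ k *s axis i 1)"

text \<open>The sums of \<open>\<i> ^ k\<close> and of \<open>\<i> ^ (2 * k)\<close> over
  \<open>k < 4\<close> vanish, so only the term with \<open>\<i> ^ k * cnj (\<i> ^ k) = 1\<close>
  remains. The coefficients are those of \<open>has_complex_measure_integral\<close>: four positive
  measures attached to the vectors \<open>polar_vec i j k\<close> decompose the entry
  \<open>(i, j)\<close> directly.\<close>

lemma polarization: "A $ i $ j = (\<Sum>k<4. \<i> ^ k * qf (polar_vec i j k) A)"
  unfolding polar_vec_def qf_eq_sesq
  by (simp add: eval_nat_numeral sesq_add_left sesq_add_right sesq_scale_left sesq_scale_right sesq_axis algebra_simps)

lemma norm_polar_vec: "norm (polar_vec i j k) \<le> 1"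
proof -
  have n: "norm (axis p c :: complex^'a) = norm c" for p :: 'a and c :: complex
  proof -
    have "(norm (axis p c $ q))\<^sup>2 = (if q = p then (norm c)\<^sup>2 else 0)" for q
      by (simp add: axis_def)
    then show ?thesis
      by (simp add: norm_vec_def L2_set_def)
  qed
  have "polar_vec i j k = (1 / 2 :: real) *\<^sub>R (axis j 1 + axis i (\<i> ^ k))"
    by (simp add: polar_vec_def vec_eq_iff axis_def) (auto simp: scaleR_conv_of_real)
  then have "norm (polar_vec i j k) = norm (axis j 1 + axis i (\<i> ^ k) :: complex^'a) / 2"
    by simp
  also have "\<dots> \<le> (norm (axis j 1 :: complex^'a) + norm (axis i (\<i> ^ k) :: complex^'a)) / 2"
    by (intro divide_right_mono norm_triangle_ineq) simp
  finally show ?thesis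
    by (simp add: n norm_power)
qed

definition im_part :: "complex^'m^'m \<Rightarrow> complex^'m^'m" where
  "im_part A = (\<chi> i j. (A $ i $ j - cnj (A $ j $ i)) / (2 * \<i>))"

text \<open>Makes the imaginary part of a quadratic form again a quadratic form, so that
  polarization applies to Poisson integrals.\<close>

lemma qf_im_part: "qf x (im_part A) = complex_of_real (Im (qf x A))"
proof -
  have "cnj (qf x A) = (\<Sum>i\<in>UNIV. \<Sum>j\<in>UNIV. cnj (x $ i) * x $ j * cnj (A $ j $ i))"
    unfolding qf_eq_sesq sesq_def by (subst sum.swap) (simp add: mult_ac)
  then have "qf x (im_part A) = (qf x A - cnj (qf x A)) / (2 * \<i>)"
    unfolding qf_eq_sesq sesq_def im_part_def vec_lambda_beta
    by (simp only: sum_subtractf[symmetric] sum_divide_distrib right_diff_distrib diff_divide_distrib times_divide_eq_right)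
  then show ?thesis
    by (simp add: complex_diff_cnj complex_eq_iff)
qed

lemma hermitian_iff_Im_qf: "(\<forall>i j. A $ i $ j = cnj (A $ j $ i)) \<longleftrightarrow> (\<forall>x. Im (qf x A) = 0)"
proof
  assume "\<forall>i j. A $ i $ j = cnj (A $ j $ i)"
  then have "cnj (A $ j $ i) = A $ i $ j" for i j
    by metis
  then have "im_part A = 0"
    by (simp add: im_part_def vec_eq_iff)
  then have "qf x (im_part A) = 0" for x
    by (simp add: qf_def)
  then show "\<forall>x. Im (qf x A) = 0"
    by (simp add: qf_im_part)
next
  assume *: "\<forall>x. Im (qf x A) = 0"
  have "im_part A $ i $ j = 0" for i j
    unfolding polarization[of "im_part A"] qf_im_part using * by simp
  then have "A $ i $ j - cnj (A $ j $ i) = 0" for i j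
    unfolding im_part_def vec_lambda_beta by (metis divide_eq_0_iff complex_i_not_zero mult_eq_0_iff zero_neq_numeral)
  then show "\<forall>i j. A $ i $ j = cnj (A $ j $ i)"
    unfolding right_minus_eq by blast
qed

lemma hermitian_nonneg_iff: "hermitian_nonneg A \<longleftrightarrow> (\<forall>x. Im (qf x A) = 0 \<and> 0 \<le> Re (qf x A))"
  unfolding hermitian_nonneg_def hermitian_iff_Im_qf qf_def[symmetric] by blast

text \<open>Flattens a quadratic form with polarized entries into a single sum over triples, the
  shape that the two comparison lemmas for combinations of measures accept.\<close>

lemma qf_triple_sum:
  assumes "\<And>i j. A $ i $ j = (\<Sum>k<4. \<i> ^ k * q i j k)"
  shows "(\<Sum>l\<in>UNIV \<times> UNIV \<times> {..<4::nat}. (cnj (x $ fst l) * x $ fst (snd l) * \<i> ^ snd (snd l))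
      * q (fst l) (fst (snd l)) (snd (snd l))) = qf x A"
  by (simp add: qf_eq_sesq sesq_def assms sum.cartesian_product' sum_distrib_left mult.assoc)

lemma matrix_measure_qf:
  assumes "matrix_measure \<mu>"
  shows "\<exists>m. finite_borel_measure m \<and> (\<forall>B\<in>sets borel. complex_of_real (measure m B) = qf x (\<mu> B))"
proof -
  define w where "w B = Re (qf x (\<mu> B))" for B
  have nonneg: "0 \<le> w B" and real: "Im (qf x (\<mu> B)) = 0" if "B \<in> sets borel" for B
    using assms that by (auto simp: matrix_measure_def hermitian_nonneg_iff w_def)
  have empty: "w {} = 0"
    using assms by (simp add: matrix_measure_def w_def qf_def)
  define m where "m = measure_of UNIV (sets borel) (\<lambda>B. ennreal (w B))"
  have sets: "sets m = sets borel"
    unfolding m_def by (metis sets.sigma_sets_eq sets_measure_of space_borel top_greatest Pow_UNIV)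
  have em: "emeasure m B = ennreal (w B)" if "B \<in> sets borel" for B
    unfolding m_def
  proof (rule emeasure_measure_of_sigma)
    show "sigma_algebra UNIV (sets (borel :: real measure))"
      using sets.sigma_algebra_axioms[of "borel :: real measure"] by simp
    show "positive (sets borel) (\<lambda>B. ennreal (w B))"
      by (simp add: positive_def empty)
    show "countably_additive (sets borel) (\<lambda>B. ennreal (w B))"
    proof (rule countably_additiveI)
      fix A :: "nat \<Rightarrow> real set" assume A: "range A \<subseteq> sets borel" "disjoint_family A"
      then have "(\<lambda>k. \<mu> (A k)) sums \<mu> (\<Union>k. A k)"
        using assms by (simp add: matrix_measure_def)
      then have "(\<lambda>k. w (A k)) sums w (\<Union>k. A k)"
        unfolding w_def by (intro bounded_linear.sums[OF bounded_linear_Re] bounded_linear.sums[OF bounded_linear_qf])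
      moreover have "0 \<le> w (A k)" for k
        using A nonneg by auto
      ultimately show "(\<Sum>k. ennreal (w (A k))) = ennreal (w (\<Union>k. A k))"
        by (simp add: suminf_ennreal2 sums_iff)
    qed
  qed fact
  have "finite_borel_measure m"
    using sets_eq_imp_space_eq[OF sets]
    by (intro finite_borel_measure.intro finite_measureI) (simp_all add: finite_borel_measure_axioms_def sets em)
  moreover have "complex_of_real (measure m B) = qf x (\<mu> B)" if "B \<in> sets borel" for B
    using nonneg[OF that] real[OF that] em[OF that] by (simp add: measure_def w_def complex_eq_iff)
  ultimately show ?thesis
    by blast
qed

text \<open>The definition of the transform provides decompositions that may vary with the entry and
  with \<eta>. The combination of all of them has the same values on Borel sets as \<open>m\<close>,
  and by \<open>measure_combination_integral_eq\<close> the integrals depend on these values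
  only.\<close>

lemma qf_stieltjes_transform:
  assumes "is_stieltjes_transform_of F \<mu>"
    and m: "finite_borel_measure m" "\<And>B. B \<in> sets borel \<Longrightarrow> complex_of_real (measure m B) = qf x (\<mu> B)"
    and \<eta>: "0 < Im \<eta>"
  shows "qf x (F \<eta>) = stieltjes m \<eta>"
proof -
  let ?f = "\<lambda>t. 1 / (complex_of_real t - \<eta>)"
  have "\<forall>i j. \<exists>\<nu> :: nat \<Rightarrow> real measure.
      (\<forall>k<4. finite_borel_measure (\<nu> k)) \<and>
      (\<forall>B\<in>sets borel. \<mu> B $ i $ j = (\<Sum>k<4. \<i> ^ k * complex_of_real (measure (\<nu> k) B))) \<and>
      F \<eta> $ i $ j = (\<Sum>k<4. \<i> ^ k * integral\<^sup>L (\<nu> k) ?f)"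
  proof (intro allI)
    fix i j
    have "has_complex_measure_integral (\<lambda>B. \<mu> B $ i $ j) ?f (F \<eta> $ i $ j)"
      using assms(1) \<eta> by (simp add: is_stieltjes_transform_of_def upper_half_plane_def)
    then show "\<exists>\<nu> :: nat \<Rightarrow> real measure.
      (\<forall>k<4. finite_borel_measure (\<nu> k)) \<and>
      (\<forall>B\<in>sets borel. \<mu> B $ i $ j = (\<Sum>k<4. \<i> ^ k * complex_of_real (measure (\<nu> k) B))) \<and>
      F \<eta> $ i $ j = (\<Sum>k<4. \<i> ^ k * integral\<^sup>L (\<nu> k) ?f)"
      unfolding has_complex_measure_integral_def finite_borel_measure_def finite_borel_measure_axioms_def
      by blast
  qed
  then obtain \<nu> where \<nu>: "\<And>i j k. k < 4 \<Longrightarrow> finite_borel_measure (\<nu> i j k)"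
      "\<And>i j B. B \<in> sets borel \<Longrightarrow> \<mu> B $ i $ j = (\<Sum>k<4. \<i> ^ k * complex_of_real (measure (\<nu> i j k) B))"
      "\<And>i j. F \<eta> $ i $ j = (\<Sum>k<4. \<i> ^ k * integral\<^sup>L (\<nu> i j k) ?f)"
    unfolding choice_iff by blast
  have "(\<Sum>l\<in>UNIV \<times> UNIV \<times> {..<4::nat}. (cnj (x $ fst l) * x $ fst (snd l) * \<i> ^ snd (snd l))
        * integral\<^sup>L (\<nu> (fst l) (fst (snd l)) (snd (snd l))) ?f)
      = (\<Sum>l\<in>{()}. 1 * integral\<^sup>L m ?f)"
  proof (rule measure_combination_integral_eq[where K = "1 / Im \<eta>"])
    show "(\<Sum>l\<in>UNIV \<times> UNIV \<times> {..<4::nat}. (cnj (x $ fst l) * x $ fst (snd l) * \<i> ^ snd (snd l))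
        * complex_of_real (measure (\<nu> (fst l) (fst (snd l)) (snd (snd l))) B))
      = (\<Sum>l\<in>{()}. 1 * complex_of_real (measure m B))" if "B \<in> sets borel" for B
      by (subst qf_triple_sum[OF \<nu>(2)[OF that]]) (simp add: m(2)[OF that])
    show "norm (?f t) \<le> 1 / Im \<eta>" for t
      by (rule norm_cauchy_kernel_le[OF \<eta>])
  qed (use \<nu>(1) m(1) in auto)
  then show ?thesis
    by (subst (asm) qf_triple_sum[OF \<nu>(3)]) (simp add: stieltjes_def)
qed

text \<open>
  The pointwise properties of a matrix Stieltjes transform that the map of the theorem preserves. They
  also hold for \<open>(H - \<eta>)\<^sup>-\<^sup>1\<close> with \<open>H\<close> Hermitian.
\<close>

definition resolvent_like :: "complex \<Rightarrow> complex^'m^'m \<Rightarrow> bool" where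
  "resolvent_like \<eta> M \<longleftrightarrow>
     (\<forall>x. x \<noteq> 0 \<longrightarrow> 0 < Im (qf x M)) \<and> (\<forall>x. norm (qf x M) \<le> (norm x)\<^sup>2 / Im \<eta>)"

lemma resolvent_like_entry_le:
  assumes "resolvent_like \<eta> M" "0 < Im \<eta>"
  shows "norm (M $ i $ j) \<le> 4 / Im \<eta>"
proof -
  have "norm (\<i> ^ k * qf (polar_vec i j k) M) \<le> 1 / Im \<eta>" for k
  proof -
    have "norm (qf (polar_vec i j k) M) \<le> (norm (polar_vec i j k))\<^sup>2 / Im \<eta>"
      using assms(1) by (simp add: resolvent_like_def)
    also have "\<dots> \<le> 1 / Im \<eta>"
      using assms(2) norm_polar_vec[of i j k] by (intro divide_right_mono power_le_one) auto
    finally show ?thesis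
      by (simp add: norm_mult norm_power)
  qed
  then have "norm (M $ i $ j) \<le> (\<Sum>k<4::nat. 1 / Im \<eta>)"
    unfolding polarization[of M i j] by (intro sum_norm_le)
  then show ?thesis
    by simp
qed

lemma stieltjes_class_resolvent_like:
  assumes "F \<in> stieltjes_class" "0 < Im \<eta>" shows "resolvent_like \<eta> (F \<eta>)"
proof -
  obtain \<mu> where \<mu>: "matrix_measure \<mu>" "\<mu> UNIV = mat 1" "is_stieltjes_transform_of F \<mu>"
    using assms(1) by (auto simp: stieltjes_class_def)
  have *: "norm (qf x (F \<eta>)) \<le> (norm x)\<^sup>2 / Im \<eta> \<and> (x \<noteq> 0 \<longrightarrow> 0 < Im (qf x (F \<eta>)))" for x
  proof -
    obtain m where m: "finite_borel_measure m" "\<And>B. B \<in> sets borel \<Longrightarrow> complex_of_real (measure m B) = qf x (\<mu> B)"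
      using matrix_measure_qf[OF \<mu>(1)] by blast
    interpret finite_borel_measure m by fact
    have "measure m UNIV = (norm x)\<^sup>2"
      using m(2)[of UNIV] unfolding \<mu>(2) qf_mat_1 of_real_eq_iff by simp
    then show ?thesis
      using norm_stieltjes_le[OF assms(2)] Im_stieltjes_pos[OF assms(2)]
      by (simp add: qf_stieltjes_transform[OF \<mu>(3) m assms(2)])
  qed
  then show ?thesis
    by (simp add: resolvent_like_def)
qed

lemma stieltjes_class_holomorphic:
  assumes "F \<in> stieltjes_class" shows "(\<lambda>\<eta>. F \<eta> $ i $ j) holomorphic_on upper_half_plane"
proof -
  obtain \<mu> where \<mu>: "matrix_measure \<mu>" "is_stieltjes_transform_of F \<mu>"
    using assms(1) by (auto simp: stieltjes_class_def)
  obtain m where m: "\<And>x. finite_borel_measure (m x)"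
      "\<And>x B. B \<in> sets borel \<Longrightarrow> complex_of_real (measure (m x) B) = qf x (\<mu> B)"
    using matrix_measure_qf[OF \<mu>(1)] by metis
  have "(\<lambda>\<eta>. \<Sum>k<4. \<i> ^ k * stieltjes (m (polar_vec i j k)) \<eta>) holomorphic_on upper_half_plane"
    by (intro holomorphic_intros finite_borel_measure.holomorphic_on_stieltjes m(1))
  moreover have "(\<Sum>k<4. \<i> ^ k * stieltjes (m (polar_vec i j k)) \<eta>) = F \<eta> $ i $ j" if "\<eta> \<in> upper_half_plane" for \<eta>
    unfolding polarization[of "F \<eta>"] using that
    by (simp add: qf_stieltjes_transform[OF \<mu>(2) m] upper_half_plane_def)
  ultimately show ?thesis
    by (rule holomorphic_transform)
qed

text \<open>The scalar representation gives a measure \<open>m x\<close> for each vector, and four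
  of them define each entry of the candidate \<mu>. What has to be shown is that the quadratic form
  of \<mu> at \<open>x\<close> is \<open>m x\<close> again; nonnegativity of \<mu> is then
  immediate.\<close>

theorem matrix_herglotz:
  fixes F :: "complex \<Rightarrow> complex^'m^'m"
  assumes hol: "\<And>i j. (\<lambda>\<eta>. F \<eta> $ i $ j) holomorphic_on upper_half_plane"
    and pos: "\<And>\<eta> x. 0 < Im \<eta> \<Longrightarrow> 0 \<le> Im (qf x (F \<eta>))"
    and bound: "\<And>\<eta> x. 0 < Im \<eta> \<Longrightarrow> norm (qf x (F \<eta>)) \<le> (norm x)\<^sup>2 / Im \<eta>"
    and lim: "\<And>i j. ((\<lambda>y. - Complex 0 y * F (Complex 0 y) $ i $ j) \<longlongrightarrow> mat 1 $ i $ j) at_top"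
  shows "F \<in> stieltjes_class"
proof -
  have "\<exists>m. finite_borel_measure m \<and> measure m UNIV = (norm x)\<^sup>2 \<and> (\<forall>\<eta>. 0 < Im \<eta> \<longrightarrow> qf x (F \<eta>) = stieltjes m \<eta>)" for x
  proof (rule herglotz_representation)
    show "(\<lambda>\<eta>. qf x (F \<eta>)) holomorphic_on upper_half_plane"
      unfolding qf_eq_sesq sesq_def by (intro holomorphic_intros hol)
    let ?s = "\<lambda>y. \<Sum>i\<in>UNIV. \<Sum>j\<in>UNIV. cnj (x $ i) * x $ j * (- Complex 0 y * F (Complex 0 y) $ i $ j)"
    let ?r = "Re (\<Sum>i\<in>UNIV. \<Sum>j\<in>UNIV. cnj (x $ i) * x $ j * mat 1 $ i $ j)"
    have "((\<lambda>y. Re (?s y))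
        \<longlongrightarrow> ?r) at_top"
      by (intro tendsto_intros lim)
    moreover have "?r = (norm x)\<^sup>2"
      using qf_mat_1[of x] by (simp add: qf_eq_sesq sesq_def)
    moreover have "Re (?s y)
        = y * Im (qf x (F (Complex 0 y)))" for y
    proof -
      have "(?s y)
          = - Complex 0 y * qf x (F (Complex 0 y))"
        unfolding qf_eq_sesq sesq_def sum_distrib_left by (intro sum.cong refl) (simp only: mult_ac)
      then show ?thesis
        by simp
    qed
    ultimately show "((\<lambda>y. y * Im (qf x (F (Complex 0 y)))) \<longlongrightarrow> (norm x)\<^sup>2) at_top"
      by simp
  qed (use pos bound in auto)
  then obtain m where m: "\<And>x. finite_borel_measure (m x)" "\<And>x. measure (m x) UNIV = (norm x)\<^sup>2"
      "\<And>x \<eta>. 0 < Im \<eta> \<Longrightarrow> qf x (F \<eta>) = stieltjes (m x) \<eta>"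
    by metis
  define \<mu> where "\<mu> B = (\<chi> i j. \<Sum>k<4. \<i> ^ k * complex_of_real (measure (m (polar_vec i j k)) B))" for B
  \<comment> \<open>The Poisson integral of \<open>m v\<close> at \<eta> is the quadratic form of
    \<open>im_part (F \<eta>)\<close> at \<open>v\<close>, so both sides have equal Poisson
    integrals by polarization of that matrix, and Stieltjes inversion applies.\<close>
  have qf_\<mu>: "qf x (\<mu> B) = complex_of_real (measure (m x) B)" if B: "B \<in> sets borel" for x B
  proof -
    have "(\<Sum>l\<in>UNIV \<times> UNIV \<times> {..<4::nat}. (cnj (x $ fst l) * x $ fst (snd l) * \<i> ^ snd (snd l))
        * complex_of_real (measure (m (polar_vec (fst l) (fst (snd l)) (snd (snd l)))) B))
      = (\<Sum>l\<in>{()}. 1 * complex_of_real (measure (m x) B))"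
    proof (rule measure_combination_eq_of_poisson_eq[OF _ _ _ B])
      fix \<eta> assume \<eta>: "0 < Im \<eta>"
      have im: "complex_of_real (integral\<^sup>L (m v) (poisson \<eta>)) = qf v (im_part (F \<eta>))" for v
        by (simp add: qf_im_part m(3)[OF \<eta>] finite_borel_measure.Im_stieltjes[OF m(1) \<eta>])
      show "(\<Sum>l\<in>UNIV \<times> UNIV \<times> {..<4::nat}. (cnj (x $ fst l) * x $ fst (snd l) * \<i> ^ snd (snd l))
          * complex_of_real (integral\<^sup>L (m (polar_vec (fst l) (fst (snd l)) (snd (snd l)))) (poisson \<eta>)))
        = (\<Sum>l\<in>{()}. 1 * complex_of_real (integral\<^sup>L (m x) (poisson \<eta>)))"
        unfolding im by (subst qf_triple_sum[OF polarization]) simp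
    qed (use m(1) in auto)
    moreover have "\<mu> B $ i $ j = (\<Sum>k<4. \<i> ^ k * complex_of_real (measure (m (polar_vec i j k)) B))" for i j
      by (simp add: \<mu>_def)
    ultimately show ?thesis
      using qf_triple_sum[of "\<mu> B" "\<lambda>i j k. complex_of_real (measure (m (polar_vec i j k)) B)" x] by simp
  qed
  have "matrix_measure \<mu>"
    unfolding matrix_measure_def
  proof (intro conjI ballI allI impI)
    show "hermitian_nonneg (\<mu> B)" if "B \<in> sets borel" for B
      by (simp add: hermitian_nonneg_iff qf_\<mu>[OF that])
    show "\<mu> {} = 0"
      by (simp add: \<mu>_def vec_eq_iff)
    fix A :: "nat \<Rightarrow> real set" assume A: "range A \<subseteq> sets borel" "disjoint_family A"
    have "(\<lambda>k. \<mu> (A k) $ i $ j) sums (\<mu> (\<Union>k. A k) $ i $ j)" for i j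
      unfolding \<mu>_def vec_lambda_beta
    proof (intro sums_sum sums_mult sums_of_real)
      fix k
      interpret finite_borel_measure "m (polar_vec i j k)" by (rule m(1))
      show "(\<lambda>l. measure (m (polar_vec i j k)) (A l)) sums measure (m (polar_vec i j k)) (\<Union>l. A l)"
        using A by (intro finite_measure_UNION) (auto simp: M_is_borel)
    qed
    then show "(\<lambda>k. \<mu> (A k)) sums \<mu> (\<Union>k. A k)"
      unfolding sums_def by (intro vec_tendstoI) simp
  qed
  moreover have "\<mu> UNIV = mat 1"
    by (simp add: vec_eq_iff polarization[of "mat 1"] qf_mat_1 \<mu>_def m(2) del: of_real_power)
  moreover have "is_stieltjes_transform_of F \<mu>"
    unfolding is_stieltjes_transform_of_def has_complex_measure_integral_def
  proof (intro ballI allI)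
    fix \<eta> :: complex and i j :: 'm assume "\<eta> \<in> upper_half_plane"
    then have \<eta>: "0 < Im \<eta>"
      by (simp add: upper_half_plane_def)
    show "\<exists>\<nu>. (\<forall>k<4. sets (\<nu> k) = sets borel \<and> finite_measure (\<nu> k)
           \<and> integrable (\<nu> k) (\<lambda>t. 1 / (complex_of_real t - \<eta>))) \<and>
        (\<forall>B\<in>sets borel. \<mu> B $ i $ j = (\<Sum>k<4. \<i> ^ k * complex_of_real (measure (\<nu> k) B))) \<and>
        F \<eta> $ i $ j = (\<Sum>k<4. \<i> ^ k * (\<integral>t. 1 / (complex_of_real t - \<eta>) \<partial>\<nu> k))"
    proof (intro exI[of _ "\<lambda>k. m (polar_vec i j k)"] conjI allI impI ballI)
      fix k
      interpret finite_borel_measure "m (polar_vec i j k)" by (rule m(1))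
      show "sets (m (polar_vec i j k)) = sets borel" "finite_measure (m (polar_vec i j k))"
        "integrable (m (polar_vec i j k)) (\<lambda>t. 1 / (complex_of_real t - \<eta>))"
        using M_is_borel finite_measure_axioms integrable_cauchy_kernel[OF \<eta>] by auto
    next
      show "F \<eta> $ i $ j = (\<Sum>k<4. \<i> ^ k * (\<integral>t. 1 / (complex_of_real t - \<eta>) \<partial>m (polar_vec i j k)))"
        unfolding polarization[of "F \<eta>"] by (simp add: m(3)[OF \<eta>] stieltjes_def)
    qed (simp add: \<mu>_def)
  qed
  ultimately show ?thesis
    unfolding stieltjes_class_def by blast
qed

section \<open>Linear algebra\<close>

lemma qf_axis: "qf (axis i 1) A = A $ i $ i"
  by (simp add: qf_eq_sesq sesq_axis)

section \<open>Nonnegative Hermitian matrices\<close>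

lemma sesq_swap_hermitian:
  assumes "hermitian_nonneg A" shows "sesq y x A = cnj (sesq x y A)"
proof -
  have h: "cnj (A $ i $ j) = A $ j $ i" for i j
    using assms unfolding hermitian_nonneg_def by metis
  show ?thesis
    unfolding sesq_def by (subst sum.swap) (simp add: h mult_ac)
qed

lemma qf_hermitian_real:
  assumes "hermitian_nonneg A" shows "qf x A = complex_of_real (Re (qf x A))"
  using assms by (simp add: hermitian_nonneg_iff complex_eq_iff)

lemma hermitian_nonneg_Cauchy_Schwarz:
  assumes A: "hermitian_nonneg A"
  shows "(norm (sesq x y A))\<^sup>2 \<le> Re (qf x A) * Re (qf y A)"
proof -
  have expand: "Re (qf (x + t *s y) A) = Re (qf x A) + 2 * Re (t * sesq x y A) + (norm t)\<^sup>2 * Re (qf y A)" for t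
  proof -
    have "qf (x + t *s y) A = qf x A + (t * sesq x y A + cnj (t * sesq x y A)) + t * cnj t * qf y A"
      unfolding qf_eq_sesq sesq_add_left sesq_add_right sesq_scale_left sesq_scale_right
        sesq_swap_hermitian[OF A, of y x] by (simp add: algebra_simps)
    then show ?thesis
      by (simp add: complex_norm_square[symmetric] complex_add_cnj del: of_real_power)
  qed
  have nonneg: "0 \<le> Re (qf v A)" for v
    using A by (simp add: hermitian_nonneg_iff)
  define s where "s = sesq x y A"
  have s: "cnj s * s = complex_of_real ((norm s)\<^sup>2)"
    by (simp only: complex_norm_square mult.commute)
  show ?thesis
  proof (cases "Re (qf y A) = 0")
    case True
    have "sesq x y A = 0"
    proof (rule ccontr)
      assume ne: "sesq x y A \<noteq> 0"
      \<comment> \<open>Along \<open>t = - r * cnj s\<close> the form is affine in \<open>r\<close>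
        because its quadratic term vanishes; this \<open>r\<close> would push it below 0.\<close>
      define r where "r = (Re (qf x A) + 1) / (norm s)\<^sup>2"
      have "0 \<le> Re (qf x A) + 2 * Re (- (complex_of_real r * cnj s) * s)"
        using nonneg[of "x + (- (complex_of_real r * cnj s)) *s y"] True
        unfolding expand s_def by simp
      also have "Re (- (complex_of_real r * cnj s) * s) = - r * (norm s)\<^sup>2"
        unfolding minus_mult_left[symmetric] mult.assoc s by (simp del: of_real_power)
      finally have "2 * (r * (norm s)\<^sup>2) \<le> Re (qf x A)"
        by simp
      moreover have "r * (norm s)\<^sup>2 = Re (qf x A) + 1"
        using ne by (simp add: r_def s_def)
      ultimately show False
        using nonneg[of x] by simp
    qed
    then show ?thesis
      using True by simp
  next
    case False
    then have b: "0 < Re (qf y A)"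
      using nonneg[of y] by simp
    define b where "b = Re (qf y A)"
    \<comment> \<open>\<open>t = - cnj s / b\<close> minimizes the quadratic polynomial in
      \<open>expand\<close>.\<close>
    have "0 \<le> Re (qf x A) + 2 * Re (- (complex_of_real (1 / b) * cnj s) * s) + (norm (- (complex_of_real (1 / b) * cnj s)))\<^sup>2 * b"
      using nonneg[of "x + (- (complex_of_real (1 / b) * cnj s)) *s y"]
      unfolding expand s_def b_def .
    also have "Re (- (complex_of_real (1 / b) * cnj s) * s) = - (1 / b) * (norm s)\<^sup>2"
      unfolding minus_mult_left[symmetric] mult.assoc s by (simp del: of_real_power)
    also have "(norm (- (complex_of_real (1 / b) * cnj s)))\<^sup>2 * b = (norm s)\<^sup>2 / b"
      using b unfolding b_def[symmetric] by (simp add: norm_mult norm_divide power_mult_distrib power2_eq_square)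
    finally show ?thesis
      using b unfolding b_def[symmetric] s_def[symmetric] by (simp add: field_simps)
  qed
qed

text \<open>
  Induction on the number of nonzero diagonal entries: subtracting the rank one matrix of a column with
  pivot \<open>A\<^sub>i\<^sub>i > 0\<close> leaves a nonnegative matrix by Cauchy-Schwarz.
\<close>

lemma hermitian_nonneg_rank_one_sum:
  fixes A :: "complex^'m^'m"
  assumes "hermitian_nonneg A"
  shows "\<exists>(d::nat) r. \<forall>i j. A $ i $ j = (\<Sum>k<d. r k $ i * cnj (r k $ j))"
  using assms
proof (induction "card {i. A $ i $ i \<noteq> 0}" arbitrary: A rule: less_induct)
  case less
  note A = less.prems
  have herm: "A $ i $ j = cnj (A $ j $ i)" for i j
    using A unfolding hermitian_nonneg_def by blast
  have CS: "(norm (sesq x (axis i 1) A))\<^sup>2 \<le> Re (qf x A) * Re (A $ i $ i)" for x i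
    using hermitian_nonneg_Cauchy_Schwarz[OF A, of x "axis i 1"] by (simp add: qf_axis)
  have diag: "A $ i $ i = complex_of_real (Re (A $ i $ i))" "0 \<le> Re (A $ i $ i)" for i
    using qf_hermitian_real[OF A, of "axis i 1"] A by (auto simp: qf_axis hermitian_nonneg_iff dest: spec[of _ "axis i 1"])
  show ?case
  proof (cases "\<exists>i. A $ i $ i \<noteq> 0")
    case False
    have "A $ i $ j = 0" for i j
      using CS[of "axis i 1" j] False by (simp add: sesq_axis)
    then show ?thesis
      by (intro exI[of _ 0]) simp
  next
    case True
    then obtain i where i: "A $ i $ i \<noteq> 0"
      by blast
    define a where "a = Re (A $ i $ i)"
    have a: "0 < a" "A $ i $ i = complex_of_real a"
      using diag[of i] i unfolding a_def by (auto simp: complex_eq_iff less_le)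
    define v :: "complex^'m" where "v = (\<chi> j. A $ j $ i / complex_of_real (sqrt a))"
    define B :: "complex^'m^'m" where "B = (\<chi> j k. A $ j $ k - v $ j * cnj (v $ k))"
    have sqrt: "complex_of_real (sqrt a) * complex_of_real (sqrt a) = complex_of_real a"
      using a(1) by (simp flip: of_real_mult)
    have qf_B: "qf x B = qf x A - complex_of_real ((norm (sesq x (axis i 1) A))\<^sup>2 / a)" for x
    proof -
      have col: "sesq x (axis i 1) A = (\<Sum>j\<in>UNIV. cnj (x $ j) * A $ j $ i)"
      proof -
        have "cnj (x $ p) * axis i 1 $ q * A $ p $ q = (if q = i then cnj (x $ p) * A $ p $ q else 0)" for p q
          by (simp add: axis_def)
        then show ?thesis
          unfolding sesq_def by simp
      qed
      have "qf x B = qf x A - (\<Sum>j\<in>UNIV. cnj (x $ j) * v $ j) * cnj (\<Sum>j\<in>UNIV. cnj (x $ j) * v $ j)"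
        unfolding qf_eq_sesq sesq_def B_def cnj_sum sum_product sum_subtractf[symmetric]
        by (intro sum.cong refl) (simp add: algebra_simps)
      also have "(\<Sum>j\<in>UNIV. cnj (x $ j) * v $ j) = sesq x (axis i 1) A / complex_of_real (sqrt a)"
        unfolding col v_def by (simp add: sum_divide_distrib)
      also have "sesq x (axis i 1) A / complex_of_real (sqrt a) * cnj (sesq x (axis i 1) A / complex_of_real (sqrt a))
          = complex_of_real ((norm (sesq x (axis i 1) A))\<^sup>2 / a)"
        by (simp add: sqrt complex_norm_square[symmetric] del: of_real_power)
      finally show ?thesis .
    qed
    have B: "hermitian_nonneg B"
      unfolding hermitian_nonneg_iff qf_B
    proof
      fix x
      have "(norm (sesq x (axis i 1) A))\<^sup>2 / a \<le> Re (qf x A)"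
        using CS[of x i] a(1) unfolding a_def[symmetric] by (simp add: field_simps)
      then show "Im (qf x A - complex_of_real ((norm (sesq x (axis i 1) A))\<^sup>2 / a)) = 0 \<and>
          0 \<le> Re (qf x A - complex_of_real ((norm (sesq x (axis i 1) A))\<^sup>2 / a))"
        using A by (simp add: hermitian_nonneg_iff del: of_real_divide)
    qed
    have "v $ i * cnj (v $ i) = complex_of_real a"
      unfolding v_def using a by (simp add: sqrt)
    then have Bii: "B $ i $ i = 0"
      unfolding B_def using a(2) by simp
    \<comment> \<open>By Cauchy-Schwarz a zero on the diagonal forces the entry in the pivot column
      to be 0, so the subtraction leaves that diagonal entry 0. With the pivot itself removed, the
      count drops.\<close>
    have "B $ j $ j = 0" if "A $ j $ j = 0" for j
    proof -
      have "norm (sesq (axis j 1) (axis i 1) A) = 0"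
        using CS[of "axis j 1" i] that by (simp add: qf_axis)
      then show ?thesis
        using qf_B[of "axis j 1"] that by (simp add: qf_axis)
    qed
    then have "{j. B $ j $ j \<noteq> 0} \<subset> {j. A $ j $ j \<noteq> 0}"
      using Bii i by blast
    then have "card {j. B $ j $ j \<noteq> 0} < card {j. A $ j $ j \<noteq> 0}"
      by (intro psubset_card_mono) auto
    from less.hyps[OF this B] obtain d and r :: "nat \<Rightarrow> complex^'m"
      where r: "\<And>j k. B $ j $ k = (\<Sum>l<d. r l $ j * cnj (r l $ k))"
      by blast
    have "A $ j $ k = (\<Sum>l<Suc d. (r(d := v)) l $ j * cnj ((r(d := v)) l $ k))" for j k
    proof -
      have "A $ j $ k = B $ j $ k + v $ j * cnj (v $ k)"
        by (simp add: B_def)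
      also have "B $ j $ k = (\<Sum>l<d. (r(d := v)) l $ j * cnj ((r(d := v)) l $ k))"
        unfolding r by (intro sum.cong) auto
      finally show ?thesis
        by simp
    qed
    then show ?thesis
      by blast
  qed
qed

section \<open>Quadratic forms of block traces and Kronecker products\<close>

lemma sum_UNIV_prod: "(\<Sum>p\<in>(UNIV :: ('a::finite \<times> 'b::finite) set). f p) = (\<Sum>a\<in>UNIV. \<Sum>b\<in>UNIV. f (a, b))"
  by (simp add: sum.cartesian_product)

definition tensor_vec :: "complex^'a \<Rightarrow> complex^'b \<Rightarrow> complex^('a::finite \<times> 'b::finite)" where
  "tensor_vec u r = (\<chi> p. u $ fst p * r $ snd p)"

definition contract_vec :: "complex^('a::finite \<times> 'b::finite) \<Rightarrow> complex^'b \<Rightarrow> complex^'a" where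
  "contract_vec x r = (\<chi> a. \<Sum>b\<in>UNIV. x $ (a, b) * cnj (r $ b))"

lemma block_trace_entry:
  "block_trace n (kronecker (mat 1) A ** M) $ p $ q
    = (\<Sum>i\<in>UNIV. \<Sum>k\<in>UNIV. A $ i $ k * M $ (p, k) $ (q, i)) / of_nat n"
proof -
  have "(kronecker (mat 1) A ** M) $ (p, i) $ (q, i) = (\<Sum>k\<in>UNIV. A $ i $ k * M $ (p, k) $ (q, i))" for i
  proof -
    have "(\<Sum>k\<in>UNIV. mat 1 $ p $ a * A $ i $ k * M $ (a, k) $ (q, i))
        = (if a = p then (\<Sum>k\<in>UNIV. A $ i $ k * M $ (a, k) $ (q, i)) else 0)" for a
      by (simp add: mat_def)
    then show ?thesis
      by (simp add: matrix_matrix_mult_def kronecker_def sum_UNIV_prod)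
  qed
  then show ?thesis
    by (simp add: block_trace_def trace_def block_def)
qed

lemma qf_tensor_vec:
  "qf (tensor_vec u r) M = (\<Sum>p\<in>UNIV. \<Sum>q\<in>UNIV.
    cnj (u $ p) * u $ q * (\<Sum>i\<in>UNIV. \<Sum>b\<in>UNIV. r $ i * cnj (r $ b) * M $ (p, b) $ (q, i)))"
proof -
  let ?t = "\<lambda>p b q i. cnj (u $ p) * u $ q * (r $ i * cnj (r $ b) * M $ (p, b) $ (q, i))"
  have "qf (tensor_vec u r) M = (\<Sum>p\<in>UNIV. \<Sum>b\<in>UNIV. \<Sum>q\<in>UNIV. \<Sum>i\<in>UNIV.
      ?t p b q i)"
    by (simp add: qf_eq_sesq sesq_def tensor_vec_def sum_UNIV_prod mult_ac)
  also have "\<dots> = (\<Sum>p\<in>UNIV. \<Sum>q\<in>UNIV. \<Sum>b\<in>UNIV. \<Sum>i\<in>UNIV.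
      ?t p b q i)"
    by (intro sum.cong refl sum.swap)
  also have "\<dots> = (\<Sum>p\<in>UNIV. \<Sum>q\<in>UNIV. \<Sum>i\<in>UNIV. \<Sum>b\<in>UNIV.
      ?t p b q i)"
    by (intro sum.cong refl sum.swap)
  finally show ?thesis
    by (simp only: sum_distrib_left)
qed

text \<open>For a rank one \<open>A\<close> built from \<open>r\<close>, the trace of
  \<open>A\<close> times a block is the form of that block at \<open>r\<close>. The block trace is
  then the compression of \<open>M\<close> to the vectors \<open>tensor_vec u r\<close>, so it
  inherits the sign of the imaginary part of \<open>M\<close>.\<close>

lemma qf_block_trace:
  assumes "\<And>i j. A $ i $ j = (\<Sum>k<d. r k $ i * cnj (r k $ j))"
  shows "qf u (block_trace n (kronecker (mat 1) A ** M)) = (\<Sum>k<d::nat. qf (tensor_vec u (r k)) M) / of_nat n"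
proof -
  have A: "(\<Sum>k<d. \<Sum>i\<in>UNIV. \<Sum>b\<in>UNIV. r k $ i * cnj (r k $ b) * M $ (p, b) $ (q, i))
      = (\<Sum>i\<in>UNIV. \<Sum>b\<in>UNIV. A $ i $ b * M $ (p, b) $ (q, i))" for p q
  proof -
    have "(\<Sum>k<d. \<Sum>i\<in>UNIV. \<Sum>b\<in>UNIV. r k $ i * cnj (r k $ b) * M $ (p, b) $ (q, i))
        = (\<Sum>i\<in>UNIV. \<Sum>k<d. \<Sum>b\<in>UNIV. r k $ i * cnj (r k $ b) * M $ (p, b) $ (q, i))"
      by (rule sum.swap)
    also have "\<dots> = (\<Sum>i\<in>UNIV. \<Sum>b\<in>UNIV. \<Sum>k<d. r k $ i * cnj (r k $ b) * M $ (p, b) $ (q, i))"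
      by (intro sum.cong refl sum.swap)
    finally show ?thesis
      by (simp add: assms sum_distrib_right)
  qed
  let ?t = "\<lambda>p q k. cnj (u $ p) * u $ q * (\<Sum>i\<in>UNIV. \<Sum>b\<in>UNIV. r k $ i * cnj (r k $ b) * M $ (p, b) $ (q, i))"
  have "(\<Sum>k<d. qf (tensor_vec u (r k)) M) = (\<Sum>p\<in>UNIV. \<Sum>k<d. \<Sum>q\<in>UNIV.
      ?t p q k)"
    unfolding qf_tensor_vec by (rule sum.swap)
  also have "\<dots> = (\<Sum>p\<in>UNIV. \<Sum>q\<in>UNIV. \<Sum>k<d.
      ?t p q k)"
    by (intro sum.cong refl sum.swap)
  also have "\<dots> = (\<Sum>p\<in>UNIV. \<Sum>q\<in>UNIV. cnj (u $ p) * u $ q * (\<Sum>i\<in>UNIV. \<Sum>b\<in>UNIV. A $ i $ b * M $ (p, b) $ (q, i)))"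
    by (simp only: sum_distrib_left[symmetric] A)
  finally have tensor: "(\<Sum>k<d. qf (tensor_vec u (r k)) M)
      = (\<Sum>p\<in>UNIV. \<Sum>q\<in>UNIV. cnj (u $ p) * u $ q * (\<Sum>i\<in>UNIV. \<Sum>b\<in>UNIV. A $ i $ b * M $ (p, b) $ (q, i)))" .
  show ?thesis
    unfolding tensor qf_eq_sesq[of u] sesq_def block_trace_entry
    by (simp only: times_divide_eq_right sum_divide_distrib[symmetric])
qed

text \<open>Dual to \<open>qf_block_trace\<close>: each rank one summand of \<open>A\<close>
  contracts the second index of \<open>x\<close>, and the form of \<open>G\<close> is left.\<close>

lemma qf_kronecker:
  assumes "\<And>i j. A $ i $ j = (\<Sum>k<d. r k $ i * cnj (r k $ j))"
  shows "qf x (kronecker G A) = (\<Sum>k<d::nat. qf (contract_vec x (r k)) G)"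
proof -
  let ?t = "\<lambda>p q b i k. cnj (x $ (p, b)) * x $ (q, i) * G $ p $ q * (r k $ b * cnj (r k $ i))"
  have contr: "qf (contract_vec x (r k)) G = (\<Sum>p\<in>UNIV. \<Sum>q\<in>UNIV. \<Sum>b\<in>UNIV. \<Sum>i\<in>UNIV.
      ?t p q b i k)" for k
  proof -
    have "cnj (contract_vec x (r k) $ p) * contract_vec x (r k) $ q
        = (\<Sum>b\<in>UNIV. \<Sum>i\<in>UNIV. (cnj (x $ (p, b)) * r k $ b) * (x $ (q, i) * cnj (r k $ i)))" for p q
      by (simp add: contract_vec_def sum_product)
    then show ?thesis
      unfolding qf_eq_sesq sesq_def by (simp add: sum_distrib_left sum_distrib_right mult_ac)
  qed
  have "qf x (kronecker G A) = (\<Sum>p\<in>UNIV. \<Sum>b\<in>UNIV. \<Sum>q\<in>UNIV. \<Sum>i\<in>UNIV. \<Sum>k<d.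
      ?t p q b i k)"
    by (simp add: qf_eq_sesq sesq_def kronecker_def sum_UNIV_prod assms sum_distrib_left mult_ac)
  also have "\<dots> = (\<Sum>p\<in>UNIV. \<Sum>q\<in>UNIV. \<Sum>b\<in>UNIV. \<Sum>i\<in>UNIV. \<Sum>k<d.
      ?t p q b i k)"
    by (intro sum.cong refl sum.swap)
  also have "\<dots> = (\<Sum>p\<in>UNIV. \<Sum>q\<in>UNIV. \<Sum>b\<in>UNIV. \<Sum>k<d. \<Sum>i\<in>UNIV.
      ?t p q b i k)"
    by (intro sum.cong refl sum.swap)
  also have "\<dots> = (\<Sum>p\<in>UNIV. \<Sum>q\<in>UNIV. \<Sum>k<d. \<Sum>b\<in>UNIV. \<Sum>i\<in>UNIV.
      ?t p q b i k)"
    by (intro sum.cong refl sum.swap)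
  also have "\<dots> = (\<Sum>p\<in>UNIV. \<Sum>k<d. \<Sum>q\<in>UNIV. \<Sum>b\<in>UNIV. \<Sum>i\<in>UNIV.
      ?t p q b i k)"
    by (intro sum.cong refl sum.swap)
  also have "\<dots> = (\<Sum>k<d. \<Sum>p\<in>UNIV. \<Sum>q\<in>UNIV. \<Sum>b\<in>UNIV. \<Sum>i\<in>UNIV.
      ?t p q b i k)"
    by (rule sum.swap)
  finally show ?thesis
    unfolding contr .
qed

section \<open>Inverse matrices\<close>

lemma invertible_iff_ker: "invertible (A :: complex^'m^'m) \<longleftrightarrow> (\<forall>x. A *v x = 0 \<longrightarrow> x = 0)"
  unfolding invertible_left_inverse matrix_left_invertible_ker ..

lemma matrix_inv_left: "invertible (A :: complex^'m^'m) \<Longrightarrow> matrix_inv A ** A = mat 1"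
  and matrix_inv_right: "invertible (A :: complex^'m^'m) \<Longrightarrow> A ** matrix_inv A = mat 1"
  using someI_ex[of "\<lambda>B. A ** B = mat 1 \<and> B ** A = mat 1"]
  unfolding invertible_def matrix_inv_def by auto

lemma matrix_inv_unique: "A ** B = mat 1 \<Longrightarrow> matrix_inv A = (B :: complex^'m^'m)"
  by (metis invertible_right_inverse matrix_inv_left matrix_mul_assoc matrix_mul_lid matrix_mul_rid)

text \<open>With \<open>v = matrix_inv A *v x\<close> the form is the conjugate of that of
  \<open>A\<close> at \<open>v\<close>. So inversion reverses the sign of the imaginary part, once
  in the integrand and once in the outer inverse.\<close>

lemma qf_matrix_inv:
  assumes "invertible A"
  shows "qf x (matrix_inv A) = cnj (qf (matrix_inv A *v x) A)"
proof -
  have "A *v (matrix_inv A *v x) = x"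
    by (simp add: matrix_vector_mul_assoc matrix_inv_right[OF assms])
  then show ?thesis
    by (simp add: qf_def mult.commute)
qed

text \<open>Put \<open>v = matrix_inv A *v x\<close>. The imaginary part of the form is at least
  \<open>y * (norm v)\<^sup>2\<close>, while Cauchy-Schwarz bounds its modulus by
  \<open>norm x * norm v\<close>; together \<open>norm v \<le> norm x / y\<close>.\<close>

lemma matrix_inv_resolvent_like:
  fixes A :: "complex^'m^'m"
  assumes A: "\<And>v. Im (qf v A) \<le> - y * (norm v)\<^sup>2" and y: "0 < y"
  shows "invertible A" "x \<noteq> 0 \<Longrightarrow> 0 < Im (qf x (matrix_inv A))"
    "norm (qf x (matrix_inv A)) \<le> (norm x)\<^sup>2 / y"
proof -
  have ker: "v = 0" if "A *v v = 0" for v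
  proof -
    have "y * (norm v)\<^sup>2 \<le> 0"
      using A[of v] that by (simp add: qf_def)
    then show ?thesis
      using y by (simp add: mult_le_0_iff)
  qed
  then show inv: "invertible A"
    by (simp add: invertible_iff_ker)
  define v where "v = matrix_inv A *v x"
  have Av: "A *v v = x"
    by (simp add: v_def matrix_vector_mul_assoc matrix_inv_right[OF inv])
  have qf: "qf x (matrix_inv A) = cnj (qf v A)"
    using qf_matrix_inv[OF inv] by (simp add: v_def)
  have Im: "y * (norm v)\<^sup>2 \<le> Im (qf x (matrix_inv A))"
    using A[of v] by (simp add: qf)
  show "0 < Im (qf x (matrix_inv A))" if "x \<noteq> 0"
  proof -
    have "v \<noteq> 0"
      using that Av by auto
    then have "0 < y * (norm v)\<^sup>2"
      using y by simp
    then show ?thesis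
      using Im by linarith
  qed
  have "norm (qf x (matrix_inv A)) \<le> (\<Sum>i\<in>UNIV. norm (x $ i) * norm (v $ i))"
    unfolding qf_def v_def[symmetric] by (rule sum_norm_le) (simp add: norm_mult)
  also have "\<dots> \<le> norm x * norm v"
    unfolding norm_vec_def using L2_set_mult_ineq[of "\<lambda>i. norm (x $ i)" "\<lambda>i. norm (v $ i)" UNIV] by simp
  finally have CS: "norm (qf x (matrix_inv A)) \<le> norm x * norm v" .
  have "y * (norm v)\<^sup>2 \<le> norm x * norm v"
    using Im CS abs_Im_le_cmod[of "qf x (matrix_inv A)"] by linarith
  then have "y * norm v \<le> norm x"
    by (cases "v = 0") (simp_all add: power2_eq_square)
  then have "norm v \<le> norm x / y"
    using y by (simp add: field_simps)
  then have "norm x * norm v \<le> norm x * (norm x / y)"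
    by (intro mult_left_mono) auto
  then show "norm (qf x (matrix_inv A)) \<le> (norm x)\<^sup>2 / y"
    using CS by (simp add: power2_eq_square)
qed

text \<open>Cramer's rule makes the entries of the inverse quotients of polynomials, from which
  continuity and holomorphy are read off.\<close>

lemma matrix_inv_entry:
  fixes A :: "complex^'m^'m"
  assumes "invertible A"
  shows "matrix_inv A $ i $ j = det (\<chi> p q. if q = i then axis j 1 $ p else A $ p $ q) / det A"
proof -
  have "A *v (matrix_inv A *v axis j 1) = axis j 1"
    by (simp add: matrix_vector_mul_assoc matrix_inv_right[OF assms])
  then have "matrix_inv A *v axis j 1 = (\<chi> k. det (\<chi> p q. if q = k then axis j 1 $ p else A $ p $ q) / det A)"
    using assms by (subst (asm) cramer) (auto simp: invertible_det_nz)
  moreover have "matrix_inv A $ i $ j = (matrix_inv A *v axis j 1) $ i"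
    by (simp add: matrix_vector_mult_def axis_def if_distrib[of "(*) _"] cong: if_cong)
  ultimately show ?thesis
    by simp
qed

lemma continuous_on_det:
  fixes A :: "'s::topological_space \<Rightarrow> complex^'m^'m"
  assumes "\<And>i j. continuous_on S (\<lambda>s. A s $ i $ j)"
  shows "continuous_on S (\<lambda>s. det (A s))"
  unfolding det_def by (intro continuous_intros assms)

lemma continuous_on_matrix_inv:
  fixes A :: "'s::topological_space \<Rightarrow> complex^'m^'m"
  assumes "\<And>i j. continuous_on S (\<lambda>s. A s $ i $ j)" "\<And>s. s \<in> S \<Longrightarrow> invertible (A s)"
  shows "continuous_on S (\<lambda>s. matrix_inv (A s) $ i $ j)"
proof -
  have "continuous_on S (\<lambda>s. (\<chi> p q. if q = i then axis j 1 $ p else A s $ p $ q) $ k $ l)" for k l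
    using assms(1) by (cases "l = i") simp_all
  then have "continuous_on S (\<lambda>s. det (\<chi> p q. if q = i then axis j 1 $ p else A s $ p $ q) / det (A s))"
    using assms by (intro continuous_on_divide continuous_on_det) (auto simp: invertible_det_nz)
  then show ?thesis
    using assms(2) by (simp add: matrix_inv_entry cong: continuous_on_cong)
qed

lemma holomorphic_on_det:
  fixes A :: "complex \<Rightarrow> complex^'m^'m"
  assumes "\<And>i j. (\<lambda>s. A s $ i $ j) holomorphic_on S"
  shows "(\<lambda>s. det (A s)) holomorphic_on S"
  unfolding det_def by (intro holomorphic_intros assms)

lemma holomorphic_on_matrix_inv:
  fixes A :: "complex \<Rightarrow> complex^'m^'m"
  assumes "\<And>i j. (\<lambda>s. A s $ i $ j) holomorphic_on S" "\<And>s. s \<in> S \<Longrightarrow> invertible (A s)"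
  shows "(\<lambda>s. matrix_inv (A s) $ i $ j) holomorphic_on S"
proof -
  have "(\<lambda>s. (\<chi> p q. if q = i then axis j 1 $ p else A s $ p $ q) $ k $ l) holomorphic_on S" for k l
    using assms(1) by (cases "l = i") simp_all
  then have "(\<lambda>s. det (\<chi> p q. if q = i then axis j 1 $ p else A s $ p $ q) / det (A s)) holomorphic_on S"
    using assms by (intro holomorphic_on_divide holomorphic_on_det) (auto simp: invertible_det_nz)
  then show ?thesis
    using assms(2) by (simp add: matrix_inv_entry cong: holomorphic_cong)
qed

text \<open>Differentiability comes from Cramer's rule, the formula from differentiating
  \<open>A s ** matrix_inv (A s) = mat 1\<close>. The explicit formula is needed because
  differentiation under the integral asks for a derivative that is jointly continuous in the
  parameter and the angle.\<close>

lemma has_field_derivative_matrix_inv: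
  fixes A :: "complex \<Rightarrow> complex^'m^'m"
  assumes S: "open S" "s \<in> S" and inv: "\<And>s. s \<in> S \<Longrightarrow> invertible (A s)"
    and A': "\<And>i j s. s \<in> S \<Longrightarrow> ((\<lambda>s. A s $ i $ j) has_field_derivative A' s $ i $ j) (at s)"
  shows "((\<lambda>s. matrix_inv (A s) $ i $ j) has_field_derivative
    - (matrix_inv (A s) ** A' s ** matrix_inv (A s)) $ i $ j) (at s)"
proof -
  define G where "G s = matrix_inv (A s)" for s
  have "(\<lambda>s. A s $ i $ j) holomorphic_on S" for i j
    unfolding holomorphic_on_def using A' field_differentiable_def has_field_derivative_at_within by blast
  from holomorphic_on_matrix_inv[OF this inv]
  have G': "((\<lambda>s. G s $ i $ j) has_field_derivative deriv (\<lambda>s. G s $ i $ j) s) (at s)" for i j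
    unfolding G_def using S by (intro holomorphic_derivI)
  define D where "D = (\<chi> i j. deriv (\<lambda>s. G s $ i $ j) s)"
  have "A' s ** G s + A s ** D = 0"
  proof -
    have "((\<lambda>s. \<Sum>k\<in>UNIV. A s $ i $ k * G s $ k $ j) has_field_derivative
        (\<Sum>k\<in>UNIV. A' s $ i $ k * G s $ k $ j + deriv (\<lambda>s. G s $ k $ j) s * A s $ i $ k)) (at s)" for i j
      by (intro DERIV_sum DERIV_mult A' S G')
    moreover have "((\<lambda>s. \<Sum>k\<in>UNIV. A s $ i $ k * G s $ k $ j) has_field_derivative 0) (at s)" for i j
    proof (rule has_field_derivative_transform_within_open[OF DERIV_const S])
      fix t assume "t \<in> S"
      from arg_cong[OF matrix_inv_right[OF inv[OF this]], of "\<lambda>B. B $ i $ j"]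
      show "(mat 1 :: complex^'m^'m) $ i $ j = (\<Sum>k\<in>UNIV. A t $ i $ k * G t $ k $ j)"
        by (simp add: matrix_matrix_mult_def G_def)
    qed
    ultimately have "(\<Sum>k\<in>UNIV. A' s $ i $ k * G s $ k $ j + deriv (\<lambda>s. G s $ k $ j) s * A s $ i $ k) = 0" for i j
      using DERIV_unique by blast
    then show ?thesis
      by (simp add: vec_eq_iff matrix_matrix_mult_def D_def sum.distrib mult.commute)
  qed
  then have "G s ** (A' s ** G s) + G s ** (A s ** D) = 0"
    by (metis matrix_add_ldistrib times0_right)
  then have "G s ** A' s ** G s + D = 0"
    using matrix_inv_left[OF inv[OF S(2)]] by (simp add: G_def matrix_mul_assoc)
  then have "D = - (G s ** A' s ** G s)"
    by (simp add: eq_neg_iff_add_eq_0 add.commute)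
  then have "D $ i $ j = - (G s ** A' s ** G s) $ i $ j"
    by simp
  then show ?thesis
    using G'[of i j] by (simp add: D_def G_def)
qed

section \<open>The map of the theorem\<close>

lemma two_eq_zero: "(2::2) = 0"
  by simp

lemma sum_UNIV_2: "(\<Sum>i\<in>(UNIV :: 2 set). f i) = f 0 + f 1"
  by (simp add: sum_2 two_eq_zero add.commute)

lemma forall_2_iff: "(\<forall>i::2. P i) \<longleftrightarrow> P 0 \<and> P 1"
  by (auto simp: forall_2 two_eq_zero)

lemma matrix2_nth [simp]:
  "matrix2 a b c d $ 0 $ 0 = a" "matrix2 a b c d $ 0 $ 1 = b"
  "matrix2 a b c d $ 1 $ 0 = c" "matrix2 a b c d $ 1 $ 1 = d"
  by (simp_all add: matrix2_def)

lemma continuous_on_matrixI: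
  fixes f :: "'s::topological_space \<Rightarrow> complex^'m^'k"
  assumes "\<And>i j. continuous_on X (\<lambda>s. f s $ i $ j)" shows "continuous_on X f"
  using assms unfolding continuous_on_def by (auto intro!: vec_tendstoI)

lemma bounded_linear_entry: "bounded_linear (\<lambda>A :: complex^'m^'k. A $ i $ j)"
  by (rule bounded_linear_compose[OF bounded_linear_vec_nth bounded_linear_vec_nth])

lemma U_mat_nth [simp]:
  "U_mat L \<theta> $ 0 $ 0 = 0" "U_mat L \<theta> $ 0 $ 1 = cis (- (real L * \<theta>))"
  "U_mat L \<theta> $ 1 $ 0 = cis (real L * \<theta>)" "U_mat L \<theta> $ 1 $ 1 = 0"
  by (simp_all add: U_mat_def)

lemma U_mat_involution: "U_mat L \<theta> ** U_mat L \<theta> = mat 1"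
  by (simp add: vec_eq_iff forall_2_iff matrix_matrix_mult_def sum_UNIV_2 mat_def cis_mult)

lemma Im_qf_U_mat: "Im (qf u (U_mat L \<theta>)) = 0"
proof -
  have "\<forall>i j. U_mat L \<theta> $ i $ j = cnj (U_mat L \<theta> $ j $ i)"
    by (simp add: forall_2_iff cis_cnj)
  then show ?thesis
    unfolding hermitian_iff_Im_qf by blast
qed

text \<open>Isolates \<eta> from a Hermitian matrix; the imaginary part, holomorphy and the
  behaviour at infinity are all read off from this form.\<close>

lemma kronecker_matrix2_split:
  "kronecker (matrix2 \<eta> z (cnj z) \<eta>) (mat 1) $ p $ q
    = kronecker (matrix2 0 z (cnj z) 0) (mat 1) $ p $ q + \<eta> * mat 1 $ p $ q"
proof -
  have "\<forall>a b. matrix2 \<eta> z (cnj z) \<eta> $ a $ b = matrix2 0 z (cnj z) 0 $ a $ b + (if a = b then \<eta> else 0)"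
    by (simp add: forall_2_iff)
  then show ?thesis
    by (cases p; cases q) (simp add: kronecker_def mat_def)
qed

lemma Im_qf_kronecker_matrix2:
  "Im (qf v (kronecker (matrix2 \<eta> z (cnj z) \<eta>) (mat 1))) = Im \<eta> * (norm v)\<^sup>2"
proof -
  let ?W = "kronecker (matrix2 0 z (cnj z) 0) (mat 1)"
  have "\<forall>p q. ?W $ p $ q = cnj (?W $ q $ p)"
    by (auto simp: kronecker_def matrix2_def mat_def)
  then have "Im (qf v ?W) = 0"
    unfolding hermitian_iff_Im_qf by blast
  moreover have "qf v (kronecker (matrix2 \<eta> z (cnj z) \<eta>) (mat 1)) = qf v ?W + \<eta> * qf v (mat 1)"
    unfolding qf_eq_sesq sesq_def kronecker_matrix2_split[of \<eta>]
    by (simp only: distrib_left sum.distrib sum_distrib_left mult_ac)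
  ultimately show ?thesis
    by (simp add: qf_mat_1 del: of_real_power)
qed

locale matrix_equation =
  fixes S :: "complex \<Rightarrow> complex^'N^'N" and n L :: nat and z :: complex
  assumes n_pos: "0 < n"
    and cont: "continuous_on (sphere 0 1) S"
    and nonneg: "\<And>w. w \<in> sphere 0 1 \<Longrightarrow> hermitian_nonneg (S w)"
begin

lemma rank_one_sum: "\<exists>(d::nat) r. \<forall>i j. S (cis \<theta>) $ i $ j = (\<Sum>k<d. r k $ i * cnj (r k $ j))"
  by (intro hermitian_nonneg_rank_one_sum nonneg) simp

lemma Im_qf_inner_mat:
  assumes "\<And>i j. S (cis \<theta>) $ i $ j = (\<Sum>k<d::nat. r k $ i * cnj (r k $ j))"
  shows "Im (qf u (inner_mat S n L M \<theta>)) = (\<Sum>k<d. Im (qf (tensor_vec u (r k)) M)) / n"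
  unfolding inner_mat_def qf_add qf_block_trace[OF assms]
  by (simp add: Im_qf_U_mat Im_divide_of_nat)

lemma Im_qf_nonneg: "resolvent_like \<eta> M \<Longrightarrow> 0 \<le> Im (qf x M)"
  unfolding resolvent_like_def by (cases "x = 0") (auto simp: qf_def less_imp_le)

lemma Im_qf_inner_mat_nonneg:
  assumes "resolvent_like \<eta> M" shows "0 \<le> Im (qf u (inner_mat S n L M \<theta>))"
proof -
  obtain d r where r: "\<And>i j. S (cis \<theta>) $ i $ j = (\<Sum>k<d::nat. r k $ i * cnj (r k $ j))"
    using rank_one_sum by blast
  show ?thesis
    unfolding Im_qf_inner_mat[OF r] by (intro divide_nonneg_nonneg sum_nonneg Im_qf_nonneg[OF assms]) simp
qed

lemma invertible_inner_mat:
  assumes M: "resolvent_like \<eta> M" shows "invertible (inner_mat S n L M \<theta>)"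
  unfolding invertible_iff_ker
proof (intro allI impI)
  fix u assume ker: "inner_mat S n L M \<theta> *v u = 0"
  show "u = 0"
  proof (rule ccontr)
    assume u: "u \<noteq> 0"
    obtain d r where r: "\<And>i j. S (cis \<theta>) $ i $ j = (\<Sum>k<d::nat. r k $ i * cnj (r k $ j))"
      using rank_one_sum by blast
    have "(\<Sum>k<d. Im (qf (tensor_vec u (r k)) M)) / n = 0"
      using ker unfolding Im_qf_inner_mat[OF r, symmetric] by (simp add: qf_def)
    then have "(\<Sum>k<d. Im (qf (tensor_vec u (r k)) M)) = 0"
      using n_pos by simp
    \<comment> \<open>Strict positivity of \<open>Im M\<close> forces
      \<open>tensor_vec u (r k) = 0\<close>, hence \<open>r k = 0\<close> as \<open>u\<close> is not
      0. So \<Sigma> vanishes at this angle, and the matrix is the invertible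
      \<open>U_mat L \<theta>\<close>.\<close>
    then have "Im (qf (tensor_vec u (r k)) M) = 0" if "k < d" for k
      using that Im_qf_nonneg[OF M] by (subst (asm) sum_nonneg_eq_0_iff) auto
    then have tensor: "tensor_vec u (r k) = 0" if "k < d" for k
      using M that unfolding resolvent_like_def by (metis less_irrefl)
    obtain p where p: "u $ p \<noteq> 0"
      using u by (auto simp: vec_eq_iff)
    have "r k $ i = 0" if "k < d" for k i
    proof -
      have "u $ p * r k $ i = 0"
        using arg_cong[OF tensor[OF that], of "\<lambda>x. x $ (p, i)"] by (simp add: tensor_vec_def)
      with p show ?thesis
        by simp
    qed
    then have "S (cis \<theta>) $ i $ j = 0" for i j
      unfolding r by simp
    then have "block_trace n (kronecker (mat 1) (S (cis \<theta>)) ** M) = 0"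
      by (simp add: vec_eq_iff block_trace_entry)
    then have "U_mat L \<theta> *v u = 0"
      using ker by (simp add: inner_mat_def)
    then have "(U_mat L \<theta> ** U_mat L \<theta>) *v u = 0"
      by (simp only: matrix_vector_mul_assoc[symmetric] matrix_vector_mult_0_right)
    then show False
      using u by (simp add: U_mat_involution)
  qed
qed

lemma Im_qf_F_integrand:
  assumes M: "resolvent_like \<eta> M" shows "Im (qf x (F_integrand S n L M \<theta>)) \<le> 0"
proof -
  obtain d r where r: "\<And>i j. S (cis \<theta>) $ i $ j = (\<Sum>k<d::nat. r k $ i * cnj (r k $ j))"
    using rank_one_sum by blast
  have "Im (qf v (matrix_inv (inner_mat S n L M \<theta>))) \<le> 0" for v
    unfolding qf_matrix_inv[OF invertible_inner_mat[OF M]] using Im_qf_inner_mat_nonneg[OF M] by simp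
  then show ?thesis
    unfolding F_integrand_def qf_kronecker[OF r] by (simp add: sum_nonpos)
qed

text \<open>Here and below the angle, and later also the matrix, are functions on an arbitrary
  space, so that one lemma serves for fixed \<open>M\<close> and for joint continuity in \<eta> and
  \<theta>.\<close>

lemma continuous_on_S_cis:
  assumes "continuous_on X t" shows "continuous_on X (\<lambda>s. S (cis (t s)) $ i $ j)"
  by (intro continuous_intros continuous_on_compose2[OF cont] continuous_on_cis assms) auto

lemma continuous_on_block_trace:
  assumes "continuous_on X t" "\<And>p q. continuous_on X (\<lambda>s. M s $ p $ q)"
  shows "continuous_on X (\<lambda>s. block_trace n (kronecker (mat 1) (S (cis (t s))) ** M s) $ i $ j)"
  unfolding block_trace_entry divide_inverse
  by (intro continuous_on_mult continuous_on_sum continuous_on_const continuous_on_S_cis assms)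

lemma continuous_on_inner_mat:
  assumes "continuous_on X t" "\<And>p q. continuous_on X (\<lambda>s. M s $ p $ q)"
  shows "continuous_on X (\<lambda>s. inner_mat S n L (M s) (t s) $ i $ j)"
proof -
  have "\<forall>i j. continuous_on X (\<lambda>s. U_mat L (t s) $ i $ j)"
    unfolding forall_2_iff by (auto intro!: continuous_on_cis continuous_intros assms(1))
  then show ?thesis
    unfolding inner_mat_def vector_add_component
    by (intro continuous_on_add continuous_on_block_trace assms) auto
qed

lemma continuous_on_matrix_inv_inner_mat:
  assumes "continuous_on X t" "\<And>p q. continuous_on X (\<lambda>s. M s $ p $ q)"
    and "\<And>s. s \<in> X \<Longrightarrow> resolvent_like (e s) (M s)"
  shows "continuous_on X (\<lambda>s. matrix_inv (inner_mat S n L (M s) (t s)) $ i $ j)"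
  using assms by (intro continuous_on_matrix_inv continuous_on_inner_mat invertible_inner_mat)

lemma continuous_on_F_integrand:
  assumes "resolvent_like \<eta> M" shows "continuous_on X (F_integrand S n L M)"
  unfolding F_integrand_def kronecker_def
  by (rule continuous_on_matrixI)
    (simp, intro continuous_on_mult continuous_on_S_cis continuous_on_matrix_inv_inner_mat[where e = "\<lambda>_. \<eta>"]
      continuous_on_id continuous_on_const assms)

lemma F_integrand_entry: "F_integrand S n L M \<theta> $ p $ q
    = matrix_inv (inner_mat S n L M \<theta>) $ fst p $ fst q * S (cis \<theta>) $ snd p $ snd q"
  by (simp add: F_integrand_def kronecker_def)

lemma F_integrand_absolutely_integrable:
  "resolvent_like \<eta> M \<Longrightarrow> F_integrand S n L M absolutely_integrable_on {0..2 * pi}"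
  by (intro absolutely_integrable_continuous_real continuous_on_F_integrand)

lemma F_integrand_integrable:
  "resolvent_like \<eta> M \<Longrightarrow> F_integrand S n L M integrable_on {0..2 * pi}"
  by (intro integrable_continuous_interval continuous_on_F_integrand)

definition K :: "complex^(2 \<times> 'N)^(2 \<times> 'N) \<Rightarrow> complex^(2 \<times> 'N)^(2 \<times> 'N)" where
  "K M = (1 / (2 * pi)) *\<^sub>R integral {0..2 * pi} (F_integrand S n L M)"

lemma outer_mat_eq: "outer_mat S n L z M \<eta> = K M - kronecker (matrix2 \<eta> z (cnj z) \<eta>) (mat 1)"
  by (simp add: outer_mat_def K_def)

lemma outer_mat_entry: "outer_mat S n L z M \<eta> $ p $ q
    = K M $ p $ q - (kronecker (matrix2 0 z (cnj z) 0) (mat 1) $ p $ q + \<eta> * mat 1 $ p $ q)"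
  unfolding outer_mat_eq vector_minus_component by (subst kronecker_matrix2_split) simp

lemma Im_qf_outer_mat:
  assumes M: "resolvent_like \<eta>' M"
  shows "Im (qf v (outer_mat S n L z M \<eta>)) \<le> - Im \<eta> * (norm v)\<^sup>2"
proof -
  have bl: "bounded_linear (\<lambda>A. Im (qf v A))" for v :: "complex^(2 \<times> 'N)"
    by (rule bounded_linear_compose[OF bounded_linear_Im bounded_linear_qf])
  have "Im (qf v (integral {0..2 * pi} (F_integrand S n L M)))
      = integral {0..2 * pi} (\<lambda>\<theta>. Im (qf v (F_integrand S n L M \<theta>)))"
    using integral_linear[OF F_integrand_integrable[OF M] bl] by (simp add: comp_def)
  also have "\<dots> \<le> integral {0..2 * pi} (\<lambda>\<theta>. 0)"
    using integrable_linear[OF F_integrand_integrable[OF M] bl] Im_qf_F_integrand[OF M]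
    by (intro integral_le) (auto simp: comp_def)
  finally have "Im (qf v (K M)) \<le> 0"
    by (simp add: K_def qf_scaleR divide_nonpos_pos)
  then show ?thesis
    by (simp add: outer_mat_eq qf_diff Im_qf_kronecker_matrix2)
qed

lemma invertible_outer_mat: "resolvent_like \<eta> M \<Longrightarrow> 0 < Im \<eta> \<Longrightarrow> invertible (outer_mat S n L z M \<eta>)"
  using matrix_inv_resolvent_like(1)[OF Im_qf_outer_mat] .

lemma F_map_resolvent_like:
  assumes M: "resolvent_like \<eta> M" and \<eta>: "0 < Im \<eta>"
  shows "resolvent_like \<eta> (F_map S n L z M \<eta>)"
proof -
  have A: "Im (qf v (outer_mat S n L z M \<eta>)) \<le> - Im \<eta> * (norm v)\<^sup>2" for v
    by (rule Im_qf_outer_mat[OF M])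
  show ?thesis
    unfolding resolvent_like_def F_map_def
    by (intro conjI allI impI) (rule matrix_inv_resolvent_like(2)[OF A \<eta>], assumption,
      rule matrix_inv_resolvent_like(3)[OF A \<eta>])
qed

lemma F_well_definedI: "resolvent_like \<eta> M \<Longrightarrow> 0 < Im \<eta> \<Longrightarrow> F_well_defined S n L z M \<eta>"
  by (simp add: F_well_defined_def invertible_inner_mat invertible_outer_mat F_integrand_absolutely_integrable)

lemma integral_F_integrand_entry:
  assumes "resolvent_like \<eta> M"
  shows "integral {0..2 * pi} (F_integrand S n L M) $ p $ q = integral {0..2 * pi} (\<lambda>\<theta>. F_integrand S n L M \<theta> $ p $ q)"
  using integral_linear[OF F_integrand_integrable[OF assms] bounded_linear_entry] by (simp add: comp_def)

section \<open>Holomorphic dependence on the spectral parameter\<close>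

context
  fixes M :: "complex \<Rightarrow> complex^(2 \<times> 'N)^(2 \<times> 'N)"
  assumes hol: "\<And>p q. (\<lambda>\<eta>. M \<eta> $ p $ q) holomorphic_on upper_half_plane"
    and res: "\<And>\<eta>. 0 < Im \<eta> \<Longrightarrow> resolvent_like \<eta> (M \<eta>)"
begin

lemma has_field_derivative_inner_mat:
  assumes "\<eta> \<in> upper_half_plane"
  shows "((\<lambda>\<eta>. inner_mat S n L (M \<eta>) \<theta> $ i $ j) has_field_derivative
    block_trace n (kronecker (mat 1) (S (cis \<theta>)) ** (\<chi> p q. deriv (\<lambda>\<eta>. M \<eta> $ p $ q) \<eta>)) $ i $ j) (at \<eta>)"
proof -
  have M': "((\<lambda>\<eta>. M \<eta> $ p $ q) has_field_derivative deriv (\<lambda>\<eta>. M \<eta> $ p $ q) \<eta>) (at \<eta>)" for p q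
    by (rule holomorphic_derivI[OF hol open_upper_half_plane assms])
  have "((\<lambda>\<eta>. block_trace n (kronecker (mat 1) (S (cis \<theta>)) ** M \<eta>) $ i $ j + U_mat L \<theta> $ i $ j) has_field_derivative
    block_trace n (kronecker (mat 1) (S (cis \<theta>)) ** (\<chi> p q. deriv (\<lambda>\<eta>. M \<eta> $ p $ q) \<eta>)) $ i $ j + 0) (at \<eta>)"
    unfolding block_trace_entry vec_lambda_beta
    by (rule DERIV_add[OF DERIV_cdivide[OF DERIV_sum[OF DERIV_sum[OF DERIV_cmult[OF M']]]] DERIV_const])
  then show ?thesis
    by (simp add: inner_mat_def)
qed

text \<open>Leibniz rule: the inner matrix is affine in \<open>M\<close>, so its derivative
  \<open>T'\<close> is the block trace of the derivative of \<open>M\<close>, and the inverse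
  contributes the factor \<open>G\<close> on either side.\<close>

lemma holomorphic_on_K: "(\<lambda>\<eta>. K (M \<eta>) $ p $ q) holomorphic_on upper_half_plane"
proof -
  define G where "G \<eta> \<theta> = matrix_inv (inner_mat S n L (M \<eta>) \<theta>)" for \<eta> \<theta>
  define T' where "T' \<eta> \<theta> = block_trace n (kronecker (mat 1) (S (cis \<theta>)) ** (\<chi> p q. deriv (\<lambda>\<eta>. M \<eta> $ p $ q) \<eta>))" for \<eta> \<theta>
  have res': "resolvent_like \<eta> (M \<eta>)" if "\<eta> \<in> upper_half_plane" for \<eta>
    using res that by (simp add: upper_half_plane_def)
  have "(\<lambda>\<eta>. integral (cbox 0 (2 * pi)) (\<lambda>\<theta>. F_integrand S n L (M \<eta>) \<theta> $ p $ q)) holomorphic_on upper_half_plane"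
  proof (rule leibniz_rule_holomorphic[where f = "\<lambda>\<eta> \<theta>. F_integrand S n L (M \<eta>) \<theta> $ p $ q" and fx = "\<lambda>\<eta> \<theta>. - (G \<eta> \<theta> ** T' \<eta> \<theta> ** G \<eta> \<theta>) $ fst p $ fst q * S (cis \<theta>) $ snd p $ snd q"])
    show "((\<lambda>\<eta>. F_integrand S n L (M \<eta>) \<theta> $ p $ q) has_field_derivative
        - (G \<eta> \<theta> ** T' \<eta> \<theta> ** G \<eta> \<theta>) $ fst p $ fst q * S (cis \<theta>) $ snd p $ snd q) (at \<eta> within upper_half_plane)"
      if "\<eta> \<in> upper_half_plane" for \<eta> \<theta>
      unfolding F_integrand_entry G_def T'_def
      by (rule has_field_derivative_at_within, rule DERIV_cmult_right,
          rule has_field_derivative_matrix_inv[OF open_upper_half_plane that])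
        (simp_all add: invertible_inner_mat[OF res'] has_field_derivative_inner_mat)
    show "(\<lambda>\<theta>. F_integrand S n L (M \<eta>) \<theta> $ p $ q) integrable_on cbox 0 (2 * pi)"
      if "\<eta> \<in> upper_half_plane" for \<eta>
      using integrable_linear[OF F_integrand_integrable[OF res'[OF that]] bounded_linear_entry[of p q]] by (simp add: comp_def)
    let ?X = "upper_half_plane \<times> cbox 0 (2 * pi)"
    have M: "continuous_on ?X (\<lambda>s. M (fst s) $ a $ b)" for a b
      by (rule continuous_on_compose2[OF holomorphic_on_imp_continuous_on[OF hol] continuous_on_fst[OF continuous_on_id]]) auto
    have M': "continuous_on ?X (\<lambda>s. deriv (\<lambda>\<eta>. M \<eta> $ a $ b) (fst s))" for a b
      by (rule continuous_on_compose2[OF holomorphic_on_imp_continuous_on[OF holomorphic_deriv[OF hol open_upper_half_plane]]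
          continuous_on_fst[OF continuous_on_id]]) auto
    have G: "continuous_on ?X (\<lambda>s. G (fst s) (snd s) $ a $ b)" for a b
      unfolding G_def
      by (rule continuous_on_matrix_inv_inner_mat[where e = fst, OF continuous_on_snd[OF continuous_on_id] M])
        (auto intro: res')
    have T: "continuous_on ?X (\<lambda>s. T' (fst s) (snd s) $ a $ b)" for a b
      unfolding T'_def by (rule continuous_on_block_trace[OF continuous_on_snd[OF continuous_on_id]]) (unfold vec_lambda_beta, rule M')
    have "continuous_on ?X (\<lambda>s. - (G (fst s) (snd s) ** T' (fst s) (snd s) ** G (fst s) (snd s)) $ fst p $ fst q
        * S (cis (snd s)) $ snd p $ snd q)"
      unfolding matrix_matrix_mult_def vector_uminus_component vec_lambda_beta
      by (intro G T continuous_on_S_cis[OF continuous_on_snd[OF continuous_on_id]] continuous_on_mult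
          continuous_on_minus continuous_on_sum)
    then show "continuous_on ?X (\<lambda>(\<eta>, \<theta>). - (G \<eta> \<theta> ** T' \<eta> \<theta> ** G \<eta> \<theta>) $ fst p $ fst q * S (cis \<theta>) $ snd p $ snd q)"
      by (simp add: case_prod_unfold)
  qed (rule convex_upper_half_plane)
  then have "(\<lambda>\<eta>. (1 / (2 * pi)) *\<^sub>R integral (cbox 0 (2 * pi)) (\<lambda>\<theta>. F_integrand S n L (M \<eta>) \<theta> $ p $ q)) holomorphic_on upper_half_plane"
    unfolding scaleR_conv_of_real by (rule holomorphic_on_mult[OF holomorphic_on_const])
  then show ?thesis
    by (rule holomorphic_transform) (simp add: K_def integral_F_integrand_entry[OF res'])
qed

lemma holomorphic_on_F_map: "(\<lambda>\<eta>. F_map S n L z (M \<eta>) \<eta> $ p $ q) holomorphic_on upper_half_plane"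
  unfolding F_map_def
proof (rule holomorphic_on_matrix_inv)
  show "(\<lambda>\<eta>. outer_mat S n L z (M \<eta>) \<eta> $ i $ j) holomorphic_on upper_half_plane" for i j
    unfolding outer_mat_entry
    by (rule holomorphic_on_diff[OF holomorphic_on_K holomorphic_on_add[OF holomorphic_on_const
          holomorphic_on_mult[OF holomorphic_on_ident holomorphic_on_const]]])
  show "invertible (outer_mat S n L z (M \<eta>) \<eta>)" if "\<eta> \<in> upper_half_plane" for \<eta>
    using invertible_outer_mat[OF res, of \<eta>] that by (simp add: upper_half_plane_def)
qed

end

end

section \<open>Estimates for large imaginary part\<close>

text \<open>The entrywise l1 norm: submultiplicative, multiplicative on Kronecker products, and
  bounded by estimates of single entries. Its dimension factors do no harm, since they are absorbed
  by the choice of \<open>y0\<close>.\<close>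

definition mnorm :: "complex^'m^'k \<Rightarrow> real" where
  "mnorm A = (\<Sum>i\<in>UNIV. \<Sum>j\<in>UNIV. norm (A $ i $ j))"

lemma mnorm_nonneg: "0 \<le> mnorm A"
  by (simp add: mnorm_def sum_nonneg)

lemma norm_entry_le_mnorm: "norm (A $ i $ j) \<le> mnorm A"
proof -
  have "norm (A $ i $ j) \<le> (\<Sum>j\<in>UNIV. norm (A $ i $ j))"
    by (intro member_le_sum) auto
  also have "\<dots> \<le> mnorm A"
    unfolding mnorm_def by (intro member_le_sum[where f = "\<lambda>i. \<Sum>j\<in>UNIV. norm (A $ i $ j)"]) (auto intro: sum_nonneg)
  finally show ?thesis .
qed

lemma mnorm_eq_0: "mnorm A = 0 \<Longrightarrow> A = 0"
  using norm_entry_le_mnorm[of A] by (simp add: vec_eq_iff)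

lemma mnorm_add_le: "mnorm (A + B) \<le> mnorm A + mnorm B"
  unfolding mnorm_def sum.distrib[symmetric] by (intro sum_mono) (simp add: norm_triangle_ineq)

lemma mnorm_diff_le: "mnorm (A - B) \<le> mnorm A + mnorm B"
  unfolding mnorm_def sum.distrib[symmetric] by (intro sum_mono) (simp add: norm_triangle_ineq4)

lemma mnorm_minus_commute: "mnorm (A - B) = mnorm (B - A)"
  by (simp add: mnorm_def norm_minus_commute)

lemma mnorm_le_of_entry_le:
  fixes A :: "complex^'m^'m"
  assumes "\<And>i j. norm (A $ i $ j) \<le> c"
  shows "mnorm A \<le> (real CARD('m))\<^sup>2 * c"
proof -
  have "(\<Sum>j\<in>UNIV. norm (A $ i $ j)) \<le> real CARD('m) * c" for i
    using assms by (intro sum_bounded_above)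
  then have "mnorm A \<le> real CARD('m) * (real CARD('m) * c)"
    unfolding mnorm_def using sum_bounded_above[of UNIV "\<lambda>i. \<Sum>j\<in>UNIV. norm (A $ i $ j)" "real CARD('m) * c"] by simp
  then show ?thesis
    by (simp add: power2_eq_square mult.assoc)
qed

lemma mnorm_mult_le: "mnorm (A ** B) \<le> mnorm A * mnorm B"
proof -
  have "mnorm (A ** B) \<le> (\<Sum>i\<in>UNIV. \<Sum>j\<in>UNIV. \<Sum>k\<in>UNIV. norm (A $ i $ k) * norm (B $ k $ j))"
    unfolding mnorm_def matrix_matrix_mult_def vec_lambda_beta
    by (intro sum_mono sum_norm_le) (simp add: norm_mult)
  also have "\<dots> = (\<Sum>i\<in>UNIV. \<Sum>k\<in>UNIV. norm (A $ i $ k) * (\<Sum>j\<in>UNIV. norm (B $ k $ j)))"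
    unfolding sum_distrib_left by (intro sum.cong refl sum.swap)
  also have "\<dots> \<le> (\<Sum>i\<in>UNIV. \<Sum>k\<in>UNIV. norm (A $ i $ k) * mnorm B)"
  proof (intro sum_mono mult_left_mono)
    show "(\<Sum>j\<in>UNIV. norm (B $ k $ j)) \<le> mnorm B" for k
      unfolding mnorm_def by (intro member_le_sum[where f = "\<lambda>i. \<Sum>j\<in>UNIV. norm (B $ i $ j)"]) (auto intro: sum_nonneg)
  qed auto
  finally show ?thesis
    by (simp add: mnorm_def sum_distrib_right)
qed

lemma mnorm_triple_le: "mnorm A \<le> a \<Longrightarrow> mnorm B \<le> b \<Longrightarrow> mnorm C \<le> c \<Longrightarrow> mnorm (A ** B ** C) \<le> a * b * c"
  using mnorm_nonneg[of A] mnorm_nonneg[of B] mnorm_nonneg[of C]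
  by (intro order_trans[OF mnorm_mult_le] order_trans[OF mult_mono[OF mnorm_mult_le order_refl]] mult_mono) auto

lemma mnorm_kronecker: "mnorm (kronecker A B) = mnorm A * mnorm B"
proof -
  have "mnorm (kronecker A B) = (\<Sum>a\<in>UNIV. \<Sum>b\<in>UNIV. \<Sum>c\<in>UNIV. \<Sum>d\<in>UNIV. norm (A $ a $ c) * norm (B $ b $ d))"
    by (simp add: mnorm_def kronecker_def sum_UNIV_prod norm_mult)
  also have "\<dots> = (\<Sum>a\<in>UNIV. \<Sum>b\<in>UNIV. (\<Sum>c\<in>UNIV. norm (A $ a $ c)) * (\<Sum>d\<in>UNIV. norm (B $ b $ d)))"
    by (simp only: sum_product)
  finally show ?thesis
    by (simp only: mnorm_def sum_product)
qed

lemma mnorm_block_trace_le: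
  assumes "0 < n" shows "mnorm (block_trace n X) \<le> mnorm X"
proof -
  have "norm (block_trace n X $ p $ q) \<le> (\<Sum>k\<in>UNIV. \<Sum>l\<in>UNIV. norm (X $ (p, k) $ (q, l)))" for p q
  proof -
    have "norm (block_trace n X $ p $ q) \<le> norm (\<Sum>k\<in>UNIV. X $ (p, k) $ (q, k))"
      using assms divide_left_mono[of 1 "real n" "norm (\<Sum>k\<in>UNIV. X $ (p, k) $ (q, k))"]
      by (simp add: block_trace_def trace_def block_def norm_divide)
    also have "\<dots> \<le> (\<Sum>k\<in>UNIV. norm (X $ (p, k) $ (q, k)))"
      by (rule norm_sum)
    also have "\<dots> \<le> (\<Sum>k\<in>UNIV. \<Sum>l\<in>UNIV. norm (X $ (p, k) $ (q, l)))"
      by (intro sum_mono member_le_sum[where f = "\<lambda>l. norm (X $ (p, _) $ (q, l))"]) auto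
    finally show ?thesis .
  qed
  then have "mnorm (block_trace n X) \<le> (\<Sum>p\<in>UNIV. \<Sum>q\<in>UNIV. \<Sum>k\<in>UNIV. \<Sum>l\<in>UNIV. norm (X $ (p, k) $ (q, l)))"
    unfolding mnorm_def by (intro sum_mono)
  also have "\<dots> = (\<Sum>p\<in>UNIV. \<Sum>k\<in>UNIV. \<Sum>q\<in>UNIV. \<Sum>l\<in>UNIV. norm (X $ (p, k) $ (q, l)))"
    by (intro sum.cong refl sum.swap)
  finally show ?thesis
    by (simp add: mnorm_def sum_UNIV_prod)
qed

lemma mnorm_mat_1: "mnorm (mat 1 :: complex^2^2) = 2"
  by (simp add: mnorm_def sum_UNIV_2 mat_def)

lemma mnorm_U_mat: "mnorm (U_mat L \<theta>) = 2"
  by (simp add: mnorm_def sum_UNIV_2)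

lemma matrix_mult_add_right: "(A + B) ** C = A ** C + B ** (C :: complex^'m^'k)"
  by (simp add: matrix_matrix_mult_def vec_eq_iff distrib_right sum.distrib)

text \<open>The resolvent identity; the contraction estimate uses it for the inner and for the outer
  inverse.\<close>

lemma matrix_inv_diff:
  fixes A B :: "complex^'m^'m"
  assumes "invertible A" "invertible B"
  shows "matrix_inv A - matrix_inv B = matrix_inv A ** (B - A) ** matrix_inv B"
proof -
  have "matrix_inv A ** (B - A) ** matrix_inv B = matrix_inv A ** B ** matrix_inv B - matrix_inv A ** A ** matrix_inv B"
    by (simp add: matrix_matrix_mult_def vec_eq_iff algebra_simps sum_subtractf)
  then show ?thesis
    using assms by (simp add: matrix_inv_left matrix_mul_assoc[symmetric] matrix_inv_right)
qed

lemma block_trace_diff: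
  "block_trace n (kronecker (mat 1) A ** M) - block_trace n (kronecker (mat 1) A ** M')
    = block_trace n (kronecker (mat 1) A ** (M - M'))"
  by (simp add: vec_eq_iff block_trace_entry right_diff_distrib sum_subtractf diff_divide_distrib)

context matrix_equation
begin

definition S_bound :: real where "S_bound = (SUP \<theta>. mnorm (S (cis \<theta>)))"

lemma mnorm_S_le: "mnorm (S (cis \<theta>)) \<le> S_bound"
proof -
  have "continuous_on (sphere 0 1) (\<lambda>w. mnorm (S w))"
    unfolding mnorm_def by (intro continuous_intros cont)
  then have "bounded ((\<lambda>w. mnorm (S w)) ` sphere 0 1)"
    by (intro compact_imp_bounded compact_continuous_image) auto
  then have "bounded (range (\<lambda>\<theta>. mnorm (S (cis \<theta>))))"
    by (rule bounded_subset) auto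
  then show ?thesis
    unfolding S_bound_def by (intro cSUP_upper bounded_imp_bdd_above) auto
qed

lemma S_bound_nonneg: "0 \<le> S_bound"
  using mnorm_S_le[of 0] mnorm_nonneg[of "S (cis 0)"] by linarith

definition dim_square :: real where "dim_square = (real CARD(2 \<times> 'N))\<^sup>2"

lemma dim_square_nonneg: "0 \<le> dim_square"
  by (simp add: dim_square_def)

text \<open>The first factor bounds \<open>K M\<close> minus the Hermitian part of the \<eta>, z
  matrix, the second one is \<open>Im \<eta>\<close> times the bound for a resolvent-like
  matrix.\<close>

definition decay_const where "decay_const = (dim_square * (4 * S_bound) + mnorm (kronecker (matrix2 0 z (cnj z) 0) (mat 1) :: complex^(2 \<times> 'N)^(2 \<times> 'N))) * (dim_square * 4)"

text \<open>
  The second summand makes \<open>\<T>(\<Sigma>M)\<close> small against \<open>U\<^sub>L\<close>, the third one makes the map a contraction.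
\<close>

definition y0 where "y0 = 1 + 32 * S_bound * dim_square + 1024 * dim_square ^ 3 * S_bound\<^sup>2"

lemma y0_ge: "1 \<le> y0" "32 * S_bound * dim_square \<le> y0" "1024 * dim_square ^ 3 * S_bound\<^sup>2 \<le> y0"
  using S_bound_nonneg dim_square_nonneg by (auto simp: y0_def add_increasing add_increasing2)

lemma mnorm_resolvent_like:
  fixes M :: "complex^(2 \<times> 'N)^(2 \<times> 'N)"
  assumes "resolvent_like \<eta> M" "0 < Im \<eta>" shows "mnorm M \<le> dim_square * (4 / Im \<eta>)"
  unfolding dim_square_def using resolvent_like_entry_le[OF assms] by (rule mnorm_le_of_entry_le)

lemma mnorm_block_trace_S: "mnorm (block_trace n (kronecker (mat 1) (S (cis \<theta>)) ** M)) \<le> 2 * S_bound * mnorm M"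
proof -
  have "mnorm (block_trace n (kronecker (mat 1) (S (cis \<theta>)) ** M)) \<le> mnorm (kronecker (mat 1 :: complex^2^2) (S (cis \<theta>)) ** M)"
    by (rule mnorm_block_trace_le[OF n_pos])
  also have "\<dots> \<le> mnorm (kronecker (mat 1 :: complex^2^2) (S (cis \<theta>))) * mnorm M"
    by (rule mnorm_mult_le)
  also have "\<dots> \<le> 2 * S_bound * mnorm M"
    unfolding mnorm_kronecker mnorm_mat_1 using mnorm_S_le mnorm_nonneg by (intro mult_right_mono) auto
  finally show ?thesis .
qed

text \<open>Multiplying \<open>G ** (T + U) = mat 1\<close> by the involution \<open>U\<close> gives
  \<open>G = U - G ** T ** U\<close>. As \<open>U\<close> has norm 2 and \<open>T\<close> at most
  1/4, the norm of \<open>G\<close> is at most 2 plus half of itself.\<close>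

lemma mnorm_matrix_inv_inner_mat:
  assumes M: "resolvent_like \<eta> M" and \<eta>: "y0 \<le> Im \<eta>"
  shows "mnorm (matrix_inv (inner_mat S n L M \<theta>)) \<le> 4"
proof -
  have pos: "0 < Im \<eta>"
    using \<eta> y0_ge(1) by linarith
  define T where "T = block_trace n (kronecker (mat 1) (S (cis \<theta>)) ** M)"
  define G where "G = matrix_inv (inner_mat S n L M \<theta>)"
  have "mnorm T \<le> 2 * S_bound * mnorm M"
    unfolding T_def by (rule mnorm_block_trace_S)
  also have "\<dots> \<le> 2 * S_bound * (dim_square * (4 / Im \<eta>))"
    using S_bound_nonneg mnorm_resolvent_like[OF M pos] by (intro mult_left_mono) auto
  \<comment> \<open>The left side is \<open>8 * S_bound * dim_square / Im \<eta>\<close>; hence the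
    constant 32 in \<open>y0\<close>.\<close>
  also have "\<dots> \<le> 1 / 4"
    using \<eta> y0_ge(2) pos by (simp add: field_simps)
  finally have T: "mnorm T \<le> 1 / 4" .
  have "G ** (T + U_mat L \<theta>) = mat 1"
    unfolding G_def T_def using matrix_inv_left[OF invertible_inner_mat[OF M]] by (simp add: inner_mat_def)
  then have "G ** (T + U_mat L \<theta>) ** U_mat L \<theta> = U_mat L \<theta>"
    by simp
  then have "G ** T ** U_mat L \<theta> + G = U_mat L \<theta>"
    by (simp only: matrix_add_ldistrib matrix_mult_add_right matrix_mul_assoc[symmetric] U_mat_involution matrix_mul_rid)
  then have "G = U_mat L \<theta> - G ** T ** U_mat L \<theta>"
    by (simp add: algebra_simps)
  then have "mnorm G \<le> mnorm (U_mat L \<theta>) + mnorm (G ** T ** U_mat L \<theta>)"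
    by (metis mnorm_diff_le)
  also have "\<dots> \<le> 2 + mnorm G * (1 / 4) * 2"
    using mnorm_triple_le[OF order_refl[of "mnorm G"] T, of "U_mat L \<theta>" 2] by (simp add: mnorm_U_mat)
  finally show ?thesis
    by (simp add: G_def)
qed

lemma K_entry:
  assumes "resolvent_like \<eta> M"
  shows "K M $ p $ q = (1 / (2 * pi)) *\<^sub>R integral {0..2 * pi} (\<lambda>\<theta>. F_integrand S n L M \<theta> $ p $ q)"
  by (simp add: K_def integral_F_integrand_entry[OF assms])

lemma norm_scaled_integral_le:
  fixes f :: "real \<Rightarrow> complex"
  assumes "continuous_on {0..2 * pi} f" "\<And>\<theta>. norm (f \<theta>) \<le> B"
  shows "norm ((1 / (2 * pi)) *\<^sub>R integral {0..2 * pi} f) \<le> B"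
proof -
  have "norm (integral {0..2 * pi} f) \<le> B * (2 * pi - 0)"
    using assms by (intro integral_bound) auto
  then show ?thesis
    by (simp add: field_simps)
qed

lemma continuous_on_F_integrand_entry:
  "resolvent_like \<eta> M \<Longrightarrow> continuous_on X (\<lambda>\<theta>. F_integrand S n L M \<theta> $ p $ q)"
  by (intro continuous_on_component continuous_on_F_integrand)

lemma mnorm_K:
  assumes M: "resolvent_like \<eta> M" and \<eta>: "y0 \<le> Im \<eta>"
  shows "mnorm (K M) \<le> dim_square * (4 * S_bound)"
  unfolding dim_square_def
proof (rule mnorm_le_of_entry_le)
  fix p q
  show "norm (K M $ p $ q) \<le> 4 * S_bound"
    unfolding K_entry[OF M]
  proof (rule norm_scaled_integral_le[OF continuous_on_F_integrand_entry[OF M]])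
    fix \<theta>
    have "norm (F_integrand S n L M \<theta> $ p $ q) \<le> mnorm (F_integrand S n L M \<theta>)"
      by (rule norm_entry_le_mnorm)
    also have "\<dots> \<le> 4 * S_bound"
      unfolding F_integrand_def mnorm_kronecker
      using mnorm_matrix_inv_inner_mat[OF M \<eta>] mnorm_S_le mnorm_nonneg by (intro mult_mono) auto
    finally show "norm (F_integrand S n L M \<theta> $ p $ q) \<le> 4 * S_bound" .
  qed
qed

text \<open>With \<open>W\<close> the part of the \<eta>, z matrix free of \<eta>,
  \<open>(K M - W - \<eta>) F = 1\<close> says that \<open>- \<eta> F - 1\<close> is
  \<open>- (K M - W) F\<close>, a bounded matrix times one of order \<open>1 / Im \<eta>\<close>.
  The bound is uniform in \<open>M\<close>, which later lets it pass to limits of iterates.\<close>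

lemma F_map_asymptotics:
  assumes M: "resolvent_like \<eta> M" and \<eta>: "y0 \<le> Im \<eta>"
  shows "norm (- \<eta> * F_map S n L z M \<eta> $ p $ q - mat 1 $ p $ q) \<le> decay_const / Im \<eta>"
proof -
  have pos: "0 < Im \<eta>"
    using \<eta> y0_ge(1) by linarith
  define W where "W = (kronecker (matrix2 0 z (cnj z) 0) (mat 1) :: complex^(2 \<times> 'N)^(2 \<times> 'N))"
  define F where "F = F_map S n L z M \<eta>"
  have "outer_mat S n L z M \<eta> ** F = mat 1"
    unfolding F_def F_map_def by (rule matrix_inv_right[OF invertible_outer_mat[OF M pos]])
  moreover have "outer_mat S n L z M \<eta> $ i $ k = (K M - W) $ i $ k - \<eta> * mat 1 $ i $ k" for i k
    unfolding outer_mat_entry W_def by simp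
  moreover have "(\<Sum>k\<in>UNIV. \<eta> * mat 1 $ i $ k * F $ k $ j) = \<eta> * F $ i $ j" for i j
  proof -
    have "\<eta> * mat 1 $ i $ k * F $ k $ j = (if k = i then \<eta> * F $ k $ j else 0)" for k
      by (simp add: mat_def)
    then show ?thesis
      by simp
  qed
  ultimately have "((K M - W) ** F) $ i $ j - \<eta> * F $ i $ j = mat 1 $ i $ j" for i j
    unfolding vec_eq_iff matrix_matrix_mult_def vec_lambda_beta
    by (simp only: left_diff_distrib sum_subtractf)
  then have "- \<eta> * F $ p $ q - mat 1 $ p $ q = - (((K M - W) ** F) $ p $ q)"
    by (metis (no_types, opaque_lifting) diff_diff_eq2 add_diff_cancel_left' diff_minus_eq_add minus_diff_eq mult_minus_left)
  then have "norm (- \<eta> * F $ p $ q - mat 1 $ p $ q) \<le> mnorm ((K M - W) ** F)"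
    using norm_entry_le_mnorm[of "(K M - W) ** F" p q] by simp
  also have "\<dots> \<le> mnorm (K M - W) * mnorm F"
    by (rule mnorm_mult_le)
  also have "\<dots> \<le> (dim_square * (4 * S_bound) + mnorm W) * (dim_square * (4 / Im \<eta>))"
  proof (rule mult_mono)
    show "mnorm (K M - W) \<le> dim_square * (4 * S_bound) + mnorm W"
      using mnorm_diff_le[of "K M" W] mnorm_K[OF M \<eta>] by linarith
    show "mnorm F \<le> dim_square * (4 / Im \<eta>)"
      unfolding F_def using mnorm_resolvent_like[OF F_map_resolvent_like[OF M pos] pos] .
  qed (use dim_square_nonneg S_bound_nonneg mnorm_nonneg in \<open>auto intro!: add_nonneg_nonneg\<close>)
  finally show ?thesis
    by (simp add: decay_const_def W_def F_def)
qed

text \<open>The resolvent identity, used twice, bounds the difference by a multiple of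
  \<open>mnorm (M - M')\<close>. The two outer inverses contribute a factor of order
  \<open>1 / (Im \<eta>)\<^sup>2\<close>, which makes the multiple small.\<close>

lemma F_map_contraction:
  assumes M: "resolvent_like \<eta> M" and M': "resolvent_like \<eta> M'" and \<eta>: "y0 \<le> Im \<eta>"
  shows "mnorm (F_map S n L z M \<eta> - F_map S n L z M' \<eta>) \<le> mnorm (M - M') / 2"
proof -
  have pos: "0 < Im \<eta>" and ge1: "1 \<le> Im \<eta>"
    using \<eta> y0_ge(1) by linarith+
  let ?G = "\<lambda>M \<theta>. matrix_inv (inner_mat S n L M \<theta>)"
  have G_diff: "mnorm (?G M \<theta> - ?G M' \<theta>) \<le> 4 * (2 * S_bound * mnorm (M - M')) * 4" for \<theta>
  proof -
    have "inner_mat S n L M' \<theta> - inner_mat S n L M \<theta> = block_trace n (kronecker (mat 1) (S (cis \<theta>)) ** (M' - M))"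
      by (simp add: inner_mat_def block_trace_diff)
    then have "mnorm (inner_mat S n L M' \<theta> - inner_mat S n L M \<theta>) \<le> 2 * S_bound * mnorm (M - M')"
      using mnorm_block_trace_S[of \<theta> "M' - M"] by (simp add: mnorm_minus_commute)
    then show ?thesis
      unfolding matrix_inv_diff[OF invertible_inner_mat[OF M] invertible_inner_mat[OF M']]
      by (intro mnorm_triple_le mnorm_matrix_inv_inner_mat[OF M \<eta>] mnorm_matrix_inv_inner_mat[OF M' \<eta>])
  qed
  have "mnorm (K M' - K M) \<le> dim_square * (32 * S_bound\<^sup>2 * mnorm (M - M'))"
    unfolding dim_square_def
  proof (rule mnorm_le_of_entry_le)
    fix p q
    let ?f = "\<lambda>M \<theta>. F_integrand S n L M \<theta> $ p $ q"
    have int: "?f M integrable_on {0..2 * pi}" "?f M' integrable_on {0..2 * pi}"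
      using M M' by (auto intro!: integrable_continuous_interval continuous_on_F_integrand_entry)
    have "(K M' - K M) $ p $ q = (1 / (2 * pi)) *\<^sub>R integral {0..2 * pi} (\<lambda>\<theta>. ?f M' \<theta> - ?f M \<theta>)"
      unfolding vector_minus_component K_entry[OF M] K_entry[OF M']
      using Henstock_Kurzweil_Integration.integral_diff[OF int(2,1)] by (simp add: scaleR_diff_right)
    also have "norm \<dots> \<le> 32 * S_bound\<^sup>2 * mnorm (M - M')"
    proof (rule norm_scaled_integral_le)
      show "continuous_on {0..2 * pi} (\<lambda>\<theta>. ?f M' \<theta> - ?f M \<theta>)"
        by (intro continuous_on_diff continuous_on_F_integrand_entry[OF M] continuous_on_F_integrand_entry[OF M'])
      fix \<theta>
      have "?f M' \<theta> - ?f M \<theta> = (?G M' \<theta> - ?G M \<theta>) $ fst p $ fst q * S (cis \<theta>) $ snd p $ snd q"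
        by (simp add: F_integrand_entry left_diff_distrib)
      also have "norm \<dots> \<le> (4 * (2 * S_bound * mnorm (M - M')) * 4) * S_bound"
        unfolding norm_mult
        using order_trans[OF norm_entry_le_mnorm G_diff] order_trans[OF norm_entry_le_mnorm mnorm_S_le]
          S_bound_nonneg mnorm_nonneg[of "M - M'"]
        by (intro mult_mono) (auto simp: mnorm_minus_commute norm_minus_commute)
      finally show "norm (?f M' \<theta> - ?f M \<theta>) \<le> 32 * S_bound\<^sup>2 * mnorm (M - M')"
        by (simp add: power2_eq_square mult_ac)
    qed
    finally show "norm ((K M' - K M) $ p $ q) \<le> 32 * S_bound\<^sup>2 * mnorm (M - M')" .
  qed
  moreover have "outer_mat S n L z M' \<eta> - outer_mat S n L z M \<eta> = K M' - K M"
    by (simp add: outer_mat_eq)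
  ultimately have "mnorm (F_map S n L z M \<eta> - F_map S n L z M' \<eta>)
      \<le> dim_square * (4 / Im \<eta>) * (dim_square * (32 * S_bound\<^sup>2 * mnorm (M - M'))) * (dim_square * (4 / Im \<eta>))"
    unfolding F_map_def matrix_inv_diff[OF invertible_outer_mat[OF M pos] invertible_outer_mat[OF M' pos]]
    by (intro mnorm_triple_le mnorm_resolvent_like[OF _ pos] F_map_resolvent_like[OF M pos, unfolded F_map_def]
        F_map_resolvent_like[OF M' pos, unfolded F_map_def]) simp
  \<comment> \<open>The constants 4, 32 and 4 multiply to 512; splitting off the desired factor 1/2
    doubles this to 1024.\<close>
  also have "\<dots> = (1024 * dim_square ^ 3 * S_bound\<^sup>2) / (Im \<eta> * Im \<eta>) * (mnorm (M - M') / 2)"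
    using pos by (simp add: field_simps power3_eq_cube power2_eq_square)
  also have "\<dots> \<le> 1 * (mnorm (M - M') / 2)"
  proof (rule mult_right_mono)
    \<comment> \<open>\<open>y0\<close> bounds this by \<open>Im \<eta>\<close> only to the first
      power, which suffices because \<open>Im \<eta>\<close> is at least 1.\<close>
    have "1024 * dim_square ^ 3 * S_bound\<^sup>2 \<le> Im \<eta> * 1"
      using y0_ge(3) \<eta> by linarith
    also have "\<dots> \<le> Im \<eta> * Im \<eta>"
      using ge1 by (intro mult_left_mono) auto
    finally show "1024 * dim_square ^ 3 * S_bound\<^sup>2 / (Im \<eta> * Im \<eta>) \<le> 1"
      using pos by simp
  qed (use mnorm_nonneg in auto)
  finally show ?thesis
    by simp
qed

end

section \<open>Existence and uniqueness\<close>

text \<open>Montel's theorem yields a subsequence for one function at a time, but all entries of a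
  matrix need a common one. Successive refinement works since limits already obtained persist along
  subsequences.\<close>

lemma Montel_finite_family:
  fixes f :: "'a \<Rightarrow> nat \<Rightarrow> complex \<Rightarrow> complex"
  assumes S: "open S" and "finite A"
    and hol: "\<And>a k. a \<in> A \<Longrightarrow> f a k holomorphic_on S"
    and bdd: "\<And>a C. a \<in> A \<Longrightarrow> compact C \<Longrightarrow> C \<subseteq> S \<Longrightarrow> \<exists>B. \<forall>k. \<forall>w\<in>C. norm (f a k w) \<le> B"
  shows "\<exists>r. strict_mono (r :: nat \<Rightarrow> nat) \<and>
    (\<forall>a\<in>A. \<exists>g. g holomorphic_on S \<and> (\<forall>w\<in>S. (\<lambda>k. f a (r k) w) \<longlonglongrightarrow> g w))"
  using assms(2-)
proof (induction A rule: finite_induct)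
  case empty
  show ?case
    by (intro exI[of _ id]) (simp add: strict_mono_def)
next
  case (insert a A)
  have "\<exists>r. strict_mono (r :: nat \<Rightarrow> nat) \<and>
      (\<forall>a\<in>A. \<exists>g. g holomorphic_on S \<and> (\<forall>w\<in>S. (\<lambda>k. f a (r k) w) \<longlonglongrightarrow> g w))"
    using insert.prems by (intro insert.IH) simp_all
  then obtain r where r: "strict_mono (r :: nat \<Rightarrow> nat)"
    "\<And>a. a \<in> A \<Longrightarrow> \<exists>g. g holomorphic_on S \<and> (\<forall>w\<in>S. (\<lambda>k. f a (r k) w) \<longlonglongrightarrow> g w)"
    by blast
  let ?H = "range (\<lambda>k. f a (r k))"
  have bdd: "\<exists>B. \<forall>h\<in>?H. \<forall>w\<in>C. norm (h w) \<le> B" if "compact C" "C \<subseteq> S" for C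
    using insert.prems(2)[of a C] that by blast
  have hol: "h holomorphic_on S" if "h \<in> ?H" for h
    using that insert.prems(1)[of a] by auto
  obtain g r' where g: "g holomorphic_on S" "strict_mono (r' :: nat \<Rightarrow> nat)"
      "\<And>w. w \<in> S \<Longrightarrow> (\<lambda>k. f a (r (r' k)) w) \<longlonglongrightarrow> g w"
    by (rule Montel[OF S hol bdd subset_refl], assumption, assumption, assumption, rule that)
  have "\<exists>g. g holomorphic_on S \<and> (\<forall>w\<in>S. (\<lambda>k. f b ((r \<circ> r') k) w) \<longlonglongrightarrow> g w)" if "b \<in> insert a A" for b
  proof (cases "b = a")
    case True
    then show ?thesis
      using g(1,3) by auto
  next
    case False
    with that have "b \<in> A"
      by simp
    from r(2)[OF this] obtain h where h: "h holomorphic_on S" "\<And>w. w \<in> S \<Longrightarrow> (\<lambda>k. f b (r k) w) \<longlonglongrightarrow> h w"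
      by blast
    have "(\<lambda>k. f b ((r \<circ> r') k) w) \<longlonglongrightarrow> h w" if "w \<in> S" for w
      using LIMSEQ_subseq_LIMSEQ[OF h(2)[OF that] g(2)] by (simp add: comp_def)
    then show ?thesis
      using h(1) by blast
  qed
  then show ?case
    using strict_mono_o[OF r(1) g(2)] by blast
qed

lemma compact_upper_half_plane_Im_ge:
  assumes "compact C" "C \<subseteq> upper_half_plane"
  shows "\<exists>\<delta>>0. \<forall>w\<in>C. \<delta> \<le> Im w"
proof (cases "C = {}")
  case False
  then obtain w where "w \<in> C" "\<And>v. v \<in> C \<Longrightarrow> Im w \<le> Im v"
    using continuous_attains_inf[OF assms(1) False, of Im] continuous_on_Im[OF continuous_on_id] by blast
  then show ?thesis
    using assms(2) by (auto simp: upper_half_plane_def)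
qed (auto intro: exI[of _ 1])

lemma mnorm_tendsto:
  assumes "\<And>i j. ((\<lambda>k. A k $ i $ j) \<longlongrightarrow> B $ i $ j) F"
  shows "((\<lambda>k. mnorm (A k - B)) \<longlongrightarrow> 0) F"
proof -
  have "((\<lambda>k. mnorm (A k - B)) \<longlongrightarrow> (\<Sum>i\<in>UNIV. \<Sum>j\<in>UNIV. norm (B $ i $ j - B $ i $ j))) F"
    unfolding mnorm_def vector_minus_component by (intro tendsto_intros assms)
  then show ?thesis
    by simp
qed

context matrix_equation
begin

text \<open>The part of the Stieltjes class without the normalization at infinity. It suffices as
  input of the map, whose values acquire the normalization by themselves.\<close>

definition regular :: "(complex \<Rightarrow> complex^(2 \<times> 'N)^(2 \<times> 'N)) \<Rightarrow> bool" where
  "regular M \<longleftrightarrow> (\<forall>p q. (\<lambda>\<eta>. M \<eta> $ p $ q) holomorphic_on upper_half_plane) \<and>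
    (\<forall>\<eta>. 0 < Im \<eta> \<longrightarrow> resolvent_like \<eta> (M \<eta>))"

lemma regularD:
  assumes "regular M"
  shows "(\<lambda>\<eta>. M \<eta> $ p $ q) holomorphic_on upper_half_plane" "0 < Im \<eta> \<Longrightarrow> resolvent_like \<eta> (M \<eta>)"
  using assms unfolding regular_def by blast+

lemma stieltjes_class_regular: "M \<in> stieltjes_class \<Longrightarrow> regular M"
  unfolding regular_def
  by (intro conjI allI impI stieltjes_class_holomorphic stieltjes_class_resolvent_like)

lemma regular_F_map:
  assumes "regular M" shows "regular (\<lambda>\<eta>. F_map S n L z (M \<eta>) \<eta>)"
  unfolding regular_def
proof (intro conjI allI impI)
  show "(\<lambda>\<eta>. F_map S n L z (M \<eta>) \<eta> $ p $ q) holomorphic_on upper_half_plane" for p q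
    by (rule holomorphic_on_F_map[OF regularD[OF assms]])
  show "resolvent_like \<eta> (F_map S n L z (M \<eta>) \<eta>)" if "0 < Im \<eta>" for \<eta>
    using regularD(2)[OF assms that] that by (rule F_map_resolvent_like)
qed

lemma Im_ge_y0_pos: "y0 \<le> Im \<eta> \<Longrightarrow> 0 < Im \<eta>"
  using y0_ge(1) by linarith

text \<open>The behaviour at infinity is replaced by a bound with a fixed constant and positivity by
  its weak form, so that all hypotheses are stable under pointwise limits.\<close>

lemma stieltjes_classI:
  assumes hol: "\<And>p q. (\<lambda>\<eta>. M \<eta> $ p $ q) holomorphic_on upper_half_plane"
    and pos: "\<And>\<eta> x. 0 < Im \<eta> \<Longrightarrow> 0 \<le> Im (qf x (M \<eta>))"
    and bound: "\<And>\<eta> x. 0 < Im \<eta> \<Longrightarrow> norm (qf x (M \<eta>)) \<le> (norm x)\<^sup>2 / Im \<eta>"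
    and asym: "\<And>\<eta> p q. y0 \<le> Im \<eta> \<Longrightarrow> norm (- \<eta> * M \<eta> $ p $ q - mat 1 $ p $ q) \<le> decay_const / Im \<eta>"
  shows "M \<in> stieltjes_class"
proof (rule matrix_herglotz[OF hol pos bound])
  fix p q
  have "((\<lambda>y. - Complex 0 y * M (Complex 0 y) $ p $ q - mat 1 $ p $ q) \<longlongrightarrow> 0) at_top"
  proof (rule Lim_null_comparison)
    show "\<forall>\<^sub>F y in at_top. norm (- Complex 0 y * M (Complex 0 y) $ p $ q - mat 1 $ p $ q) \<le> decay_const / y"
    proof (rule eventually_mono[OF eventually_ge_at_top[of y0]])
      fix y assume "y0 \<le> y"
      then show "norm (- Complex 0 y * M (Complex 0 y) $ p $ q - mat 1 $ p $ q) \<le> decay_const / y"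
        using asym[of "Complex 0 y" p q] by (simp only: complex.sel)
    qed
    show "((\<lambda>y. decay_const / y) \<longlongrightarrow> 0) at_top"
      by (intro tendsto_divide_0[OF tendsto_const] filterlim_at_top_imp_at_infinity filterlim_ident)
  qed
  then show "((\<lambda>y. - Complex 0 y * M (Complex 0 y) $ p $ q) \<longlongrightarrow> mat 1 $ p $ q) at_top"
    by (rule LIM_zero_cancel)
qed

lemma F_map_stieltjes_class:
  assumes "regular M" shows "(\<lambda>\<eta>. F_map S n L z (M \<eta>) \<eta>) \<in> stieltjes_class"
proof (rule stieltjes_classI)
  note F = regularD[OF regular_F_map[OF assms]]
  show "(\<lambda>\<eta>. F_map S n L z (M \<eta>) \<eta> $ p $ q) holomorphic_on upper_half_plane" for p q
    by (rule F(1))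
  show "0 \<le> Im (qf x (F_map S n L z (M \<eta>) \<eta>))" if "0 < Im \<eta>" for x \<eta>
    by (rule Im_qf_nonneg[OF F(2)[OF that]])
  show "norm (qf x (F_map S n L z (M \<eta>) \<eta>)) \<le> (norm x)\<^sup>2 / Im \<eta>" if "0 < Im \<eta>" for x \<eta>
    using F(2)[OF that] by (simp add: resolvent_like_def)
  show "norm (- \<eta> * F_map S n L z (M \<eta>) \<eta> $ p $ q - mat 1 $ p $ q) \<le> decay_const / Im \<eta>" if "y0 \<le> Im \<eta>" for \<eta> p q
    by (rule F_map_asymptotics[OF regularD(2)[OF assms Im_ge_y0_pos[OF that]] that])
qed

lemma regular_eqI:
  assumes "regular P" "regular Q"
    and eq: "\<And>\<eta>. y0 \<le> Im \<eta> \<Longrightarrow> P \<eta> = Q \<eta>"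
    and \<eta>: "\<eta> \<in> upper_half_plane"
  shows "P \<eta> = Q \<eta>"
proof -
  have "P \<eta> $ p $ q = Q \<eta> $ p $ q" for p q
  proof (rule analytic_continuation_open[where f = "\<lambda>\<eta>. P \<eta> $ p $ q" and g = "\<lambda>\<eta>. Q \<eta> $ p $ q"])
    show "open {w. y0 < Im w}" "open upper_half_plane" "connected upper_half_plane"
      using open_halfspace_Im_gt open_upper_half_plane connected_upper_half_plane by auto
    have "Complex 0 (y0 + 1) \<in> {w. y0 < Im w}"
      by simp
    then show "{w. y0 < Im w} \<noteq> {}"
      by blast
    show "{w. y0 < Im w} \<subseteq> upper_half_plane"
      using Im_ge_y0_pos by (auto simp: upper_half_plane_def)
  qed (use assms regularD(1) in auto)
  then show ?thesis
    by (simp add: vec_eq_iff)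
qed

lemma solution_unique:
  assumes "regular P" "regular Q" "solves_equation S n L z P" "solves_equation S n L z Q" "\<eta> \<in> upper_half_plane"
  shows "P \<eta> = Q \<eta>"
proof (rule regular_eqI[OF assms(1,2) _ assms(5)])
  fix \<eta> assume \<eta>: "y0 \<le> Im \<eta>"
  then have pos: "0 < Im \<eta>"
    by (rule Im_ge_y0_pos)
  then have "P \<eta> = F_map S n L z (P \<eta>) \<eta>" "Q \<eta> = F_map S n L z (Q \<eta>) \<eta>"
    using assms(3,4) by (auto simp: solves_equation_def upper_half_plane_def)
  then have "mnorm (P \<eta> - Q \<eta>) \<le> mnorm (P \<eta> - Q \<eta>) / 2"
    using F_map_contraction[OF regularD(2)[OF assms(1) pos] regularD(2)[OF assms(2) pos] \<eta>] by metis
  then have "mnorm (P \<eta> - Q \<eta>) = 0"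
    using mnorm_nonneg[of "P \<eta> - Q \<eta>"] by linarith
  then show "P \<eta> = Q \<eta>"
    using mnorm_eq_0[of "P \<eta> - Q \<eta>"] by simp
qed

text \<open>The start is the transform of the unit mass at 0 times the identity.\<close>

primrec picard :: "nat \<Rightarrow> complex \<Rightarrow> complex^(2 \<times> 'N)^(2 \<times> 'N)" where
  "picard 0 \<eta> = mat (- 1 / \<eta>)"
| "picard (Suc k) \<eta> = F_map S n L z (picard k \<eta>) \<eta>"

lemma regular_picard: "regular (picard k)"
proof (induction k)
  case 0
  have "resolvent_like \<eta> (mat (- 1 / \<eta>) :: complex^(2 \<times> 'N)^(2 \<times> 'N))" if \<eta>: "0 < Im \<eta>" for \<eta>
  proof -
    have mat: "mat (- 1 / \<eta>) $ i $ j = - 1 / \<eta> * mat 1 $ i $ j" for i j :: "2 \<times> 'N"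
      by (simp add: mat_def)
    have qf: "qf x (mat (- 1 / \<eta>)) = complex_of_real ((norm x)\<^sup>2) * (- 1 / \<eta>)" for x :: "complex^(2 \<times> 'N)"
    proof -
      have "qf x (mat (- 1 / \<eta>)) = - 1 / \<eta> * qf x (mat 1)"
        unfolding qf_eq_sesq sesq_def mat sum_distrib_left by (intro sum.cong refl) (simp only: mult_ac)
      then show ?thesis
        by (simp only: qf_mat_1 mult.commute)
    qed
    have Im_scale: "Im (complex_of_real r * w) = r * Im w" for r w
      by simp
    have "0 < Im (- 1 / \<eta>)"
      using \<eta> by (simp add: Im_divide sum_power2_gt_zero_iff)
    then have "0 < Im (qf x (mat (- 1 / \<eta>)))" if "x \<noteq> 0" for x :: "complex^(2 \<times> 'N)"
      using that unfolding qf Im_scale by (intro mult_pos_pos) auto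
    moreover have "norm (qf x (mat (- 1 / \<eta>))) \<le> (norm x)\<^sup>2 / Im \<eta>" for x :: "complex^(2 \<times> 'N)"
      using abs_Im_le_cmod[of \<eta>] \<eta> unfolding qf norm_mult norm_of_real norm_divide by (simp add: frac_le)
    ultimately show ?thesis
      by (simp add: resolvent_like_def)
  qed
  moreover have "(\<lambda>\<eta>. (mat (- 1 / \<eta>) :: complex^(2 \<times> 'N)^(2 \<times> 'N)) $ p $ q) holomorphic_on upper_half_plane" for p q
    by (cases "p = q") (auto simp: mat_def upper_half_plane_def intro!: holomorphic_intros)
  ultimately show ?case
    by (simp add: regular_def)
next
  case (Suc k)
  show ?case
    using regular_F_map[OF Suc] by simp
qed

lemma mnorm_picard_diff:
  assumes "y0 \<le> Im \<eta>"
  shows "mnorm (picard (Suc k) \<eta> - picard k \<eta>) \<le> (1 / 2) ^ k * mnorm (picard 1 \<eta> - picard 0 \<eta>)"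
proof (induction k)
  case (Suc k)
  have "mnorm (picard (Suc (Suc k)) \<eta> - picard (Suc k) \<eta>) \<le> mnorm (picard (Suc k) \<eta> - picard k \<eta>) / 2"
    unfolding picard.simps(2)[of "Suc k"] picard.simps(2)[of k, symmetric]
    using F_map_contraction[OF regularD(2)[OF regular_picard Im_ge_y0_pos[OF assms]]
        regularD(2)[OF regular_picard Im_ge_y0_pos[OF assms]] assms, of "Suc k" k] by simp
  then show ?case
    using Suc by simp
qed simp

theorem solution_exists: "\<exists>P\<in>stieltjes_class. solves_equation S n L z P"
proof -
  define f where "f a k \<eta> = picard k \<eta> $ fst a $ snd a" for a k \<eta>
  have bdd: "\<exists>B. \<forall>k. \<forall>w\<in>C. norm (f a k w) \<le> B" if C: "compact C" "C \<subseteq> upper_half_plane" for a C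
  proof -
    obtain \<delta> where \<delta>: "0 < \<delta>" "\<And>w. w \<in> C \<Longrightarrow> \<delta> \<le> Im w"
      using compact_upper_half_plane_Im_ge[OF C] by blast
    have "norm (f a k w) \<le> 4 / \<delta>" if "w \<in> C" for k w
    proof -
      have pos: "0 < Im w"
        using \<delta>(1) \<delta>(2)[OF that] by linarith
      then have "norm (f a k w) \<le> 4 / Im w"
        unfolding f_def by (intro resolvent_like_entry_le[OF regularD(2)[OF regular_picard pos]])
      also have "\<dots> \<le> 4 / \<delta>"
        using \<delta>(1) \<delta>(2)[OF that] pos by (intro divide_left_mono) auto
      finally show ?thesis .
    qed
    then show ?thesis
      by blast
  qed
  have f_hol: "f a k holomorphic_on upper_half_plane" for a k
    unfolding f_def by (rule regularD(1)[OF regular_picard])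
  have "\<exists>r. strict_mono (r :: nat \<Rightarrow> nat) \<and> (\<forall>a\<in>UNIV.
      \<exists>g. g holomorphic_on upper_half_plane \<and> (\<forall>w\<in>upper_half_plane. (\<lambda>k. f a (r k) w) \<longlonglongrightarrow> g w))"
    by (rule Montel_finite_family[OF open_upper_half_plane finite f_hol bdd])
  then obtain r where r: "strict_mono (r :: nat \<Rightarrow> nat)"
    "\<forall>a. \<exists>g. g holomorphic_on upper_half_plane \<and> (\<forall>w\<in>upper_half_plane. (\<lambda>k. f a (r k) w) \<longlonglongrightarrow> g w)"
    by auto
  from choice[OF r(2)] obtain g where all: "\<forall>a. g a holomorphic_on upper_half_plane \<and>
      (\<forall>w\<in>upper_half_plane. (\<lambda>k. f a (r k) w) \<longlonglongrightarrow> g a w)" ..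
  have g: "g a holomorphic_on upper_half_plane"
    "w \<in> upper_half_plane \<Longrightarrow> (\<lambda>k. f a (r k) w) \<longlonglongrightarrow> g a w" for a w
    using spec[OF all, of a] by blast+
  define P where "P \<eta> = (\<chi> p q. g (p, q) \<eta>)" for \<eta>
  have hol: "(\<lambda>\<eta>. P \<eta> $ p $ q) holomorphic_on upper_half_plane" for p q
    unfolding P_def by (simp add: g(1))
  have lim: "(\<lambda>k. picard (r k) \<eta> $ p $ q) \<longlonglongrightarrow> P \<eta> $ p $ q" if "0 < Im \<eta>" for \<eta> p q
    using g(2)[of \<eta> "(p, q)"] that by (simp add: f_def P_def upper_half_plane_def)
  have lim_qf: "(\<lambda>k. qf x (picard (r k) \<eta>)) \<longlonglongrightarrow> qf x (P \<eta>)" if "0 < Im \<eta>" for x \<eta>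
    unfolding qf_eq_sesq sesq_def by (intro tendsto_intros lim that)
  have P: "P \<in> stieltjes_class"
  proof (rule stieltjes_classI[OF hol])
    fix \<eta> x assume \<eta>: "0 < Im \<eta>"
    note res = regularD(2)[OF regular_picard \<eta>]
    show "0 \<le> Im (qf x (P \<eta>))"
      by (rule tendsto_lowerbound[OF tendsto_Im[OF lim_qf[OF \<eta>]]])
        (rule always_eventually, intro allI Im_qf_nonneg[OF res], simp)
    have "norm (qf x (picard k \<eta>)) \<le> (norm x)\<^sup>2 / Im \<eta>" for k
      using res[of k] unfolding resolvent_like_def by blast
    then show "norm (qf x (P \<eta>)) \<le> (norm x)\<^sup>2 / Im \<eta>"
      by (intro tendsto_upperbound[OF tendsto_norm[OF lim_qf[OF \<eta>]]] always_eventually allI) simp_all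
  next
    fix \<eta> p q assume \<eta>: "y0 \<le> Im \<eta>"
    then have pos: "0 < Im \<eta>"
      by (rule Im_ge_y0_pos)
    \<comment> \<open>The bound is obtained for values of the map, so index 0 is set aside;
      \<open>r k\<close> is positive eventually.\<close>
    have step: "norm (- \<eta> * picard k \<eta> $ p $ q - mat 1 $ p $ q) \<le> decay_const / Im \<eta>" if "0 < k" for k
      using that F_map_asymptotics[OF regularD(2)[OF regular_picard pos] \<eta>] by (cases k) auto
    have "\<forall>\<^sub>F k in sequentially. 0 < r k"
      by (rule eventually_mono[OF eventually_gt_at_top[of 0]]) (rule less_le_trans[OF _ seq_suble[OF r(1)]])
    then have "\<forall>\<^sub>F k in sequentially. norm (- \<eta> * picard (r k) \<eta> $ p $ q - mat 1 $ p $ q) \<le> decay_const / Im \<eta>"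
      by (rule eventually_mono) (rule step)
    then show "norm (- \<eta> * P \<eta> $ p $ q - mat 1 $ p $ q) \<le> decay_const / Im \<eta>"
      by (intro tendsto_upperbound[OF tendsto_norm[OF tendsto_diff[OF tendsto_mult[OF tendsto_const lim[OF pos]] tendsto_const]]]) simp_all
  qed
  \<comment> \<open>The limit of the forms gave only \<open>0 \<le> Im\<close>. Strict positivity
    returns through the representing measure, which has positive mass for every nonzero
    vector.\<close>
  have regular: "regular P"
    by (rule stieltjes_class_regular[OF P])
  have fixed: "P \<eta> = F_map S n L z (P \<eta>) \<eta>" if \<eta>: "y0 \<le> Im \<eta>" for \<eta>
  proof -
    have pos: "0 < Im \<eta>"
      by (rule Im_ge_y0_pos[OF \<eta>])
    let ?d = "\<lambda>k. mnorm (picard (r k) \<eta> - P \<eta>)"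
    have d: "?d \<longlonglongrightarrow> 0"
      by (rule mnorm_tendsto[OF lim[OF pos]])
    have step: "(\<lambda>k. (1 / 2) ^ r k * mnorm (picard 1 \<eta> - picard 0 \<eta>)) \<longlonglongrightarrow> 0"
      using LIMSEQ_subseq_LIMSEQ[OF LIMSEQ_power_zero[of "1 / 2 :: real"] r(1)]
      by (intro tendsto_mult_left_zero) (simp add: comp_def)
    have "mnorm (P \<eta> - F_map S n L z (P \<eta>) \<eta>)
        \<le> ?d k + (1 / 2) ^ r k * mnorm (picard 1 \<eta> - picard 0 \<eta>) + ?d k / 2" for k
    proof -
      \<comment> \<open>The successor of \<open>r k\<close> need not belong to the subsequence, so
        applying the map to \<open>picard (r k) \<eta>\<close> may leave it; the geometric decay of
        consecutive differences bridges the gap.\<close>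
      have split: "P \<eta> - F_map S n L z (P \<eta>) \<eta> = (P \<eta> - picard (r k) \<eta>)
          + (picard (r k) \<eta> - picard (Suc (r k)) \<eta>) + (F_map S n L z (picard (r k) \<eta>) \<eta> - F_map S n L z (P \<eta>) \<eta>)"
        by simp
      have "mnorm (P \<eta> - F_map S n L z (P \<eta>) \<eta>) \<le> mnorm (P \<eta> - picard (r k) \<eta>)
          + mnorm (picard (r k) \<eta> - picard (Suc (r k)) \<eta>)
          + mnorm (F_map S n L z (picard (r k) \<eta>) \<eta> - F_map S n L z (P \<eta>) \<eta>)"
        unfolding split by (rule order_trans[OF mnorm_add_le add_right_mono[OF mnorm_add_le]])
      then show ?thesis
        using mnorm_picard_diff[OF \<eta>, of "r k"]
          F_map_contraction[OF regularD(2)[OF regular_picard pos] regularD(2)[OF regular pos] \<eta>, of "r k"]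
          mnorm_minus_commute[of "P \<eta>" "picard (r k) \<eta>"]
          mnorm_minus_commute[of "picard (r k) \<eta>" "picard (Suc (r k)) \<eta>"]
        by linarith
    qed
    moreover have "(\<lambda>k. ?d k + (1 / 2) ^ r k * mnorm (picard 1 \<eta> - picard 0 \<eta>) + ?d k / 2) \<longlonglongrightarrow> 0 + 0 + 0 / 2"
      by (intro tendsto_intros d step) simp
    ultimately have "mnorm (P \<eta> - F_map S n L z (P \<eta>) \<eta>) \<le> 0"
      by (intro LIMSEQ_le_const[where X = "\<lambda>k. ?d k + (1 / 2) ^ r k * mnorm (picard 1 \<eta> - picard 0 \<eta>) + ?d k / 2"]) simp_all
    then have "mnorm (P \<eta> - F_map S n L z (P \<eta>) \<eta>) = 0"
      using mnorm_nonneg[of "P \<eta> - F_map S n L z (P \<eta>) \<eta>"] by linarith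
    then show ?thesis
      using mnorm_eq_0[of "P \<eta> - F_map S n L z (P \<eta>) \<eta>"] by simp
  qed
  have "solves_equation S n L z P"
    unfolding solves_equation_def by (rule ballI, rule regular_eqI[OF regular regular_F_map[OF regular] fixed])
  then show ?thesis
    using P by blast
qed

end

section \<open>Symmetry\<close>

definition block_sign :: "2 \<Rightarrow> complex" where
  "block_sign i = (if i = 0 then 1 else - 1)"

lemma block_sign_square [simp]: "block_sign i * block_sign i = 1"
  and cnj_block_sign [simp]: "cnj (block_sign i) = block_sign i"
  by (simp_all add: block_sign_def)

text \<open>\<open>- J A\<^sup>* J\<close> with \<open>J\<close> the diagonal matrix of the signs of \<open>\<sigma>\<close>.\<close>

definition reflect :: "('m \<Rightarrow> 2) \<Rightarrow> complex^'m^'m \<Rightarrow> complex^'m^'m" where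
  "reflect \<sigma> A = (\<chi> p q. - (block_sign (\<sigma> p) * block_sign (\<sigma> q) * cnj (A $ q $ p)))"

lemma reflect_nth: "reflect \<sigma> A $ p $ q = - (block_sign (\<sigma> p) * block_sign (\<sigma> q) * cnj (A $ q $ p))"
  by (simp add: reflect_def)

text \<open>The adjoint reverses the product, the two minus signs cancel, and the signs at the
  summation index square to 1.\<close>

lemma reflect_mult: "(reflect \<sigma> A ** reflect \<sigma> B) $ p $ q
    = block_sign (\<sigma> p) * block_sign (\<sigma> q) * cnj ((B ** A) $ q $ p)"
proof -
  have "reflect \<sigma> A $ p $ k * reflect \<sigma> B $ k $ q
      = block_sign (\<sigma> p) * block_sign (\<sigma> q) * cnj (B $ q $ k * A $ k $ p)" for k
  proof -
    have "reflect \<sigma> A $ p $ k * reflect \<sigma> B $ k $ q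
        = (block_sign (\<sigma> k) * block_sign (\<sigma> k)) * (block_sign (\<sigma> p) * block_sign (\<sigma> q) * cnj (B $ q $ k * A $ k $ p))"
      unfolding reflect_nth by (simp add: mult_ac del: block_sign_square)
    then show ?thesis
      by simp
  qed
  then show ?thesis
    by (simp add: matrix_matrix_mult_def sum_distrib_left)
qed

lemma matrix_inv_reflect:
  assumes "invertible A" shows "matrix_inv (reflect \<sigma> A) = reflect \<sigma> (matrix_inv A)"
proof (rule matrix_inv_unique)
  have "(reflect \<sigma> A ** reflect \<sigma> (matrix_inv A)) $ p $ q = mat 1 $ p $ q" for p q
    unfolding reflect_mult matrix_inv_left[OF assms] by (simp add: mat_def)
  then show "reflect \<sigma> A ** reflect \<sigma> (matrix_inv A) = mat 1"
    by (simp add: vec_eq_iff)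
qed

definition sign_vec :: "('m \<Rightarrow> 2) \<Rightarrow> complex^'m \<Rightarrow> complex^'m" where
  "sign_vec \<sigma> x = (\<chi> p. block_sign (\<sigma> p) * x $ p)"

lemma norm_sign_vec: "norm (sign_vec \<sigma> x) = norm x"
proof -
  have "norm (sign_vec \<sigma> x $ i) = norm (x $ i)" for i
    by (simp add: sign_vec_def block_sign_def norm_mult)
  then show ?thesis
    by (simp add: norm_vec_def)
qed

lemma sign_vec_eq_0: "sign_vec \<sigma> x = 0 \<Longrightarrow> x = 0"
  using norm_sign_vec[of \<sigma> x] by simp

lemma qf_reflect: "qf x (reflect \<sigma> A) = - cnj (qf (sign_vec \<sigma> x) A)"
proof -
  have "cnj (qf (sign_vec \<sigma> x) A) = (\<Sum>j\<in>UNIV. \<Sum>i\<in>UNIV. cnj (x $ j) * x $ i * (block_sign (\<sigma> j) * block_sign (\<sigma> i) * cnj (A $ i $ j)))"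
    unfolding qf_eq_sesq sesq_def by (subst sum.swap) (simp add: sign_vec_def mult_ac)
  then show ?thesis
    unfolding qf_eq_sesq sesq_def reflect_nth by (simp add: sum_negf)
qed

lemma qf_scale: "qf (r *s x) A = cnj r * r * qf x A"
  by (simp add: qf_eq_sesq sesq_scale_left sesq_scale_right mult.assoc)

lemma resolvent_like_reflect:
  assumes "resolvent_like (- cnj \<eta>) A" shows "resolvent_like \<eta> (reflect \<sigma> A)"
  unfolding resolvent_like_def qf_reflect
proof (intro conjI allI impI)
  fix x :: "complex^'a" assume "x \<noteq> 0"
  then have "sign_vec \<sigma> x \<noteq> 0"
    using sign_vec_eq_0 by blast
  then have "0 < Im (qf (sign_vec \<sigma> x) A)"
    using assms unfolding resolvent_like_def by blast
  then show "0 < Im (- cnj (qf (sign_vec \<sigma> x) A))"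
    by simp
next
  fix x
  have "norm (qf (sign_vec \<sigma> x) A) \<le> (norm (sign_vec \<sigma> x))\<^sup>2 / Im (- cnj \<eta>)"
    using assms unfolding resolvent_like_def by blast
  then show "norm (- cnj (qf (sign_vec \<sigma> x) A)) \<le> (norm x)\<^sup>2 / Im \<eta>"
    by (simp add: norm_sign_vec)
qed

lemma holomorphic_on_reflect:
  assumes "f holomorphic_on upper_half_plane"
  shows "(\<lambda>\<eta>. cnj (f (- cnj \<eta>))) holomorphic_on upper_half_plane"
proof -
  have "(\<lambda>w. f (- w)) holomorphic_on cnj ` upper_half_plane"
    by (rule holomorphic_on_compose_gen[OF _ assms, unfolded comp_def])
      (auto intro: holomorphic_intros simp: upper_half_plane_def)
  from holomorphic_on_compose_cnj_cnj[OF this open_upper_half_plane] show ?thesis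
    by (simp add: comp_def)
qed

context matrix_equation
begin

lemma cnj_S_cis: "cnj (S (cis \<theta>) $ i $ k) = S (cis \<theta>) $ k $ i"
  using nonneg[of "cis \<theta>"] unfolding hermitian_nonneg_def by (metis norm_cis mem_sphere_0)

text \<open>\<open>U_mat L \<theta>\<close> is fixed: it is Hermitian and off-diagonal, so the minus
  sign and the block signs cancel. The block trace commutes with the reflection because \<Sigma> is
  Hermitian and acts inside the blocks.\<close>

lemma reflect_inner_mat:
  "inner_mat S n L (reflect fst M) \<theta> = reflect (\<lambda>p. p) (inner_mat S n L M \<theta>)"
proof -
  have T: "block_trace n (kronecker (mat 1) (S (cis \<theta>)) ** reflect fst M) $ p $ q
      = reflect (\<lambda>p. p) (block_trace n (kronecker (mat 1) (S (cis \<theta>)) ** M)) $ p $ q" for p q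
  proof -
    have "(\<Sum>i\<in>UNIV. \<Sum>k\<in>UNIV. S (cis \<theta>) $ i $ k * reflect fst M $ (p, k) $ (q, i))
        = (\<Sum>k\<in>UNIV. \<Sum>i\<in>UNIV. - (block_sign p * block_sign q * cnj (S (cis \<theta>) $ k $ i * M $ (q, i) $ (p, k))))"
      by (subst sum.swap) (simp add: reflect_nth cnj_S_cis mult_ac)
    also have "\<dots> = - (block_sign p * block_sign q * cnj (\<Sum>k\<in>UNIV. \<Sum>i\<in>UNIV. S (cis \<theta>) $ k $ i * M $ (q, i) $ (p, k)))"
      by (simp add: sum_negf sum_distrib_left)
    finally show ?thesis
      unfolding block_trace_entry reflect_nth by simp
  qed
  have "\<forall>p q. U_mat L \<theta> $ p $ q = - (block_sign p * block_sign q * cnj (U_mat L \<theta> $ q $ p))"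
    by (simp add: forall_2_iff block_sign_def cis_cnj)
  then have U: "U_mat L \<theta> $ p $ q = reflect (\<lambda>p. p) (U_mat L \<theta>) $ p $ q" for p q
    unfolding reflect_nth by blast
  have "inner_mat S n L (reflect fst M) \<theta> $ p $ q = reflect (\<lambda>p. p) (inner_mat S n L M \<theta>) $ p $ q" for p q
    unfolding inner_mat_def vector_add_component T
    by (subst U) (simp add: reflect_nth algebra_simps)
  then show ?thesis
    by (simp add: vec_eq_iff)
qed

lemma reflect_F_integrand:
  assumes "resolvent_like \<eta> M"
  shows "F_integrand S n L (reflect fst M) \<theta> = reflect fst (F_integrand S n L M \<theta>)"
proof -
  show ?thesis
    unfolding vec_eq_iff F_integrand_entry reflect_inner_mat matrix_inv_reflect[OF invertible_inner_mat[OF assms]] reflect_nth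
    by (simp add: cnj_S_cis)
qed

text \<open>Off the diagonal of the \<eta>, z matrix the signs cancel as for \<open>U_mat\<close>,
  so \<open>z\<close> and \<open>cnj z\<close> stay. On the diagonal the negative conjugate acts
  alone, which is why \<eta> is traded for \<open>- cnj \<eta>\<close>.\<close>

lemma reflect_outer_mat:
  assumes M: "resolvent_like (- cnj \<eta>) M" and \<eta>: "0 < Im \<eta>"
  shows "outer_mat S n L z (reflect fst M) \<eta> = reflect fst (outer_mat S n L z M (- cnj \<eta>))"
proof -
  have M': "resolvent_like \<eta> (reflect fst M)"
    by (rule resolvent_like_reflect[OF M])
  have K: "K (reflect fst M) $ p $ q = - (block_sign (fst p) * block_sign (fst q) * cnj (K M $ q $ p))" for p q
  proof -
    have "integral {0..2 * pi} (\<lambda>\<theta>. - (block_sign (fst p) * block_sign (fst q)) * cnj (F_integrand S n L M \<theta> $ q $ p))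
        = - (block_sign (fst p) * block_sign (fst q)) * cnj (integral {0..2 * pi} (\<lambda>\<theta>. F_integrand S n L M \<theta> $ q $ p))"
      unfolding Henstock_Kurzweil_Integration.integral_mult_right Henstock_Kurzweil_Integration.integral_cnj ..
    then show ?thesis
      unfolding K_entry[OF M] K_entry[OF M'] reflect_F_integrand[OF M] reflect_nth
      by (simp add: scaleR_conv_of_real mult_ac)
  qed
  have Z: "\<forall>a b. matrix2 \<eta> z (cnj z) \<eta> $ a $ b = - (block_sign a * block_sign b * cnj (matrix2 (- cnj \<eta>) z (cnj z) (- cnj \<eta>) $ b $ a))"
    by (simp add: forall_2_iff block_sign_def)
  have Z': "kronecker (matrix2 \<eta> z (cnj z) \<eta>) (mat 1) $ p $ q
      = - (block_sign (fst p) * block_sign (fst q) * cnj (kronecker (matrix2 (- cnj \<eta>) z (cnj z) (- cnj \<eta>)) (mat 1) $ q $ p))" for p q :: "2 \<times> 'N"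
    unfolding kronecker_def vec_lambda_beta Z[rule_format, of "fst p" "fst q"] by (simp add: mat_def)
  show ?thesis
    unfolding vec_eq_iff outer_mat_eq vector_minus_component K Z' reflect_nth by (simp add: algebra_simps)
qed

lemma reflect_solution:
  assumes P: "regular P" "solves_equation S n L z P"
  shows "regular (\<lambda>\<eta>. reflect fst (P (- cnj \<eta>)))" "solves_equation S n L z (\<lambda>\<eta>. reflect fst (P (- cnj \<eta>)))"
proof -
  show "regular (\<lambda>\<eta>. reflect fst (P (- cnj \<eta>)))"
    unfolding regular_def
  proof (intro conjI allI impI)
    show "(\<lambda>\<eta>. reflect fst (P (- cnj \<eta>)) $ p $ q) holomorphic_on upper_half_plane" for p q
      unfolding reflect_nth
      by (rule holomorphic_on_minus[OF holomorphic_on_mult[OF holomorphic_on_const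
            holomorphic_on_reflect[OF regularD(1)[OF P(1)]]]])
    show "resolvent_like \<eta> (reflect fst (P (- cnj \<eta>)))" if "0 < Im \<eta>" for \<eta>
      using that by (intro resolvent_like_reflect regularD(2)[OF P(1)]) simp
  qed
  show "solves_equation S n L z (\<lambda>\<eta>. reflect fst (P (- cnj \<eta>)))"
    unfolding solves_equation_def
  proof
    fix \<eta> assume "\<eta> \<in> upper_half_plane"
    then have \<eta>: "0 < Im \<eta>" "0 < Im (- cnj \<eta>)"
      by (simp_all add: upper_half_plane_def)
    note M = regularD(2)[OF P(1) \<eta>(2)]
    have "P (- cnj \<eta>) = matrix_inv (outer_mat S n L z (P (- cnj \<eta>)) (- cnj \<eta>))"
      using P(2) \<eta>(2) by (simp add: solves_equation_def F_map_def upper_half_plane_def)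
    then show "reflect fst (P (- cnj \<eta>)) = F_map S n L z (reflect fst (P (- cnj \<eta>))) \<eta>"
      unfolding F_map_def reflect_outer_mat[OF M \<eta>(1)] matrix_inv_reflect[OF invertible_outer_mat[OF M \<eta>(2)]]
      by simp
  qed
qed

end

lemma poisson_uminus: "poisson \<eta> (- t) = poisson (- cnj \<eta>) t"
  by (simp add: poisson_def power2_eq_square algebra_simps)

lemma vimage_uminus: "uminus -` B = uminus ` (B :: real set)"
  by (auto simp: image_iff) (metis minus_minus)

text \<open>The image of \<open>m\<close> under \<open>uminus\<close> has at \<eta> the Poisson
  integral that \<open>m\<close> has at \<open>- cnj \<eta>\<close>. By \<open>sym\<close> the two
  agree, and Poisson integrals determine a finite measure.\<close>

lemma measure_symmetric:
  assumes "finite_borel_measure m"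
    and sym: "\<And>\<eta>. 0 < Im \<eta> \<Longrightarrow> stieltjes m \<eta> = - cnj (stieltjes m (- cnj \<eta>))"
    and B: "B \<in> sets borel"
  shows "measure m (uminus ` B) = measure m B"
proof -
  interpret finite_borel_measure m by fact
  have meas: "uminus \<in> measurable m borel"
    by (simp add: measurable_cong_sets[OF M_is_borel refl])
  define m' where "m' = distr m borel (uminus :: real \<Rightarrow> real)"
  interpret m': finite_borel_measure m'
    unfolding m'_def using finite_measure_distr[OF meas]
    by (simp add: finite_borel_measure_def finite_borel_measure_axioms_def)
  have "measure m B = measure m' B"
  proof (rule measure_eq_of_poisson_eq[OF finite_borel_measure_axioms m'.finite_borel_measure_axioms _ B])
    fix \<eta> assume \<eta>: "0 < Im \<eta>"
    have "integral\<^sup>L m' (poisson \<eta>) = integral\<^sup>L m (poisson (- cnj \<eta>))"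
      unfolding m'_def by (subst integral_distr[OF meas poisson_measurable]) (simp add: poisson_uminus)
    also have "\<dots> = Im (stieltjes m (- cnj \<eta>))"
      using \<eta> by (subst Im_stieltjes) simp_all
    also have "\<dots> = Im (stieltjes m \<eta>)"
      using sym[OF \<eta>] by simp
    also have "\<dots> = integral\<^sup>L m (poisson \<eta>)"
      by (rule Im_stieltjes[OF \<eta>])
    finally show "integral\<^sup>L m (poisson \<eta>) = integral\<^sup>L m' (poisson \<eta>)" ..
  qed
  also have "\<dots> = measure m (uminus -` B)"
    unfolding m'_def using measure_distr[OF meas B] by (simp add: borel_UNIV)
  also have "uminus -` B = uminus ` B"
    by (rule vimage_uminus)
  finally show ?thesis ..
qed

lemma qf_block: "qf x (block i i A) = qf (\<chi> p. if fst p = i then x $ snd p else 0) A"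
proof -
  have single: "(\<Sum>p\<in>UNIV. if fst p = i then h p else 0) = (\<Sum>b\<in>UNIV. h (i, b))"
    for h :: "2 \<times> 'a \<Rightarrow> complex"
  proof -
    have "(\<Sum>b\<in>UNIV. if a = i then h (a, b) else 0) = (if a = i then (\<Sum>b\<in>UNIV. h (a, b)) else 0)" for a
      by simp
    then show ?thesis
      by (simp add: sum_UNIV_prod)
  qed
  have "qf (\<chi> p. if fst p = i then x $ snd p else 0) A = (\<Sum>p\<in>UNIV. if fst p = i then
      (\<Sum>q\<in>UNIV. if fst q = i then cnj (x $ snd p) * x $ snd q * A $ p $ q else 0) else 0)"
    unfolding qf_eq_sesq sesq_def
  proof (rule sum.cong[OF refl])
    fix p
    show "(\<Sum>q\<in>UNIV. cnj ((\<chi> p. if fst p = i then x $ snd p else 0) $ p) * (\<chi> p. if fst p = i then x $ snd p else 0) $ q * A $ p $ q)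
      = (if fst p = i then (\<Sum>q\<in>UNIV. if fst q = i then cnj (x $ snd p) * x $ snd q * A $ p $ q else 0) else 0)"
      by (cases "fst p = i") (auto intro!: sum.cong)
  qed
  then show ?thesis
    unfolding single by (simp add: qf_eq_sesq sesq_def block_def)
qed

lemma matrix_measure_block:
  assumes "matrix_measure \<Lambda>" shows "matrix_measure (\<lambda>B. block i i (\<Lambda> B))"
  unfolding matrix_measure_def
proof (intro conjI ballI allI impI)
  show "hermitian_nonneg (block i i (\<Lambda> B))" if "B \<in> sets borel" for B
    using assms that by (simp add: matrix_measure_def hermitian_nonneg_iff qf_block)
  show "block i i (\<Lambda> {}) = 0"
    using assms by (simp add: matrix_measure_def block_def vec_eq_iff)
  fix A :: "nat \<Rightarrow> real set" assume "range A \<subseteq> sets borel" "disjoint_family A"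
  then have sums: "(\<lambda>k. \<Lambda> (A k)) sums \<Lambda> (\<Union>k. A k)"
    using assms by (simp add: matrix_measure_def)
  have "(\<lambda>k. \<Lambda> (A k) $ p $ q) sums (\<Lambda> (\<Union>k. A k) $ p $ q)" for p q
    by (rule bounded_linear.sums[OF bounded_linear_entry sums])
  then show "(\<lambda>k. block i i (\<Lambda> (A k))) sums block i i (\<Lambda> (\<Union>k. A k))"
    unfolding sums_def block_def by (intro vec_tendstoI) simp
qed

context matrix_equation
begin

text \<open>Uniqueness makes \<open>P\<close> invariant under the reflection. A vector supported in
  one block is an eigenvector of J, so the invariance becomes a symmetry of its scalar measure; the
  polarization vectors for the entries of a diagonal block are of this kind.\<close>

lemma solution_measure_symmetric:
  assumes P: "P \<in> stieltjes_class" "solves_equation S n L z P"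
    and \<Lambda>: "matrix_measure \<Lambda>" "is_stieltjes_transform_of P \<Lambda>"
    and B: "B \<in> sets borel"
  shows "block i i (\<Lambda> B) = block i i (\<Lambda> (uminus ` B))"
proof -
  note regular = stieltjes_class_regular[OF P(1)]
  have B': "uminus ` B \<in> sets borel"
  proof -
    have "uminus ` B = uminus -` B"
      by (rule vimage_uminus[symmetric])
    also have "\<dots> \<in> sets borel"
      using measurable_sets[of uminus borel borel B] B by simp
    finally show ?thesis .
  qed
  have qf_sym: "qf x (\<Lambda> B) = qf x (\<Lambda> (uminus ` B))"
    if x: "sign_vec fst x = block_sign i *s x" for x :: "complex^(2 \<times> 'N)"
  proof -
    obtain m where m: "finite_borel_measure m" "\<And>B. B \<in> sets borel \<Longrightarrow> complex_of_real (measure m B) = qf x (\<Lambda> B)"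
      using matrix_measure_qf[OF \<Lambda>(1)] by blast
    note stieltjes = qf_stieltjes_transform[OF \<Lambda>(2) m]
    have "stieltjes m \<eta> = - cnj (stieltjes m (- cnj \<eta>))" if \<eta>: "0 < Im \<eta>" for \<eta>
    proof -
      have "P \<eta> = reflect fst (P (- cnj \<eta>))"
        using \<eta> by (intro solution_unique[OF regular reflect_solution(1)[OF regular P(2)] P(2)
              reflect_solution(2)[OF regular P(2)]]) (simp add: upper_half_plane_def)
      then have "qf x (P \<eta>) = - cnj (qf (sign_vec fst x) (P (- cnj \<eta>)))"
        by (metis qf_reflect)
      \<comment> \<open>The sign enters the form twice and squares to 1.\<close>
      also have "qf (sign_vec fst x) (P (- cnj \<eta>)) = qf x (P (- cnj \<eta>))"
        unfolding x qf_scale by simp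
      finally show ?thesis
        using stieltjes[of \<eta>] stieltjes[of "- cnj \<eta>"] \<eta> by simp
    qed
    from measure_symmetric[OF m(1) this B] show ?thesis
      using m(2)[OF B] m(2)[OF B'] by simp
  qed
  have "\<Lambda> B $ (i, k) $ (i, l) = \<Lambda> (uminus ` B) $ (i, k) $ (i, l)" for k l
  proof -
    have "sign_vec fst (polar_vec (i, k) (i, l) j) = block_sign i *s polar_vec (i, k) (i, l) j" for j
      by (auto simp: vec_eq_iff sign_vec_def polar_vec_def axis_def distrib_left)
    then show ?thesis
      unfolding polarization[of "\<Lambda> _"] by (simp only: qf_sym)
  qed
  then show ?thesis
    by (simp add: vec_eq_iff block_def)
qed

end

theorem theorem5:
  fixes \<Sigma> :: "complex \<Rightarrow> complex^'N^'N" and n L :: nat and z :: complex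
  assumes "1 \<le> n" and "1 \<le> L"
    and "continuous_on (sphere 0 1) \<Sigma>"
    and "\<forall>w\<in>sphere 0 1. hermitian_nonneg (\<Sigma> w)"
  shows
    "(\<forall>M\<in>stieltjes_class.
        (\<forall>\<eta>\<in>upper_half_plane. F_well_defined \<Sigma> n L z (M \<eta>) \<eta>) \<and>
        (\<lambda>\<eta>. F_map \<Sigma> n L z (M \<eta>) \<eta>) \<in> stieltjes_class) \<and>
     (\<exists>P\<in>stieltjes_class. solves_equation \<Sigma> n L z P \<and>
        (\<forall>Q\<in>stieltjes_class. solves_equation \<Sigma> n L z Q \<longrightarrow>
           (\<forall>\<eta>\<in>upper_half_plane. Q \<eta> = P \<eta>))) \<and>
     (\<forall>P\<in>stieltjes_class. \<forall>\<Lambda>.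
        solves_equation \<Sigma> n L z P \<longrightarrow> matrix_measure \<Lambda> \<longrightarrow> is_stieltjes_transform_of P \<Lambda> \<longrightarrow>
        (\<forall>i. matrix_measure (\<lambda>B. block i i (\<Lambda> B)) \<and>
             is_stieltjes_transform_of (\<lambda>\<eta>. block i i (P \<eta>)) (\<lambda>B. block i i (\<Lambda> B)) \<and>
             (\<forall>B\<in>sets borel. block i i (\<Lambda> B) = block i i (\<Lambda> (uminus ` B)))))"
proof -
  interpret matrix_equation \<Sigma> n L z
    using assms by unfold_locales auto
  show ?thesis
  proof (intro conjI ballI allI impI)
    fix M :: "complex \<Rightarrow> complex^(2 \<times> 'N)^(2 \<times> 'N)" assume M: "M \<in> stieltjes_class"
    show "F_well_defined \<Sigma> n L z (M \<eta>) \<eta>" if "\<eta> \<in> upper_half_plane" for \<eta>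
      using that stieltjes_class_resolvent_like[OF M] by (simp add: upper_half_plane_def F_well_definedI)
    show "(\<lambda>\<eta>. F_map \<Sigma> n L z (M \<eta>) \<eta>) \<in> stieltjes_class"
      by (rule F_map_stieltjes_class[OF stieltjes_class_regular[OF M]])
  next
    obtain P where P: "P \<in> stieltjes_class" "solves_equation \<Sigma> n L z P"
      using solution_exists by blast
    have "Q \<eta> = P \<eta>" if "Q \<in> stieltjes_class" "solves_equation \<Sigma> n L z Q" "\<eta> \<in> upper_half_plane" for Q \<eta>
      by (rule solution_unique[OF stieltjes_class_regular[OF that(1)] stieltjes_class_regular[OF P(1)] that(2) P(2) that(3)])
    with P show "\<exists>P\<in>stieltjes_class. solves_equation \<Sigma> n L z P \<and>
        (\<forall>Q\<in>stieltjes_class. solves_equation \<Sigma> n L z Q \<longrightarrow> (\<forall>\<eta>\<in>upper_half_plane. Q \<eta> = P \<eta>))"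
      by blast
  next
    fix P and \<Lambda> :: "real set \<Rightarrow> complex^(2 \<times> 'N)^(2 \<times> 'N)" and i
    assume P: "P \<in> stieltjes_class" "solves_equation \<Sigma> n L z P"
      and \<Lambda>: "matrix_measure \<Lambda>" "is_stieltjes_transform_of P \<Lambda>"
    show "matrix_measure (\<lambda>B. block i i (\<Lambda> B))"
      by (rule matrix_measure_block[OF \<Lambda>(1)])
    show "is_stieltjes_transform_of (\<lambda>\<eta>. block i i (P \<eta>)) (\<lambda>B. block i i (\<Lambda> B))"
      using \<Lambda>(2) by (simp add: is_stieltjes_transform_of_def block_def)
    show "block i i (\<Lambda> B) = block i i (\<Lambda> (uminus ` B))" if "B \<in> sets borel" for B
      by (rule solution_measure_symmetric[OF P \<Lambda> that])
  qed
qed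

end
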